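(* Let $p\ge3$ be a prime, let $k$ be a field of characteristic $p$, and let $\lambda\vdash n$ be a partition which is not a James partition. Then $\dim_k H^1(\mathcal{S}_n,S^\lambda)\le 1$.
   Context: $\mathcal{S}_n$ is the symmetric group, $S^\lambda$ is the Specht module over $k$ in James' convention (the submodule of the permutation module $M^\lambda$ on $\lambda$-tabloids spanned by the polytabloids), and $H^1(\mathcal{S}_n,S^\lambda)=\mathrm{Ext}^1_{k\mathcal{S}_n}(k,S^\lambda)$ with $k$ the trivial module. A partition $\lambda=(\lambda_1,\dots,\lambda_r)$ with all $\lambda_i>0$ is a James partition if $\binom{\lambda_i+j}{j}\equiv 0\pmod p$ for all $1\le i<r$ and all $1\le j\le\lambda_{i+1}$. *)

theory Defs
  imports
    "HOL-Algebra.Sym_Groups"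
    "HOL-Algebra.AbelCoset"
    "HOL-Combinatorics.Permutations"
    "HOL-Computational_Algebra.Primes"
    "Jordan_Normal_Form.VS_Connect"
begin

section \<open>Partitions\<close>

definition partition_of :: "nat list \<Rightarrow> nat \<Rightarrow> bool" where
  "partition_of la n \<longleftrightarrow> sorted_wrt (\<ge>) la \<and> (\<forall>x \<in> set la. x > 0) \<and> sum_list la = n"

text \<open>Rows are numbered from \<open>0\<close>, so \<open>la ! i\<close> is the part $\lambda_{i+1}$.\<close>

definition james_partition :: "nat \<Rightarrow> nat list \<Rightarrow> bool" where
  "james_partition p la \<longleftrightarrow>
     (\<forall>i. Suc i < length la \<longrightarrow>
        (\<forall>j \<in> {1..la ! Suc i}. p dvd ((la ! i + j) choose j)))"


section \<open>Tableaux and tabloids\<close>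

definition young_diagram :: "nat list \<Rightarrow> (nat \<times> nat) set" where
  "young_diagram la = {(i, j). i < length la \<and> j < la ! i}"

text \<open>
  A tableau is a bijection from the diagram to \<open>{1..n}\<close>.  Off the diagram it takes the value
  \<open>0\<close>, which every permutation of \<open>{1..n}\<close> fixes; so the symmetric group acts on tableaux by
  plain composition.
\<close>

definition tableaux :: "nat list \<Rightarrow> (nat \<times> nat \<Rightarrow> nat) set" where
  "tableaux la = {t. bij_betw t (young_diagram la) {1..sum_list la} \<and>
                     (\<forall>c. c \<notin> young_diagram la \<longrightarrow> t c = 0)}"

definition row_stabilizer :: "nat list \<Rightarrow> (nat \<times> nat \<Rightarrow> nat) \<Rightarrow> (nat \<Rightarrow> nat) set" where
  "row_stabilizer la t = {\<pi>. \<pi> permutes {1..sum_list la} \<and>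
     (\<forall>i j. (i, j) \<in> young_diagram la \<longrightarrow>
        (\<exists>j'. (i, j') \<in> young_diagram la \<and> \<pi> (t (i, j)) = t (i, j')))}"

definition column_stabilizer :: "nat list \<Rightarrow> (nat \<times> nat \<Rightarrow> nat) \<Rightarrow> (nat \<Rightarrow> nat) set" where
  "column_stabilizer la t = {\<pi>. \<pi> permutes {1..sum_list la} \<and>
     (\<forall>i j. (i, j) \<in> young_diagram la \<longrightarrow>
        (\<exists>i'. (i', j) \<in> young_diagram la \<and> \<pi> (t (i, j)) = t (i', j)))}"

type_synonym tabloid = "(nat \<times> nat \<Rightarrow> nat) set"

definition tabloid_of :: "nat list \<Rightarrow> (nat \<times> nat \<Rightarrow> nat) \<Rightarrow> tabloid" where
  "tabloid_of la t = (\<lambda>\<pi>. \<pi> \<circ> t) ` row_stabilizer la t"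

definition tabloids :: "nat list \<Rightarrow> tabloid set" where
  "tabloids la = tabloid_of la ` tableaux la"

definition tabloid_action :: "(nat \<Rightarrow> nat) \<Rightarrow> tabloid \<Rightarrow> tabloid" where
  "tabloid_action \<pi> T = (\<lambda>s. \<pi> \<circ> s) ` T"


section \<open>Permutation modules and Specht modules\<close>

text \<open>
  An element of $M^\lambda$ is its coefficient function on tabloids.  The ring-multiplication
  fields of the record type \<open>module\<close> play no role for modules and are left unspecified.
\<close>

definition perm_module :: "nat list \<Rightarrow> ('k :: field, tabloid \<Rightarrow> 'k) module" where
  "perm_module la =
     \<lparr> carrier = {v. \<forall>T. T \<notin> tabloids la \<longrightarrow> v T = 0},
       mult = undefined, one = undefined,
       zero = (\<lambda>T. 0), add = (\<lambda>v w T. v T + w T), smult = (\<lambda>c v T. c * v T) \<rparr>"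

text \<open>The linear extension of \<open>tabloid_action\<close>, written on coefficient functions.\<close>

definition perm_action :: "(nat \<Rightarrow> nat) \<Rightarrow> (tabloid \<Rightarrow> 'k) \<Rightarrow> (tabloid \<Rightarrow> 'k)" where
  "perm_action \<pi> v = (\<lambda>T. v (tabloid_action (inv' \<pi>) T))"

text \<open>$e_t = \sum_{\pi \in C_t} \mathrm{sgn}(\pi)\, \pi\{t\}$.\<close>

definition polytabloid ::
  "nat list \<Rightarrow> (nat \<times> nat \<Rightarrow> nat) \<Rightarrow> (tabloid \<Rightarrow> 'k :: field)" where
  "polytabloid la t = (\<lambda>T. \<Sum>\<pi> \<in> column_stabilizer la t.
     if T = tabloid_action \<pi> (tabloid_of la t) then of_int (sign \<pi>) else 0)"

definition specht_module :: "nat list \<Rightarrow> ('k :: field, tabloid \<Rightarrow> 'k) module" where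
  "specht_module la = perm_module la
     \<lparr> carrier := LinearCombinations.module.span class_ring (perm_module la)
                    (polytabloid la ` tableaux la) \<rparr>"


section \<open>Group cohomology\<close>

text \<open>
  As for products of cosets in \<open>rcoset_mult\<close>, the scalar multiple of a coset \<open>X\<close> is saturated
  by \<open>W\<close>: the plain image of \<open>X\<close> under the scalar \<open>0\<close> would not be a coset.
\<close>

definition quotient_module :: "('k :: field, 'v) module \<Rightarrow> 'v set \<Rightarrow> ('k, 'v set) module" where
  "quotient_module V W =
     \<lparr> carrier = a_rcosets\<^bsub>V\<^esub> W, mult = undefined, one = undefined,
       zero = W, add = set_add V, smult = (\<lambda>c X. \<Union>x \<in> X. W +>\<^bsub>V\<^esub> (c \<odot>\<^bsub>V\<^esub> x)) \<rparr>"

definition tuples :: "('g, 'm) monoid_scheme \<Rightarrow> nat \<Rightarrow> 'g list set" where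
  "tuples G m = {gs. set gs \<subseteq> carrier G \<and> length gs = m}"

text \<open>
  $\mathrm{Ext}^q_{kG}(k, V)$ is computed from the standard resolution of the trivial module $k$,
  whose term in degree \<open>q\<close> is the free module $k[G^{q+1}]$ with \<open>G\<close> acting diagonally.  A
  homomorphism $k[G^{q+1}] \to V$ is an equivariant map $G^{q+1} \to V$, and the differential of
  the resolution is the alternating sum of the maps omitting one entry.  The action of \<open>G\<close> on
  \<open>V\<close> is the argument \<open>\<rho>\<close>.
\<close>

definition cochains ::
  "('g, 'm) monoid_scheme \<Rightarrow> ('k :: field, 'v) module \<Rightarrow> ('g \<Rightarrow> 'v \<Rightarrow> 'v) \<Rightarrow> nat \<Rightarrow>
     ('k, 'g list \<Rightarrow> 'v) module" where
  "cochains G V \<rho> q =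
     \<lparr> carrier = {f \<in> tuples G (q + 1) \<rightarrow>\<^sub>E carrier V.
                   \<forall>g \<in> carrier G. \<forall>gs \<in> tuples G (q + 1).
                     f (map (\<lambda>h. g \<otimes>\<^bsub>G\<^esub> h) gs) = \<rho> g (f gs)},
       mult = undefined, one = undefined,
       zero = (\<lambda>gs \<in> tuples G (q + 1). \<zero>\<^bsub>V\<^esub>),
       add = (\<lambda>f h. \<lambda>gs \<in> tuples G (q + 1). f gs \<oplus>\<^bsub>V\<^esub> h gs),
       smult = (\<lambda>c f. \<lambda>gs \<in> tuples G (q + 1). c \<odot>\<^bsub>V\<^esub> f gs) \<rparr>"

definition coboundary ::
  "('g, 'm) monoid_scheme \<Rightarrow> ('k :: field, 'v) module \<Rightarrow> nat \<Rightarrow> ('g list \<Rightarrow> 'v) \<Rightarrow>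
     ('g list \<Rightarrow> 'v)" where
  "coboundary G V q f =
     (\<lambda>gs \<in> tuples G (q + 2).
        \<Oplus>\<^bsub>V\<^esub>i \<in> {..q + 1}. ((- 1) ^ i) \<odot>\<^bsub>V\<^esub> f (take i gs @ drop (Suc i) gs))"

definition cocycles ::
  "('g, 'm) monoid_scheme \<Rightarrow> ('k :: field, 'v) module \<Rightarrow> ('g \<Rightarrow> 'v \<Rightarrow> 'v) \<Rightarrow> nat \<Rightarrow>
     ('g list \<Rightarrow> 'v) set" where
  "cocycles G V \<rho> q =
     {f \<in> carrier (cochains G V \<rho> q). coboundary G V q f = \<zero>\<^bsub>cochains G V \<rho> (q + 1)\<^esub>}"

definition coboundaries ::
  "('g, 'm) monoid_scheme \<Rightarrow> ('k :: field, 'v) module \<Rightarrow> ('g \<Rightarrow> 'v \<Rightarrow> 'v) \<Rightarrow> nat \<Rightarrow>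
     ('g list \<Rightarrow> 'v) set" where
  "coboundaries G V \<rho> q =
     (if q = 0 then {\<zero>\<^bsub>cochains G V \<rho> 0\<^esub>}
      else coboundary G V (q - 1) ` carrier (cochains G V \<rho> (q - 1)))"

definition group_cohomology ::
  "nat \<Rightarrow> ('g, 'm) monoid_scheme \<Rightarrow> ('k :: field, 'v) module \<Rightarrow> ('g \<Rightarrow> 'v \<Rightarrow> 'v) \<Rightarrow>
     ('k, ('g list \<Rightarrow> 'v) set) module" where
  "group_cohomology q G V \<rho> =
     quotient_module (cochains G V \<rho> q \<lparr> carrier := cocycles G V \<rho> q \<rparr>) (coboundaries G V \<rho> q)"

end

theory Submission
  imports Defs
begin

text \<open>
  Write $M$ for the permutation module and $S$ for the Specht module.  Since $p$ is odd, a
  homomorphism from a Young subgroup to the additive group of $k$ kills all transpositions, so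
  $H^1(\mathcal{S}_n, M) = 0$: every cocycle with values in $S$ has the form $q \mapsto qu - u$ for
  some \<open>u\<close> in $M$ that is fixed modulo $S$ (\<open>crossed_hom_principal\<close>, \<open>cocycle_eq_delta\<close>).  The
  cocycle is a coboundary as soon as \<open>u\<close> lies in $S + M^{\mathcal{S}_n}$, and $M^{\mathcal{S}_n}$ is
  spanned by the sum \<open>all_ones\<close> of all tabloids.  So it suffices to find, for any two vectors fixed
  modulo $S$, a nontrivial combination of them that lies in $S + M^{\mathcal{S}_n}$
  (\<open>combination_in_raising_kernel\<close>).

  Membership in $S$ is tested with the kernel intersection theorem of James
  (\<open>carrier_specht_module\<close>).  Encode a tabloid by the word \<open>w\<close> that sends an entry to its row.
  The divided power $e_i^{(a)}$ moves \<open>a\<close> entries from row $i+1$ to row $i$ in all possible ways, and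
  $S$ is the common kernel of all $e_i^{(a)}$ with $a \ge 1$.  If \<open>u\<close> is fixed modulo $S$, then
  $e_i^{(a)} u$ is an invariant of a permutation module, hence a multiple $c_i(a)$ of the sum of all
  words, and \<open>u\<close> lies in $S$ exactly if all the numbers $c_i(a)$ vanish.

  The numbers $c_i(a)$ inherit linear relations from the relations between divided powers:
  $e_i^{(a)} e_i^{(b)} = \binom{a+b}{a} e_i^{(a+b)}$, commutation of $e_i$ and $e_j$ for
  $|i-j| \ge 2$, and the straightening of $e_i^{(a)} e_{i+1}^{(b)}$ (locales \<open>constant_raising\<close> and
  \<open>coherent_family\<close>).  For the vector \<open>all_ones\<close> they are $J_i(a) = \binom{\lambda_i+a}{a}$, so
  $\lambda$ is a James partition exactly if this family vanishes.  If it does not vanish, let \<open>i\<close> be the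
  first row with $J_i \ne 0$ and \<open>a\<close> the least argument with $J_i(a) \ne 0$; then $a = p^s$, and the
  relations show that a family satisfying them is zero once $c_i(p^s)$ and one further coefficient
  vanish (\<open>coherent_family_eq_0\<close>).  Hence these families form a space of dimension at most two,
  one dimension of which is spanned by $J$, the family of the invariant vector.  The quotient,
  in which $H^1(\mathcal{S}_n, S)$ embeds, has dimension at most one.
\<close>

section \<open>Binomial coefficients modulo a prime\<close>

locale field_of_char =
  fixes p :: nat and K :: "'k :: field itself"
  assumes prime_p: "prime p" and char_p: "CHAR('k) = p"
begin

lemma of_nat_eq_0: "(of_nat m :: 'k) = 0 \<longleftrightarrow> p dvd m"
  using of_nat_eq_0_iff_char_dvd[where 'a = 'k, of m] char_p by simp

lemma p_gt_1: "p > 1"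
  using prime_p prime_gt_1_nat by blast

lemma p_pos [simp]: "0 < p" "p \<noteq> 0"
  using p_gt_1 by simp_all

lemma ppow_pos: "p ^ s > 0"
  by simp

lemma ppow_choose_eq_0:
  assumes "0 < i" "i < p ^ s"
  shows "(of_nat (p ^ s choose i) :: 'k) = 0"
proof -
  have e: "i * (p ^ s choose i) = p ^ s * ((p ^ s - 1) choose (i - 1))"
    using times_binomial_minus1_eq[of i "p ^ s"] assms by simp
  have "p dvd (p ^ s choose i)"
  proof (rule ccontr)
    assume "\<not> p dvd (p ^ s choose i)"
    then have "coprime (p ^ s) (p ^ s choose i)"
      using prime_p by (simp add: prime_imp_coprime)
    moreover have "p ^ s dvd i * (p ^ s choose i)"
      unfolding e by simp
    ultimately have "p ^ s dvd i"
      by (simp add: coprime_dvd_mult_left_iff)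
    then show False
      using assms by (auto dest: dvd_imp_le)
  qed
  then show ?thesis
    by (simp add: of_nat_eq_0)
qed

text \<open>
  This compares coefficients in $(1+X)^{m+p^s} = (1+X)^m (1+X^{p^s})$.  The lemmas below
  are the parts of Lucas' theorem that follow from it.
\<close>

lemma choose_add_ppow:
  "(of_nat ((m + p ^ s) choose j) :: 'k) =
     of_nat (m choose j) + (if p ^ s \<le> j then of_nat (m choose (j - p ^ s)) else 0)"
proof -
  have "(of_nat ((m + p ^ s) choose j) :: 'k) =
          (\<Sum>k\<le>j. of_nat (p ^ s choose k) * of_nat (m choose (j - k)))"
    using vandermonde[of "p ^ s" m j]
    by (metis (no_types, lifting) add.commute of_nat_mult of_nat_sum sum.cong)
  also have "\<dots> = (\<Sum>k\<in>{..j} \<inter> {0, p ^ s}. of_nat (p ^ s choose k) * of_nat (m choose (j - k)))"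
  proof (rule sum.mono_neutral_right)
    show "\<forall>k\<in>{..j} - {..j} \<inter> {0, p ^ s}. (of_nat (p ^ s choose k) * of_nat (m choose (j - k)) :: 'k) = 0"
    proof
      fix k assume k: "k \<in> {..j} - {..j} \<inter> {0, p ^ s}"
      show "(of_nat (p ^ s choose k) * of_nat (m choose (j - k)) :: 'k) = 0"
        using k ppow_choose_eq_0[of k s] by (cases "k < p ^ s") (auto simp: binomial_eq_0)
    qed
  qed auto
  also have "{..j} \<inter> {0, p ^ s} = (if p ^ s \<le> j then {0, p ^ s} else {0})"
    by auto
  finally show ?thesis
    using ppow_pos[of s] by auto
qed

lemma choose_add_mult_ppow:
  assumes "j < p ^ s"
  shows "(of_nat ((m + q * p ^ s) choose j) :: 'k) = of_nat (m choose j)"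
proof (induction q)
  case (Suc q)
  have "m + Suc q * p ^ s = (m + q * p ^ s) + p ^ s"
    by simp
  then show ?case
    using Suc choose_add_ppow[of "m + q * p ^ s" s j] assms by (simp only: not_le[symmetric] if_False add_0_right simp_thms)
qed simp

lemma choose_ppow: "(of_nat (m choose (p ^ s)) :: 'k) = of_nat (m div p ^ s)"
proof -
  have "(of_nat ((r + q * p ^ s) choose (p ^ s)) :: 'k) = of_nat q" if "r < p ^ s" for r q
  proof (induction q)
    case 0
    then show ?case using that by (simp add: binomial_eq_0)
  next
    case (Suc q)
    have "r + Suc q * p ^ s = (r + q * p ^ s) + p ^ s"
      by simp
    then show ?case
      using Suc choose_add_ppow[of "r + q * p ^ s" s "p ^ s"]
      by (simp only: order_refl if_True diff_self_eq_0 binomial_n_0 of_nat_1 of_nat_Suc add.commute)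
  qed
  from this[of "m mod p ^ s" "m div p ^ s"] show ?thesis
    by (metis mod_div_mult_eq mod_less_divisor ppow_pos)
qed

text \<open>
  In characteristic \<open>p\<close> the value is $(-1)^j$, because consecutive ones add up to
  $\binom{p^s}{j+1} = 0$.
\<close>

lemma choose_pred_ppow_neq_0:
  assumes "j < p ^ s"
  shows "(of_nat ((p ^ s - 1) choose j) :: 'k) \<noteq> 0"
  using assms
proof (induction j)
  case (Suc j)
  have "p ^ s choose Suc j = ((p ^ s - 1) choose j) + ((p ^ s - 1) choose Suc j)"
    using binomial_Suc_Suc[of "p ^ s - 1" j] ppow_pos[of s] by (metis Suc_diff_1)
  then have "(0 :: 'k) = of_nat ((p ^ s - 1) choose j) + of_nat ((p ^ s - 1) choose Suc j)"
    using ppow_choose_eq_0[of "Suc j" s] Suc.prems by (metis of_nat_add zero_less_Suc)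
  then show ?case
    using Suc by auto
qed simp

lemma choose_neq_0_imp_ppow:
  assumes "n > 0" and "\<And>x. 0 < x \<Longrightarrow> x < n \<Longrightarrow> (of_nat (n choose x) :: 'k) = 0"
  shows "\<exists>s. n = p ^ s"
proof -
  obtain q where q: "n = p ^ multiplicity p n * q" "\<not> p dvd q"
    using multiplicity_decompose'[of n p] assms(1) prime_p
    by (metis not_prime_unit not_gr_zero)
  have "(of_nat (n choose (p ^ multiplicity p n)) :: 'k) = of_nat q"
    using q(1) ppow_pos[of "multiplicity p n"] unfolding choose_ppow
    by (metis less_not_refl nonzero_mult_div_cancel_left)
  then have "(of_nat (n choose (p ^ multiplicity p n)) :: 'k) \<noteq> 0"
    using q(2) by (simp add: of_nat_eq_0)
  moreover have "p ^ multiplicity p n \<le> n"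
    using assms(1) by (simp add: dvd_imp_le multiplicity_dvd)
  ultimately have "p ^ multiplicity p n = n"
    using assms(2)[of "p ^ multiplicity p n"] by (metis le_neq_implies_less ppow_pos)
  then show ?thesis by metis
qed

lemma add_ppow_div_ppow:
  assumes "Suc l = p ^ s * q"
  shows "(l + p ^ s) div p ^ s = q"
proof -
  have "l + p ^ s = (p ^ s - 1) + q * p ^ s"
    using assms ppow_pos[of s] by (simp only: mult.commute)
  also have "\<dots> div p ^ s = q + (p ^ s - 1) div p ^ s"
    using ppow_pos[of s] by (metis add.commute div_mult_self3 less_not_refl)
  finally show ?thesis
    using ppow_pos[of s] by simp
qed

text \<open>
  Modulo \<open>p\<close>, the coefficient for $p^j$ is one more than the digit of \<open>l\<close> at $p^j$ in base \<open>p\<close>.  So the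
  hypothesis says that the last \<open>s\<close> digits of \<open>l\<close> are all $p-1$.
\<close>

lemma ppow_dvd_SucI:
  assumes "\<And>j. j < s \<Longrightarrow> (of_nat ((l + p ^ j) choose (p ^ j)) :: 'k) = 0"
  shows "p ^ s dvd Suc l"
  using assms
proof (induction s)
  case (Suc s)
  then obtain q where q: "Suc l = p ^ s * q"
    by (auto elim: dvdE)
  have "p dvd q"
    using Suc.prems[of s] add_ppow_div_ppow[OF q] by (simp add: choose_ppow of_nat_eq_0)
  then show ?case
    unfolding q by (simp add: mult.commute)
qed simp

lemma choose_of_ppow_dvd_Suc:
  assumes "p ^ s dvd Suc l" and "0 < b" and "a < p ^ s"
  shows "(of_nat ((l + b) choose a) :: 'k) = of_nat ((b - 1) choose a)"
proof -
  obtain q where "Suc l = q * p ^ s"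
    using assms(1) by (metis dvd_def mult.commute)
  then have "l + b = (b - 1) + q * p ^ s"
    using assms(2) by linarith
  then show ?thesis
    using choose_add_mult_ppow[OF assms(3)] by simp
qed

end

section \<open>Coherent families of coefficients\<close>

text \<open>
  The relations satisfied by the coefficients $c_i(a)$ of a vector fixed modulo the Specht module; rows
  are numbered from \<open>0\<close>, and only the values with $1 \le a \le \lambda_{i+1}$ carry information.  In
  \<open>adjacent_gt\<close> an argument $a - t$ beyond $\lambda_{i+1}$ may occur, but then the second binomial
  coefficient is zero.  The number \<open>d\<close> in \<open>adjacent_le\<close> is the coefficient that belongs to moving \<open>a\<close>
  entries from row $i+2$ directly to row \<open>i\<close>.
\<close>

locale coherent_family = field_of_char p K for p and K :: "'k :: field itself" +
  fixes lam :: "nat \<Rightarrow> nat" and c :: "nat \<Rightarrow> nat \<Rightarrow> 'k"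
  assumes p_ge_3: "p \<ge> 3"
    and lam_Suc_le: "lam (Suc i) \<le> lam i"
    and divided_power: "0 < a \<Longrightarrow> 0 < b \<Longrightarrow> a + b \<le> lam (Suc i) \<Longrightarrow>
      of_nat ((a + b) choose a) * c i (a + b) = of_nat ((lam i + (a + b)) choose a) * c i b"
    and distant: "Suc i < j \<Longrightarrow> 0 < a \<Longrightarrow> a \<le> lam (Suc i) \<Longrightarrow> 0 < b \<Longrightarrow> b \<le> lam (Suc j) \<Longrightarrow>
      of_nat ((lam i + a) choose a) * c j b = of_nat ((lam j + b) choose b) * c i a"
    and adjacent_gt: "0 < b \<Longrightarrow> b \<le> lam (Suc (Suc i)) \<Longrightarrow> b < a \<Longrightarrow> a \<le> lam (Suc i) + b \<Longrightarrow>
      of_nat ((lam i + a) choose a) * c (Suc i) b =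
        (\<Sum>t\<le>b. of_nat ((lam i + a) choose t) * of_nat ((lam (Suc i) + b - a) choose (b - t)) * c i (a - t))"
    and adjacent_le: "0 < a \<Longrightarrow> \<exists>d. \<forall>b. a \<le> b \<longrightarrow> b \<le> lam (Suc (Suc i)) \<longrightarrow>
      of_nat ((lam i + a) choose a) * c (Suc i) b =
        (\<Sum>t<a. of_nat ((lam i + a) choose t) * of_nat ((lam (Suc i) + b - a) choose (b - t)) * c i (a - t))
        + of_nat ((lam (Suc i) + b - a) choose (b - a)) * d"
begin

text \<open>
  With $a + b = p^s$ the left-hand side of \<open>divided_power\<close> vanishes, while the factor on the right
  is $\binom{p^s-1}{a}$, a unit.
\<close>

lemma vanish_below_ppow:
  assumes "p ^ s dvd Suc (lam i)" and "p ^ s \<le> lam (Suc i)" and "0 < b" and "b < p ^ s"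
  shows "c i b = 0"
proof -
  have e: "p ^ s - b + b = p ^ s"
    using assms by simp
  have "(of_nat (p ^ s choose (p ^ s - b)) :: 'k) = 0"
    using assms by (intro ppow_choose_eq_0) auto
  then have "of_nat ((lam i + p ^ s) choose (p ^ s - b)) * c i b = 0"
    using divided_power[of "p ^ s - b" b i] assms e by simp
  moreover have "(of_nat ((lam i + p ^ s) choose (p ^ s - b)) :: 'k) \<noteq> 0"
    using choose_of_ppow_dvd_Suc[OF assms(1), of "p ^ s" "p ^ s - b"]
      choose_pred_ppow_neq_0[of "p ^ s - b" s] assms(3,4) ppow_pos[of s] by auto
  ultimately show ?thesis by simp
qed

text \<open>
  Minimality of \<open>n\<close> turns \<open>divided_power\<close> into $\binom{n}{x} = 0$ for $0 < x < n$.
\<close>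

lemma least_support_ppow:
  assumes "c i n \<noteq> 0" and "0 < n" and "n \<le> lam (Suc i)" and "\<And>b. 0 < b \<Longrightarrow> b < n \<Longrightarrow> c i b = 0"
  shows "\<exists>k. n = p ^ k"
proof (rule choose_neq_0_imp_ppow)
  fix x assume x: "0 < x" "x < n"
  then show "(of_nat (n choose x) :: 'k) = 0"
    using divided_power[of x "n - x" i] assms(1,3) assms(4)[of "n - x"] by simp
qed fact

lemma obtain_least_support:
  assumes "c i m \<noteq> 0" and "0 < m" and "m \<le> lam (Suc i)"
  obtains k where "c i (p ^ k) \<noteq> 0" and "p ^ k \<le> lam (Suc i)" and "\<And>b. 0 < b \<Longrightarrow> b < p ^ k \<Longrightarrow> c i b = 0"
proof -
  define n where "n = (LEAST n. 0 < n \<and> c i n \<noteq> 0)"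
  have n: "0 < n \<and> c i n \<noteq> 0"
    unfolding n_def by (rule LeastI[of _ m]) (use assms in auto)
  have le: "n \<le> m"
    unfolding n_def by (rule Least_le) (use assms in auto)
  have least: "c i b = 0" if "0 < b" "b < n" for b
    using not_less_Least[of b "\<lambda>n. 0 < n \<and> c i n \<noteq> 0"] that unfolding n_def by auto
  obtain k where "n = p ^ k"
    using least_support_ppow[of i n] n le least assms(3) by auto
  then show thesis
    using that[of k] n le least assms(3) by auto
qed

lemma ppow_lt_ppow_iff: "p ^ a < p ^ b \<longleftrightarrow> a < b"
  using p_gt_1 by simp

lemma ppow_le_ppow_iff: "p ^ a \<le> p ^ b \<longleftrightarrow> a \<le> b"
  using p_gt_1 by simp

text \<open>
  All terms of \<open>adjacent_gt\<close> except the one for $t = 0$ contain a coefficient below $p^k$.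
\<close>

lemma adjacent_ppow:
  assumes "p ^ s \<le> lam (Suc (Suc i))" and "s < k" and "p ^ k \<le> lam (Suc i)"
    and "\<And>b. 0 < b \<Longrightarrow> b < p ^ k \<Longrightarrow> c i b = 0"
  shows "of_nat ((lam i + p ^ k) choose (p ^ k)) * c (Suc i) (p ^ s) =
     of_nat ((lam (Suc i) + p ^ s - p ^ k) choose (p ^ s)) * c i (p ^ k)"
proof -
  have lt: "p ^ s < p ^ k"
    using assms(2) by (simp add: ppow_lt_ppow_iff)
  have "of_nat ((lam i + p ^ k) choose (p ^ k)) * c (Suc i) (p ^ s) =
     (\<Sum>t\<le>p ^ s. of_nat ((lam i + p ^ k) choose t) *
        of_nat ((lam (Suc i) + p ^ s - p ^ k) choose (p ^ s - t)) * c i (p ^ k - t))"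
    using assms lt by (intro adjacent_gt) auto
  also have "\<dots> = (\<Sum>t\<in>{0}. of_nat ((lam i + p ^ k) choose t) *
        of_nat ((lam (Suc i) + p ^ s - p ^ k) choose (p ^ s - t)) * c i (p ^ k - t))"
  proof (rule sum.mono_neutral_right)
    show "\<forall>t\<in>{..p ^ s} - {0}. of_nat ((lam i + p ^ k) choose t) *
        of_nat ((lam (Suc i) + p ^ s - p ^ k) choose (p ^ s - t)) * c i (p ^ k - t) = 0"
      using lt by (auto intro!: assms(4))
  qed auto
  finally show ?thesis by simp
qed

text \<open>
  A row with $J_i = 0$ that is followed by a row with $J_{i+1} \ne 0$ carries no coefficients.  By
  \<open>vanish_below_ppow\<close> the least argument $p^k$ at which $c_i$ is nonzero is the largest power of
  \<open>p\<close> up to $\lambda_{i+1}$.  If $s < k$, then \<open>adjacent_ppow\<close> multiplies $c_i(p^k)$ by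
  $J_{i+1}(p^s) \ne 0$ and gives zero.
\<close>

lemma vanish_before_non_james:
  assumes james: "\<And>a. 0 < a \<Longrightarrow> a \<le> lam (Suc i) \<Longrightarrow> (of_nat ((lam i + a) choose a) :: 'k) = 0"
    and s_le: "p ^ s \<le> lam (Suc (Suc i))"
    and non_james: "(of_nat ((lam (Suc i) + p ^ s) choose (p ^ s)) :: 'k) \<noteq> 0"
    and s_least: "\<And>a. 0 < a \<Longrightarrow> a < p ^ s \<Longrightarrow> (of_nat ((lam (Suc i) + a) choose a) :: 'k) = 0"
    and m: "0 < m" "m \<le> lam (Suc i)"
  shows "c i m = 0"
proof (rule ccontr)
  assume "c i m \<noteq> 0"
  then obtain k where k: "c i (p ^ k) \<noteq> 0" "p ^ k \<le> lam (Suc i)"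
      and low: "\<And>b. 0 < b \<Longrightarrow> b < p ^ k \<Longrightarrow> c i b = 0"
    using obtain_least_support m by metis
  have dvd: "p ^ Suc j dvd Suc (lam i)" if "p ^ j \<le> lam (Suc i)" for j
  proof (rule ppow_dvd_SucI)
    fix j' assume "j' < Suc j"
    then have "p ^ j' \<le> p ^ j" by (simp add: ppow_le_ppow_iff)
    then show "(of_nat ((lam i + p ^ j') choose (p ^ j')) :: 'k) = 0"
      using that by (intro james) auto
  qed
  have "lam (Suc i) < p ^ Suc k"
  proof (rule ccontr)
    assume "\<not> ?thesis"
    then have "c i (p ^ k) = 0"
      using dvd[of k] k p_gt_1 by (intro vanish_below_ppow[of "Suc k"]) (auto simp: ppow_lt_ppow_iff)
    then show False using k by simp
  qed
  then have "p ^ s < p ^ Suc k"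
    using s_le lam_Suc_le[of "Suc i"] by linarith
  then have "s \<le> k" by (simp only: ppow_lt_ppow_iff)
  show False
  proof (cases "s < k")
    case True
    have "p ^ s < p ^ k" using True by (simp add: ppow_lt_ppow_iff)
    have "of_nat ((lam (Suc i) + p ^ s - p ^ k) choose (p ^ s)) * c i (p ^ k) = 0"
      using adjacent_ppow[OF s_le True k(2) low] james[of "p ^ k"] k by simp
    moreover have "lam (Suc i) + p ^ s = (lam (Suc i) + p ^ s - p ^ k) + 1 * p ^ k"
      using k by simp
    then have "(of_nat ((lam (Suc i) + p ^ s - p ^ k) choose (p ^ s)) :: 'k) \<noteq> 0"
      using non_james choose_add_mult_ppow[OF \<open>p ^ s < p ^ k\<close>, of _ 1] by metis
    ultimately show False using k by simp
  next
    case False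
    then have s: "s = k" using \<open>s \<le> k\<close> by simp
    have "p ^ k dvd Suc (lam (Suc i))"
      using s_least s by (intro ppow_dvd_SucI) (auto simp: ppow_lt_ppow_iff)
    then obtain q where q: "Suc (lam (Suc i)) = p ^ k * q"
      by (auto elim: dvdE)
    have q0: "(of_nat q :: 'k) \<noteq> 0"
      using non_james s add_ppow_div_ppow[OF q] by (simp add: choose_ppow)
    have "q \<ge> 2"
    proof (rule ccontr)
      assume "\<not> q \<ge> 2"
      then have "p ^ k * q \<le> p ^ k * 1" by (intro mult_le_mono2) simp
      then show False using q k by linarith
    qed
    then obtain r where r: "q = r + 2" by (metis add.commute le_Suc_ex)
    have l2: "lam (Suc i) - p ^ k = (p ^ k - 1) + r * p ^ k"
    proof -
      have "p ^ k * q = p ^ k + p ^ k + r * p ^ k" unfolding r by (simp add: algebra_simps)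
      then show ?thesis using q ppow_pos[of k] by linarith
    qed
    (* The case s = k.  Here lambda_(i+1) + 1 = q p^k with q <> 0 in the field, and the relation
       for a = 2 p^k, b = p^k reduces to (q - 2) c(2 p^k) + c(p^k) = 0.  As 2 c(2 p^k) = c(p^k)
       if 2 p^k lies in the range, and q = 2 otherwise, c(p^k) = 0 follows.  The bound 2 p^k < p^(k+1)
       uses that p is odd. *)
    have two: "2 * p ^ k < p ^ Suc k"
      using p_ge_3 by simp
    have dk: "p ^ Suc k dvd Suc (lam i)" using dvd k by simp
    have J2: "(of_nat ((lam i + 2 * p ^ k) choose (2 * p ^ k)) :: 'k) = 0"
      using choose_of_ppow_dvd_Suc[OF dk _ two, of "2 * p ^ k"] by (simp add: binomial_eq_0)
    have "(2 * p ^ k - 1) div p ^ k = 1"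
    proof -
      have "2 * p ^ k - 1 = p ^ k + (p ^ k - 1)" using ppow_pos[of k] by linarith
      then show ?thesis by (simp add: div_add_self1)
    qed
    then have J1: "(of_nat ((lam i + 2 * p ^ k) choose (p ^ k)) :: 'k) = 1"
      using choose_of_ppow_dvd_Suc[OF dk, of "2 * p ^ k" "p ^ k"] two by (simp add: choose_ppow)
    define f where "f t = of_nat ((lam i + 2 * p ^ k) choose t) *
        of_nat ((lam (Suc i) + p ^ k - 2 * p ^ k) choose (p ^ k - t)) * c i (2 * p ^ k - t)" for t
    have "of_nat ((lam i + 2 * p ^ k) choose (2 * p ^ k)) * c (Suc i) (p ^ k) = (\<Sum>t\<le>p ^ k. f t)"
      unfolding f_def using s s_le k by (intro adjacent_gt) auto
    also have "\<dots> = (\<Sum>t\<in>{0, p ^ k}. f t)"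
    proof (rule sum.mono_neutral_right)
      show "\<forall>t\<in>{..p ^ k} - {0, p ^ k}. f t = 0"
      proof
        fix t assume t: "t \<in> {..p ^ k} - {0, p ^ k}"
        show "f t = 0"
        proof (cases "2 * p ^ k - t \<le> lam (Suc i)")
          case True
          have e: "2 * p ^ k - t = p ^ k + (p ^ k - t)" using t by auto
          have "(of_nat ((p ^ k + (p ^ k - t)) choose (p ^ k)) :: 'k) = 1"
            using choose_ppow[of "p ^ k + (p ^ k - t)" k] t by (auto simp: div_add_self1)
          then have "c i (p ^ k + (p ^ k - t)) = 0"
            using divided_power[of "p ^ k" "p ^ k - t" i] low[of "p ^ k - t"] t True e by auto
          then show ?thesis unfolding f_def e by simp
        next
          case False
          then have "lam (Suc i) + p ^ k - 2 * p ^ k < p ^ k - t" using k t by auto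
          then show ?thesis unfolding f_def by (simp add: binomial_eq_0)
        qed
      qed
    qed auto
    also have "\<dots> = f 0 + f (p ^ k)" using ppow_pos[of k] by simp
    also have "f (p ^ k) = c i (p ^ k)"
      unfolding f_def J1 by simp
    also have "f 0 = of_nat r * c i (2 * p ^ k)"
    proof -
      have "(of_nat ((lam (Suc i) - p ^ k) choose (p ^ k)) :: 'k) = of_nat r"
        unfolding choose_ppow l2 using ppow_pos[of k] by simp
      then show ?thesis unfolding f_def by simp
    qed
    finally have eq: "of_nat r * c i (2 * p ^ k) + c i (p ^ k) = 0"
      using J2 by simp
    show False
    proof (cases "r = 0")
      case True
      then show False using eq k by simp
    next
      case False
      then have "1 * p ^ k \<le> r * p ^ k" by (intro mult_le_mono1) simp
      then have "2 * p ^ k \<le> lam (Suc i)" using l2 k by linarith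
      moreover have "(of_nat ((p ^ k + p ^ k) choose (p ^ k)) :: 'k) = 2"
        using choose_ppow[of "p ^ k + p ^ k" k] ppow_pos[of k] by (simp flip: mult_2)
      ultimately have "2 * c i (2 * p ^ k) = c i (p ^ k)"
        using divided_power[of "p ^ k" "p ^ k" i] J1 by (simp flip: mult_2)
      then have "of_nat q * c i (2 * p ^ k) = 0"
        using eq unfolding r by (simp add: algebra_simps)
      then show False
        using q0 k \<open>2 * c i (2 * p ^ k) = c i (p ^ k)\<close> by auto
    qed
  qed
qed

text \<open>
  Two conditions determine a coherent family.  By \<open>distant\<close> and \<open>vanish_before_non_james\<close> the
  condition $c_i(p^s) = 0$ reduces everything to the rows \<open>i\<close> and $i+1$, since $J_i(p^s) \ne 0$.
  The adjacent relations with $a = p^s$ express $c_{i+1}$ by $c_{i+1}(p^s)$, and the relation with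
  $a = p^k$, $b = p^s$ expresses the only coefficient of row \<open>i\<close> that is left by $c_{i+1}(p^s)$ as
  well.  If row $i+2$ is too short for $c_{i+1}(p^s)$ to exist, then $c_{i+1} = 0$ and the second
  condition is imposed on row \<open>i\<close>, at the largest power of \<open>p\<close> up to $\lambda_{i+1}$, instead.
\<close>

theorem coherent_family_eq_0:
  assumes james: "\<And>j a. j < i \<Longrightarrow> 0 < a \<Longrightarrow> a \<le> lam (Suc j) \<Longrightarrow> (of_nat ((lam j + a) choose a) :: 'k) = 0"
    and s_le: "p ^ s \<le> lam (Suc i)"
    and non_james: "(of_nat ((lam i + p ^ s) choose (p ^ s)) :: 'k) \<noteq> 0"
    and s_least: "\<And>a. 0 < a \<Longrightarrow> a < p ^ s \<Longrightarrow> (of_nat ((lam i + a) choose a) :: 'k) = 0"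
    and h: "p ^ h \<le> lam (Suc i)" "lam (Suc i) < p ^ Suc h"
    and c_s: "c i (p ^ s) = 0"
    and c_extra: "if p ^ s \<le> lam (Suc (Suc i)) then c (Suc i) (p ^ s) = 0 else c i (p ^ h) = 0"
    and m: "0 < m" "m \<le> lam (Suc j)"
  shows "c j m = 0"
proof -
  have "p ^ s dvd Suc (lam i)"
    by (rule ppow_dvd_SucI) (simp add: s_least ppow_lt_ppow_iff)
  then have low: "c i b = 0" if "0 < b" "b \<le> p ^ s" for b
    using vanish_below_ppow[of s i b] s_le that c_s by (cases "b = p ^ s") auto
  have row_Suc_i: "c (Suc i) b = 0" if b: "0 < b" "b \<le> lam (Suc (Suc i))" for b
  proof (cases "b < p ^ s")
    case True
    have "of_nat ((lam i + p ^ s) choose (p ^ s)) * c (Suc i) b =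
       (\<Sum>t\<le>b. of_nat ((lam i + p ^ s) choose t) *
          of_nat ((lam (Suc i) + b - p ^ s) choose (b - t)) * c i (p ^ s - t))"
      using b True s_le by (intro adjacent_gt) auto
    also have "\<dots> = 0"
      using True by (intro sum.neutral) (auto intro!: low)
    finally show ?thesis using non_james by simp
  next
    case False
    obtain d where d: "\<And>b. p ^ s \<le> b \<Longrightarrow> b \<le> lam (Suc (Suc i)) \<Longrightarrow>
      of_nat ((lam i + p ^ s) choose (p ^ s)) * c (Suc i) b =
        (\<Sum>t<p ^ s. of_nat ((lam i + p ^ s) choose t) *
           of_nat ((lam (Suc i) + b - p ^ s) choose (b - t)) * c i (p ^ s - t))
        + of_nat ((lam (Suc i) + b - p ^ s) choose (b - p ^ s)) * d"
      using adjacent_le[of "p ^ s" i] by auto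
    have z: "(\<Sum>t<p ^ s. of_nat ((lam i + p ^ s) choose t) *
           of_nat ((lam (Suc i) + b - p ^ s) choose (b - t)) * c i (p ^ s - t)) = 0" for b
      by (intro sum.neutral) (auto intro!: low)
    have "d = 0"
      using d[of "p ^ s"] c_extra b False unfolding z by auto
    then show ?thesis
      using d[of b] b False non_james unfolding z by auto
  qed
  have row_i: "c i n = 0" if n: "0 < n" "n \<le> lam (Suc i)" for n
  proof (rule ccontr)
    assume "c i n \<noteq> 0"
    then obtain k where k: "c i (p ^ k) \<noteq> 0" "p ^ k \<le> lam (Suc i)"
        and least: "\<And>b. 0 < b \<Longrightarrow> b < p ^ k \<Longrightarrow> c i b = 0"
      using obtain_least_support n by metis
    have "p ^ s < p ^ k"
      using low[of "p ^ k"] k by (meson not_less ppow_pos)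
    then have "s < k" by (simp add: ppow_lt_ppow_iff)
    (* Otherwise c(p^k + p^s) would be a multiple of c(p^s) = 0, and at the same time a nonzero
       multiple of c(p^k). *)
    have short: "lam (Suc i) < p ^ k + p ^ s"
    proof (rule ccontr)
      assume "\<not> ?thesis"
      then have le: "p ^ k + p ^ s \<le> lam (Suc i)" by simp
      have "(of_nat ((p ^ k + p ^ s) choose (p ^ k)) :: 'k) = 1"
        using choose_ppow[of "p ^ k + p ^ s" k] \<open>p ^ s < p ^ k\<close> by (simp add: div_add_self1)
      then have "c i (p ^ k + p ^ s) = 0"
        using divided_power[of "p ^ k" "p ^ s" i] le c_s by simp
      then have "of_nat ((lam i + (p ^ s + p ^ k)) choose (p ^ s)) * c i (p ^ k) = 0"
        using divided_power[of "p ^ s" "p ^ k" i] le by (simp add: add.commute)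
      moreover have "(of_nat ((lam i + (p ^ s + p ^ k)) choose (p ^ s)) :: 'k) \<noteq> 0"
        using choose_add_mult_ppow[OF \<open>p ^ s < p ^ k\<close>, of "lam i + p ^ s" 1] non_james
        by (simp add: add.assoc)
      ultimately show False using k by simp
    qed
    show False
    proof (cases "p ^ s \<le> lam (Suc (Suc i))")
      case True
      have "of_nat ((lam (Suc i) + p ^ s - p ^ k) choose (p ^ s)) * c i (p ^ k) = 0"
        using adjacent_ppow[OF True \<open>s < k\<close> k(2) least] row_Suc_i[of "p ^ s"] True by simp
      moreover have "(lam (Suc i) + p ^ s - p ^ k) div p ^ s = 1"
        using short k by (intro div_nat_eqI) auto
      ultimately show False using k by (simp add: choose_ppow)
    next
      case False
      have "p ^ k < p ^ Suc h" using k h by linarith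
      then have "k \<le> h" by (simp only: ppow_lt_ppow_iff)
      moreover have "k \<noteq> h" using c_extra False k by auto
      ultimately have "p ^ Suc k \<le> p ^ h" by (simp only: ppow_le_ppow_iff)
      moreover have "2 * p ^ k \<le> p ^ Suc k" using p_ge_3 by simp
      ultimately show False using short h \<open>p ^ s < p ^ k\<close> by linarith
    qed
  qed
  consider "j = i" | "j = Suc i" | "Suc i < j" | "Suc j < i" | "Suc j = i"
    by linarith
  then show ?thesis
  proof cases
    case 3
    then show ?thesis
      using distant[OF 3, of "p ^ s" m] s_le m non_james c_s by auto
  next
    case 4
    then show ?thesis
      using distant[OF 4, of m "p ^ s"] s_le m non_james james[of j m] by auto
  next
    case 5
    then show ?thesis
      using vanish_before_non_james[of j s m] james[of j] s_le non_james s_least m by auto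
  qed (use row_i row_Suc_i m in auto)
qed

end

section \<open>Words and raising operators\<close>

definition fiber :: "nat \<Rightarrow> (nat \<Rightarrow> nat) \<Rightarrow> nat \<Rightarrow> nat set" where
  "fiber n w i = {x \<in> {1..n}. w x = i}"

text \<open>
  The words of content \<open>mu\<close>: they encode the tabloids of shape \<open>mu\<close>, and \<open>mu\<close> may be any composition
  of \<open>n\<close>.  The value \<open>0\<close> outside \<open>{1..n}\<close> makes equality of words extensional.
\<close>

definition words :: "nat \<Rightarrow> (nat \<Rightarrow> nat) \<Rightarrow> (nat \<Rightarrow> nat) set" where
  "words n mu = {w. (\<forall>x. x \<notin> {1..n} \<longrightarrow> w x = 0) \<and> (\<forall>i. card (fiber n w i) = mu i)}"

definition relabel :: "(nat \<Rightarrow> nat) \<Rightarrow> nat set \<Rightarrow> nat \<Rightarrow> nat \<Rightarrow> nat" where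
  "relabel w A j = (\<lambda>x. if x \<in> A then j else w x)"

definition subsets_of_card :: "'a set \<Rightarrow> nat \<Rightarrow> 'a set set" where
  "subsets_of_card F a = {A. A \<subseteq> F \<and> card A = a}"

definition move :: "nat \<Rightarrow> nat \<Rightarrow> nat \<Rightarrow> (nat \<Rightarrow> nat) \<Rightarrow> nat \<Rightarrow> nat" where
  "move i j a mu = mu (i := mu i - a, j := mu j + a)"

text \<open>
  The divided power $e_i^{(a)}$ on coefficient functions: the coefficient of the image at \<open>w\<close> collects
  the coefficients of all words from which \<open>w\<close> arises when \<open>a\<close> letters $i+1$ are turned into \<open>i\<close>.
\<close>

definition raise :: "nat \<Rightarrow> nat \<Rightarrow> nat \<Rightarrow> ((nat \<Rightarrow> nat) \<Rightarrow> 'k::comm_ring_1) \<Rightarrow> (nat \<Rightarrow> nat) \<Rightarrow> 'k" where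
  "raise n i a v w = (\<Sum>A\<in>subsets_of_card (fiber n w i) a. v (relabel w A (Suc i)))"

lemma finite_fiber [simp]: "finite (fiber n w i)"
  by (simp add: fiber_def)

lemma fiber_subset: "fiber n w i \<subseteq> {1..n}"
  by (auto simp: fiber_def)

lemma mem_fiber: "x \<in> fiber n w i \<longleftrightarrow> x \<in> {1..n} \<and> w x = i"
  by (simp add: fiber_def)

lemma card_fiber: "w \<in> words n mu \<Longrightarrow> card (fiber n w i) = mu i"
  by (simp add: words_def)

lemma finite_subsets_of_card [simp]: "finite F \<Longrightarrow> finite (subsets_of_card F a)"
  by (simp add: subsets_of_card_def)

lemma card_subsets_of_card: "finite F \<Longrightarrow> card (subsets_of_card F a) = card F choose a"
  by (simp add: subsets_of_card_def n_subsets)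

lemma subsets_of_cardD: "A \<in> subsets_of_card F a \<Longrightarrow> A \<subseteq> F" "A \<in> subsets_of_card F a \<Longrightarrow> card A = a"
  by (simp_all add: subsets_of_card_def)

lemma fiber_relabel_other: "k \<noteq> j \<Longrightarrow> A \<inter> fiber n w k = {} \<Longrightarrow> fiber n (relabel w A j) k = fiber n w k"
  by (auto simp: fiber_def relabel_def)

lemma fiber_relabel_target: "A \<subseteq> {1..n} \<Longrightarrow> fiber n (relabel w A j) j = fiber n w j \<union> A"
  by (auto simp: fiber_def relabel_def)

lemma fiber_relabel_source: "i \<noteq> j \<Longrightarrow> fiber n (relabel w A j) i = fiber n w i - A"
  by (auto simp: fiber_def relabel_def)

lemma relabel_in_words:
  assumes w: "w \<in> words n mu" and A: "A \<in> subsets_of_card (fiber n w i) a" and "i \<noteq> j"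
  shows "relabel w A j \<in> words n (move i j a mu)"
proof -
  note A' = subsets_of_cardD[OF A]
  have fin: "finite A" using A'(1) finite_subset by fastforce
  have sub: "A \<subseteq> {1..n}" using A'(1) fiber_subset by blast
  have 1: "card (fiber n (relabel w A j) i) = mu i - a"
    using A' fin \<open>i \<noteq> j\<close> w by (simp add: fiber_relabel_source card_Diff_subset card_fiber)
  have "fiber n w j \<inter> A = {}" using A'(1) \<open>i \<noteq> j\<close> by (auto simp: fiber_def)
  then have 2: "card (fiber n (relabel w A j) j) = mu j + a"
    using A' fin w by (simp add: fiber_relabel_target[OF sub] card_Un_disjoint card_fiber)
  have 3: "card (fiber n (relabel w A j) k) = mu k" if "k \<noteq> i" "k \<noteq> j" for k
  proof -
    have "A \<inter> fiber n w k = {}" using A'(1) that by (auto simp: fiber_def)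
    then show ?thesis using that w by (simp add: fiber_relabel_other card_fiber)
  qed
  have 4: "relabel w A j x = 0" if "x \<notin> {1..n}" for x
    using that sub w by (auto simp: relabel_def words_def)
  show ?thesis
    unfolding words_def move_def using 1 2 3 4 \<open>i \<noteq> j\<close> by auto
qed

lemma obtain_moved_word:
  assumes "w \<in> words n mu" and "a \<le> mu i" and "i \<noteq> j"
  obtains w' where "w' \<in> words n (move i j a mu)"
proof -
  obtain A where "A \<subseteq> fiber n w i" "card A = a"
    using obtain_subset_with_card_n[of a "fiber n w i"] assms by (metis card_fiber)
  then show thesis
    using that relabel_in_words[OF assms(1) _ assms(3), of A a] by (auto simp: subsets_of_card_def)
qed

lemma fiber_comp_permutes:
  assumes "q permutes {1..n}"
  shows "fiber n (w \<circ> q) i = inv' q ` fiber n w i"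
proof -
  have "x \<in> inv' q ` fiber n w i" if "x \<in> {1..n}" "w (q x) = i" for x
  proof -
    have "q x \<in> fiber n w i" using that permutes_in_image[OF assms, of x] by (simp add: fiber_def)
    moreover have "x = inv' q (q x)" using assms by (simp add: permutes_inverses)
    ultimately show ?thesis by blast
  qed
  moreover have "inv' q y \<in> {1..n}" if "y \<in> {1..n}" for y
    using that permutes_in_image[OF permutes_inv[OF assms]] by simp
  ultimately show ?thesis
    using assms by (auto simp: fiber_def permutes_inverses)
qed

lemma comp_in_words:
  assumes "w \<in> words n mu" and "q permutes {1..n}"
  shows "w \<circ> q \<in> words n mu"
proof -
  have "card (inv' q ` fiber n w i) = mu i" for i
    using assms card_image[OF permutes_inj_on[OF permutes_inv[OF assms(2)]]] by (metis card_fiber)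
  moreover have "w (q x) = 0" if "x \<notin> {1..n}" for x
    using assms that permutes_not_in[OF assms(2) that] by (simp add: words_def)
  ultimately show ?thesis
    using fiber_comp_permutes[OF assms(2), of w] unfolding words_def by simp
qed

lemma words_transitive:
  assumes "w \<in> words n mu" and "w' \<in> words n mu"
  obtains q where "q permutes {1..n}" and "w' = w \<circ> q"
proof -
  have "image_mset w' (mset_set {1..n}) = image_mset w (mset_set {1..n})"
  proof (rule multiset_eqI)
    fix i
    have "count (image_mset u (mset_set {1..n})) i = card (fiber n u i)" for u
      by (simp add: count_image_mset' fiber_def) (auto intro!: arg_cong[of _ _ card])
    then show "count (image_mset w' (mset_set {1..n})) i = count (image_mset w (mset_set {1..n})) i"
      using assms by (simp add: card_fiber)
  qed
  then obtain q where q: "q permutes {1..n}" "\<forall>x\<in>{1..n}. w' x = w (q x)"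
    using image_mset_eq_implies_permutes[of "{1..n}" w' w] by auto
  have "w' = w \<circ> q"
  proof
    fix x show "w' x = (w \<circ> q) x"
      using q assms permutes_not_in[OF q(1), of x] by (cases "x \<in> {1..n}") (auto simp: words_def)
  qed
  then show thesis using q that by blast
qed

lemma raise_comp_permutes:
  assumes q: "q permutes {1..n}"
  shows "raise n i a (\<lambda>w. v (w \<circ> q)) w = raise n i a v (w \<circ> q)"
proof -
  have inj: "inj q" "inj (inv' q)" using q permutes_inj permutes_inv by blast+
  have qi: "q ` inv' q ` A = A" "inv' q ` q ` A = A" for A
    using q by (auto simp: image_image permutes_inverses)
  have "raise n i a v (w \<circ> q) = (\<Sum>A\<in>subsets_of_card (inv' q ` fiber n w i) a. v (relabel (w \<circ> q) A (Suc i)))"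
    unfolding raise_def fiber_comp_permutes[OF q] ..
  also have "\<dots> = (\<Sum>A\<in>subsets_of_card (fiber n w i) a. v (relabel w A (Suc i) \<circ> q))"
  proof (rule sum.reindex_bij_witness[of _ "\<lambda>A. inv' q ` A" "\<lambda>A. q ` A"])
    fix A assume "A \<in> subsets_of_card (inv' q ` fiber n w i) a"
    then show "q ` A \<in> subsets_of_card (fiber n w i) a"
      using qi inj by (auto simp: subsets_of_card_def card_image[OF inj_on_subset[OF inj(1)]] permutes_inverses[OF q] subset_iff)
    have "relabel w (q ` A) (Suc i) \<circ> q = relabel (w \<circ> q) A (Suc i)"
      using inj by (auto simp: relabel_def inj_image_mem_iff)
    then show "v (relabel w (q ` A) (Suc i) \<circ> q) = v (relabel (w \<circ> q) A (Suc i))" by simp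
  next
    fix A assume "A \<in> subsets_of_card (fiber n w i) a"
    then show "inv' q ` A \<in> subsets_of_card (inv' q ` fiber n w i) a"
      using inj by (auto simp: subsets_of_card_def card_image[OF inj_on_subset[OF inj(2)]])
  qed (use qi in auto)
  finally show ?thesis unfolding raise_def by simp
qed

section \<open>Relations between divided powers\<close>

lemma sum_disjoint_pairs:
  fixes g :: "nat set \<Rightarrow> 'k::comm_ring_1"
  assumes "finite F"
  shows "(\<Sum>A\<in>subsets_of_card F a. \<Sum>B\<in>subsets_of_card (F - A) b. g (A \<union> B)) =
         of_nat ((a + b) choose a) * (\<Sum>C\<in>subsets_of_card F (a + b). g C)"
proof -
  have fin: "finite A" if "A \<subseteq> F" for A using assms that finite_subset by blast
  have "(\<Sum>A\<in>subsets_of_card F a. \<Sum>B\<in>subsets_of_card (F - A) b. g (A \<union> B)) =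
        (\<Sum>(A, B)\<in>Sigma (subsets_of_card F a) (\<lambda>A. subsets_of_card (F - A) b). g (A \<union> B))"
    using assms by (intro sum.Sigma) auto
  also have "\<dots> = (\<Sum>(C, A)\<in>Sigma (subsets_of_card F (a + b)) (\<lambda>C. subsets_of_card C a). g C)"
  proof (rule sum.reindex_bij_witness[of _ "\<lambda>(C, A). (A, C - A)" "\<lambda>(A, B). (A \<union> B, A)"], goal_cases)
    case (1 x)
    then show ?case by (auto simp: subsets_of_card_def)
  next
    case (2 x)
    then obtain A B where x: "x = (A, B)" "A \<subseteq> F" "card A = a" "B \<subseteq> F - A" "card B = b"
      by (auto simp: subsets_of_card_def)
    then have "card (A \<union> B) = a + b"
      using fin[of A] fin[of B] by (subst card_Un_disjoint) auto
    then show ?case using x by (auto simp: subsets_of_card_def)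
  next
    case (3 x)
    then show ?case by (auto simp: subsets_of_card_def)
  next
    case (4 x)
    then obtain C A where x: "x = (C, A)" "C \<subseteq> F" "card C = a + b" "A \<subseteq> C" "card A = a"
      by (auto simp: subsets_of_card_def)
    then have "card (C - A) = b"
      using fin[of A] by (subst card_Diff_subset) auto
    then show ?case using x by (auto simp: subsets_of_card_def)
  next
    case (5 x)
    then show ?case by auto
  qed
  also have "\<dots> = (\<Sum>C\<in>subsets_of_card F (a + b). \<Sum>A\<in>subsets_of_card C a. g C)"
    using assms fin by (intro sum.Sigma[symmetric]) (auto simp: subsets_of_card_def)
  also have "\<dots> = (\<Sum>C\<in>subsets_of_card F (a + b). of_nat ((a + b) choose a) * g C)"
  proof (rule sum.cong)
    fix C assume C: "C \<in> subsets_of_card F (a + b)"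
    then have "card (subsets_of_card C a) = (a + b) choose a"
      using fin[of C] by (simp add: card_subsets_of_card subsets_of_cardD)
    then show "(\<Sum>A\<in>subsets_of_card C a. g C) = of_nat ((a + b) choose a) * g C"
      by simp
  qed simp
  finally show ?thesis by (simp add: sum_distrib_left)
qed

text \<open>
  The reindexing behind the straightening of $e_i^{(a)} e_{i+1}^{(b)}$: \<open>A\<close> holds the letters that go down
  first, \<open>B\<close> those that go down afterwards, and the sum is split by the part $T = A \cap B$ that
  goes down twice.
\<close>

lemma sum_overlapping_pairs:
  fixes g :: "nat set \<Rightarrow> nat set \<Rightarrow> nat set \<Rightarrow> 'k::comm_ring_1"
  assumes fin: "finite F" "finite F'" and dis: "F \<inter> F' = {}"
  shows "(\<Sum>A\<in>subsets_of_card F a. \<Sum>B\<in>subsets_of_card (F' \<union> A) b. g (A \<inter> B) (B - A) (A - B)) =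
         (\<Sum>t\<le>min a b. \<Sum>T\<in>subsets_of_card F t. \<Sum>B\<in>subsets_of_card F' (b - t).
            \<Sum>A\<in>subsets_of_card (F - T) (a - t). g T B A)"
proof -
  let ?S = "Sigma (subsets_of_card F a) (\<lambda>A. subsets_of_card (F' \<union> A) b)"
  let ?R = "Sigma {..min a b} (\<lambda>t. Sigma (subsets_of_card F t) (\<lambda>T. subsets_of_card F' (b - t) \<times> subsets_of_card (F - T) (a - t)))"
  have finF: "finite A" if "A \<subseteq> F" for A using fin that finite_subset by blast
  have finF': "finite A" if "A \<subseteq> F'" for A using fin that finite_subset by blast
  have finU: "finite A" if "A \<subseteq> F' \<union> B" "B \<subseteq> F" for A B using fin that finite_subset[of A "F' \<union> F"] by blast
  have "(\<Sum>A\<in>subsets_of_card F a. \<Sum>B\<in>subsets_of_card (F' \<union> A) b. g (A \<inter> B) (B - A) (A - B)) =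
        (\<Sum>(A, B)\<in>?S. g (A \<inter> B) (B - A) (A - B))"
    using fin finF by (intro sum.Sigma) (auto simp: subsets_of_card_def)
  also have "\<dots> = (\<Sum>(t, T, B, A)\<in>?R. g T B A)"
  proof (rule sum.reindex_bij_witness[of _ "\<lambda>(t, T, B, A). (T \<union> A, T \<union> B)" "\<lambda>(A, B). (card (A \<inter> B), A \<inter> B, B - A, A - B)"], goal_cases)
    case (1 x)
    then show ?case by auto
  next
    case (2 x)
    then obtain A B where x: "x = (A, B)" "A \<subseteq> F" "card A = a" "B \<subseteq> F' \<union> A" "card B = b"
      by (auto simp: subsets_of_card_def)
    have f: "finite A" "finite B" using finF finU x by blast+
    have c1: "card (A \<inter> B) \<le> a" "card (A \<inter> B) \<le> b"
      using f x card_mono[of A "A \<inter> B"] card_mono[of B "A \<inter> B"] by auto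
    have c2: "card (B - A) = b - card (A \<inter> B)" "card (A - B) = a - card (A \<inter> B)"
      using f x by (auto simp: card_Diff_subset_Int Int_commute)
    show ?case using x c1 c2 by (auto simp: subsets_of_card_def)
  next
    case (3 x)
    then obtain t T B A where "x = (t, T, B, A)" "T \<subseteq> F" "card T = t" "B \<subseteq> F'" "A \<subseteq> F - T"
      by (auto simp: subsets_of_card_def)
    moreover from this dis have "(T \<union> A) \<inter> (T \<union> B) = T" "T \<union> B - (T \<union> A) = B" "T \<union> A - (T \<union> B) = A"
      by auto
    ultimately show ?case by simp
  next
    case (4 x)
    then obtain t T B A where x: "x = (t, T, B, A)" "T \<subseteq> F" "card T = t" "B \<subseteq> F'" "A \<subseteq> F - T"
        "card B = b - t" "card A = a - t" "t \<le> a" "t \<le> b"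
      by (auto simp: subsets_of_card_def)
    then have "card (T \<union> A) = a" "card (T \<union> B) = b"
      using finF[of T] finF[of A] finF'[of B] dis by (subst card_Un_disjoint; auto)+
    then show ?case using x by (auto simp: subsets_of_card_def)
  next
    case (5 x)
    then show ?case by auto
  qed
  also have "\<dots> = (\<Sum>t\<le>min a b. \<Sum>T\<in>subsets_of_card F t. \<Sum>B\<in>subsets_of_card F' (b - t).
            \<Sum>A\<in>subsets_of_card (F - T) (a - t). g T B A)"
    using fin by (simp add: sum.Sigma sum.cartesian_product)
  finally show ?thesis .
qed


text \<open>
  The situation of a vector \<open>u\<close> that is fixed modulo the Specht module, stated for words only.  Each
  relation of \<open>coherent_family\<close> is obtained by evaluating a product of two divided powers on \<open>u\<close>
  at one word in two ways.
\<close>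

locale constant_raising = field_of_char p K for p and K :: "'k :: field itself" +
  fixes n :: nat and lam :: "nat \<Rightarrow> nat" and u :: "(nat \<Rightarrow> nat) \<Rightarrow> 'k" and c :: "nat \<Rightarrow> nat \<Rightarrow> 'k"
  assumes p_ge_3: "p \<ge> 3"
    and lam_Suc_le: "lam (Suc i) \<le> lam i"
    and words_nonempty: "words n lam \<noteq> {}"
    and raise_eq: "0 < a \<Longrightarrow> a \<le> lam (Suc i) \<Longrightarrow> w \<in> words n (move (Suc i) i a lam) \<Longrightarrow> raise n i a u w = c i a"
begin

lemma obtain_first_moved_word:
  assumes "a \<le> lam (Suc i)"
  obtains w where "w \<in> words n (move (Suc i) i a lam)"
proof -
  obtain w0 where "w0 \<in> words n lam" using words_nonempty by blast
  then show thesis using that assms obtain_moved_word[of w0 n lam a "Suc i" i] by auto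
qed

lemma divided_power_relation:
  assumes "0 < a" "0 < b" "a + b \<le> lam (Suc i)"
  shows "of_nat ((a + b) choose a) * c i (a + b) = of_nat ((lam i + (a + b)) choose a) * c i b"
proof -
  obtain w where w: "w \<in> words n (move (Suc i) i (a + b) lam)"
    using obtain_first_moved_word assms(3) by blast
  let ?F = "fiber n w i" and ?g = "\<lambda>C. u (relabel w C (Suc i))"
  have mu: "move i (Suc i) a (move (Suc i) i (a + b) lam) = move (Suc i) i b lam"
    using assms by (auto simp: move_def)
  have "of_nat ((a + b) choose a) * c i (a + b) = (\<Sum>A\<in>subsets_of_card ?F a. \<Sum>B\<in>subsets_of_card (?F - A) b. ?g (A \<union> B))"
    using sum_disjoint_pairs[where F = ?F and g = ?g and a = a and b = b] raise_eq[OF _ assms(3) w] assms by (simp add: raise_def)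
  also have "\<dots> = (\<Sum>A\<in>subsets_of_card ?F a. c i b)"
  proof (rule sum.cong)
    fix A assume A: "A \<in> subsets_of_card ?F a"
    have "c i b = raise n i b u (relabel w A (Suc i))"
      using relabel_in_words[OF w A, of "Suc i"] assms by (intro raise_eq[symmetric]) (auto simp: mu)
    also have "\<dots> = (\<Sum>B\<in>subsets_of_card (?F - A) b. ?g (A \<union> B))"
      unfolding raise_def fiber_relabel_source[OF n_not_Suc_n]
      by (intro sum.cong refl arg_cong[of _ _ u]) (auto simp: relabel_def)
    finally show "(\<Sum>B\<in>subsets_of_card (?F - A) b. ?g (A \<union> B)) = c i b" ..
  qed simp
  also have "\<dots> = of_nat ((lam i + (a + b)) choose a) * c i b"
    using w by (simp add: card_subsets_of_card card_fiber move_def)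
  finally show ?thesis .
qed

lemma distant_relation:
  assumes ij: "Suc i < j" and a: "0 < a" "a \<le> lam (Suc i)" and b: "0 < b" "b \<le> lam (Suc j)"
  shows "of_nat ((lam i + a) choose a) * c j b = of_nat ((lam j + b) choose b) * c i a"
proof -
  obtain w0 where w0: "w0 \<in> words n (move (Suc i) i a lam)"
    using obtain_first_moved_word a(2) by blast
  have "b \<le> move (Suc i) i a lam (Suc j)"
    using ij b by (simp add: move_def)
  then obtain w where w: "w \<in> words n (move (Suc j) j b (move (Suc i) i a lam))"
    using obtain_moved_word[OF w0, of b "Suc j" j] by auto
  let ?f = "\<lambda>A B. u (relabel (relabel w A (Suc i)) B (Suc j))"
  have mu1: "move i (Suc i) a (move (Suc j) j b (move (Suc i) i a lam)) = move (Suc j) j b lam"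
    and mu2: "move j (Suc j) b (move (Suc j) j b (move (Suc i) i a lam)) = move (Suc i) i a lam"
    using ij a b by (auto simp: move_def)
  have "of_nat ((lam i + a) choose a) * c j b = (\<Sum>A\<in>subsets_of_card (fiber n w i) a. c j b)"
    using w ij by (simp add: card_subsets_of_card card_fiber move_def)
  also have "\<dots> = (\<Sum>A\<in>subsets_of_card (fiber n w i) a. \<Sum>B\<in>subsets_of_card (fiber n w j) b. ?f A B)"
  proof (rule sum.cong)
    fix A assume A: "A \<in> subsets_of_card (fiber n w i) a"
    have "fiber n (relabel w A (Suc i)) j = fiber n w j"
      using ij subsets_of_cardD(1)[OF A] by (intro fiber_relabel_other) (auto simp: fiber_def)
    moreover have "c j b = raise n j b u (relabel w A (Suc i))"
      using relabel_in_words[OF w A, of "Suc i"] b by (intro raise_eq[symmetric]) (auto simp: mu1)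
    ultimately show "c j b = (\<Sum>B\<in>subsets_of_card (fiber n w j) b. ?f A B)"
      by (simp add: raise_def)
  qed simp
  also have "\<dots> = (\<Sum>B\<in>subsets_of_card (fiber n w j) b. \<Sum>A\<in>subsets_of_card (fiber n w i) a. ?f A B)"
    by (rule sum.swap)
  also have "\<dots> = (\<Sum>B\<in>subsets_of_card (fiber n w j) b. c i a)"
  proof (rule sum.cong)
    fix B assume B: "B \<in> subsets_of_card (fiber n w j) b"
    have "fiber n (relabel w B (Suc j)) i = fiber n w i"
      using ij subsets_of_cardD(1)[OF B] by (intro fiber_relabel_other) (auto simp: fiber_def)
    moreover have "c i a = raise n i a u (relabel w B (Suc j))"
      using relabel_in_words[OF w B, of "Suc j"] a by (intro raise_eq[symmetric]) (auto simp: mu2)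
    moreover have "relabel (relabel w A (Suc i)) B (Suc j) = relabel (relabel w B (Suc j)) A (Suc i)"
      if "A \<in> subsets_of_card (fiber n w i) a" for A
      using subsets_of_cardD(1)[OF that] subsets_of_cardD(1)[OF B] ij by (fastforce simp: relabel_def fiber_def)
    ultimately show "(\<Sum>A\<in>subsets_of_card (fiber n w i) a. ?f A B) = c i a"
      by (simp add: raise_def)
  qed simp
  also have "\<dots> = of_nat ((lam j + b) choose b) * c i a"
    using w ij by (simp add: card_subsets_of_card card_fiber move_def)
  finally show ?thesis .
qed

text \<open>
  For fixed \<open>T\<close> and \<open>B\<close> the sum over \<open>A\<close> in \<open>sum_overlapping_pairs\<close> is again a raising operator, of
  degree $a - t$, and contributes $c_i(a-t)$.  In the term $t = a$ nothing is left to raise;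
  it is kept as a sum over \<open>u\<close>.
\<close>

lemma adjacent_expansion:
  assumes w: "w \<in> words n (move (Suc i) i a (move (Suc (Suc i)) (Suc i) b lam))"
    and a: "0 < a" "a \<le> lam (Suc i) + b" and b: "0 < b" "b \<le> lam (Suc (Suc i))"
  shows "of_nat ((lam i + a) choose a) * c (Suc i) b =
     (\<Sum>t\<in>{..min a b} - {a}. of_nat ((lam i + a) choose t) *
        of_nat ((lam (Suc i) + b - a) choose (b - t)) * c i (a - t)) +
     (if a \<le> b then \<Sum>T\<in>subsets_of_card (fiber n w i) a. \<Sum>B\<in>subsets_of_card (fiber n w (Suc i)) (b - a).
        u (relabel w (T \<union> B) (Suc (Suc i))) else 0)"
proof -
  let ?F = "fiber n w i" and ?F' = "fiber n w (Suc i)"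
  let ?g = "\<lambda>T B A. u (relabel (relabel w (T \<union> B) (Suc (Suc i))) A (Suc i))"
  have cF: "card ?F = lam i + a" and cF': "card ?F' = lam (Suc i) + b - a"
    using w by (simp_all add: card_fiber move_def)
  have mu: "move i (Suc i) a (move (Suc i) i a (move (Suc (Suc i)) (Suc i) b lam)) = move (Suc (Suc i)) (Suc i) b lam"
    using a by (auto simp: move_def)
  have "of_nat ((lam i + a) choose a) * c (Suc i) b = (\<Sum>A\<in>subsets_of_card ?F a. c (Suc i) b)"
    by (simp add: card_subsets_of_card cF)
  also have "\<dots> = (\<Sum>A\<in>subsets_of_card ?F a. \<Sum>B\<in>subsets_of_card (?F' \<union> A) b. ?g (A \<inter> B) (B - A) (A - B))"
  proof (rule sum.cong)
    fix A assume A: "A \<in> subsets_of_card ?F a"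
    have "A \<subseteq> {1..n}" using subsets_of_cardD(1)[OF A] fiber_subset by blast
    then have "fiber n (relabel w A (Suc i)) (Suc i) = ?F' \<union> A"
      by (rule fiber_relabel_target)
    moreover have "c (Suc i) b = raise n (Suc i) b u (relabel w A (Suc i))"
      using relabel_in_words[OF w A, of "Suc i"] b by (intro raise_eq[symmetric]) (auto simp: mu)
    moreover have "relabel (relabel w A (Suc i)) B (Suc (Suc i)) =
        relabel (relabel w (A \<inter> B \<union> (B - A)) (Suc (Suc i))) (A - B) (Suc i)" for B
      by (auto simp: relabel_def)
    ultimately show "c (Suc i) b = (\<Sum>B\<in>subsets_of_card (?F' \<union> A) b. ?g (A \<inter> B) (B - A) (A - B))"
      by (simp add: raise_def)
  qed simp
  also have "\<dots> = (\<Sum>t\<le>min a b. \<Sum>T\<in>subsets_of_card ?F t. \<Sum>B\<in>subsets_of_card ?F' (b - t).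
            \<Sum>A\<in>subsets_of_card (?F - T) (a - t). ?g T B A)"
    by (rule sum_overlapping_pairs) (auto simp: fiber_def)
  also have "\<dots> = (\<Sum>t\<in>{..min a b} - {a}. \<Sum>T\<in>subsets_of_card ?F t. \<Sum>B\<in>subsets_of_card ?F' (b - t).
            \<Sum>A\<in>subsets_of_card (?F - T) (a - t). ?g T B A) +
      (if a \<le> b then \<Sum>T\<in>subsets_of_card ?F a. \<Sum>B\<in>subsets_of_card ?F' (b - a).
            \<Sum>A\<in>subsets_of_card (?F - T) (a - a). ?g T B A else 0)" (is "_ = ?s1 + ?s2")
  proof (cases "a \<le> b")
    case True
    then show ?thesis
      by (subst sum.remove[of "{..min a b}" a]) (simp_all add: add.commute)
  next
    case False
    then have "{..min a b} - {a} = {..min a b}" by auto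
    then show ?thesis using False by simp
  qed
  also have "?s1 = (\<Sum>t\<in>{..min a b} - {a}. \<Sum>T\<in>subsets_of_card ?F t. \<Sum>B\<in>subsets_of_card ?F' (b - t). c i (a - t))"
  proof (intro sum.cong refl)
    fix t T B assume t: "t \<in> {..min a b} - {a}" and T: "T \<in> subsets_of_card ?F t" and B: "B \<in> subsets_of_card ?F' (b - t)"
    let ?w = "relabel w (T \<union> B) (Suc (Suc i))"
    have le: "b - t \<le> lam (Suc i) + b - a"
      using subsets_of_cardD[OF B] card_mono[of ?F' B] cF' by auto
    have at: "0 < a - t" "a - t \<le> lam (Suc i)"
      using t le a by auto
    have wT: "relabel w T (Suc (Suc i)) \<in> words n (move i (Suc (Suc i)) t (move (Suc i) i a (move (Suc (Suc i)) (Suc i) b lam)))"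
      using relabel_in_words[OF w T] by simp
    have "fiber n (relabel w T (Suc (Suc i))) (Suc i) = ?F'"
      using subsets_of_cardD(1)[OF T] by (intro fiber_relabel_other) (auto simp: fiber_def)
    then have "relabel (relabel w T (Suc (Suc i))) B (Suc (Suc i)) \<in>
        words n (move (Suc i) (Suc (Suc i)) (b - t) (move i (Suc (Suc i)) t (move (Suc i) i a (move (Suc (Suc i)) (Suc i) b lam))))"
      using relabel_in_words[OF wT, of B "Suc i" "b - t" "Suc (Suc i)"] B by simp
    moreover have "relabel (relabel w T (Suc (Suc i))) B (Suc (Suc i)) = ?w"
      by (auto simp: relabel_def)
    moreover have "move (Suc i) (Suc (Suc i)) (b - t) (move i (Suc (Suc i)) t (move (Suc i) i a (move (Suc (Suc i)) (Suc i) b lam)))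
        = move (Suc i) i (a - t) lam"
      using t b le a by (auto simp: move_def)
    ultimately have "raise n i (a - t) u ?w = c i (a - t)"
      using at by (intro raise_eq) auto
    moreover have "fiber n ?w i = ?F - T"
      using subsets_of_cardD(1)[OF B] by (auto simp: fiber_def relabel_def)
    ultimately show "(\<Sum>A\<in>subsets_of_card (?F - T) (a - t). ?g T B A) = c i (a - t)"
      by (simp add: raise_def)
  qed
  also have "\<dots> = (\<Sum>t\<in>{..min a b} - {a}. of_nat ((lam i + a) choose t) *
        of_nat ((lam (Suc i) + b - a) choose (b - t)) * c i (a - t))"
    by (simp add: card_subsets_of_card cF cF' mult.assoc)
  also have "?s2 = (if a \<le> b then \<Sum>T\<in>subsets_of_card ?F a. \<Sum>B\<in>subsets_of_card ?F' (b - a).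
        u (relabel w (T \<union> B) (Suc (Suc i))) else 0)"
  proof -
    have "subsets_of_card (?F - T) 0 = {{}}" for T
      by (auto simp: subsets_of_card_def finite_subset[OF _ finite_Diff[OF finite_fiber]])
    moreover have "relabel w' {} j = w'" for w' j
      by (simp add: relabel_def)
    ultimately show ?thesis by simp
  qed
  finally show ?thesis .
qed

lemma obtain_adjacent_word:
  assumes "a \<le> lam (Suc i) + b" "b \<le> lam (Suc (Suc i))"
  obtains w where "w \<in> words n (move (Suc i) i a (move (Suc (Suc i)) (Suc i) b lam))"
proof -
  obtain w0 where w0: "w0 \<in> words n (move (Suc (Suc i)) (Suc i) b lam)"
    using obtain_first_moved_word assms(2) by blast
  then show thesis
    using that obtain_moved_word[OF w0, of a "Suc i" i] assms by (auto simp: move_def)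
qed

lemma adjacent_gt_relation:
  assumes "0 < b" "b \<le> lam (Suc (Suc i))" "b < a" "a \<le> lam (Suc i) + b"
  shows "of_nat ((lam i + a) choose a) * c (Suc i) b =
    (\<Sum>t\<le>b. of_nat ((lam i + a) choose t) * of_nat ((lam (Suc i) + b - a) choose (b - t)) * c i (a - t))"
proof -
  obtain w where w: "w \<in> words n (move (Suc i) i a (move (Suc (Suc i)) (Suc i) b lam))"
    using obtain_adjacent_word assms by blast
  have "{..min a b} - {a} = {..b}" using assms by auto
  then show ?thesis
    using adjacent_expansion[OF w _ assms(4,1,2)] assms by simp
qed

lemma adjacent_le_relation:
  assumes a: "0 < a"
  shows "\<exists>d. \<forall>b. a \<le> b \<longrightarrow> b \<le> lam (Suc (Suc i)) \<longrightarrow>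
      of_nat ((lam i + a) choose a) * c (Suc i) b =
        (\<Sum>t<a. of_nat ((lam i + a) choose t) * of_nat ((lam (Suc i) + b - a) choose (b - t)) * c i (a - t))
        + of_nat ((lam (Suc i) + b - a) choose (b - a)) * d"
proof -
  let ?s = "\<lambda>b. \<Sum>t<a. of_nat ((lam i + a) choose t) * of_nat ((lam (Suc i) + b - a) choose (b - t)) * c i (a - t)"
  (* The case b = a of the expansion shows that the sum of u over all ways of moving a entries
     from row i + 2 to row i is a constant, and computes it. *)
  define d where "d = of_nat ((lam i + a) choose a) * c (Suc i) a - ?s a"
  have set_eq: "{..min a b} - {a} = {..<a}" if "a \<le> b" for b using that by auto
  have d: "(\<Sum>T\<in>subsets_of_card (fiber n w i) a. u (relabel w T (Suc (Suc i)))) = d"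
    if w: "w \<in> words n (move (Suc (Suc i)) i a lam)" and le: "a \<le> lam (Suc (Suc i))" for w
  proof -
    have mu: "move (Suc i) i a (move (Suc (Suc i)) (Suc i) a lam) = move (Suc (Suc i)) i a lam"
      by (auto simp: move_def)
    have "subsets_of_card (fiber n w (Suc i)) 0 = {{}}"
      by (auto simp: subsets_of_card_def finite_subset[OF _ finite_fiber])
    then show ?thesis
      using adjacent_expansion[of w i a a] w le a unfolding mu d_def set_eq[OF order_refl] by simp
  qed
  have "of_nat ((lam i + a) choose a) * c (Suc i) b = ?s b + of_nat ((lam (Suc i) + b - a) choose (b - a)) * d"
    if ab: "a \<le> b" and b: "b \<le> lam (Suc (Suc i))" for b
  proof -
    obtain w where w: "w \<in> words n (move (Suc i) i a (move (Suc (Suc i)) (Suc i) b lam))"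
      using obtain_adjacent_word[of a i b] ab b by auto
    let ?F = "fiber n w i" and ?F' = "fiber n w (Suc i)"
    have "(\<Sum>T\<in>subsets_of_card ?F a. \<Sum>B\<in>subsets_of_card ?F' (b - a). u (relabel w (T \<union> B) (Suc (Suc i)))) =
          (\<Sum>B\<in>subsets_of_card ?F' (b - a). \<Sum>T\<in>subsets_of_card ?F a. u (relabel w (T \<union> B) (Suc (Suc i))))"
      by (rule sum.swap)
    also have "\<dots> = (\<Sum>B\<in>subsets_of_card ?F' (b - a). d)"
    proof (rule sum.cong)
      fix B assume B: "B \<in> subsets_of_card ?F' (b - a)"
      let ?w = "relabel w B (Suc (Suc i))"
      have "?w \<in> words n (move (Suc i) (Suc (Suc i)) (b - a) (move (Suc i) i a (move (Suc (Suc i)) (Suc i) b lam)))"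
        using relabel_in_words[OF w B, of "Suc (Suc i)"] by simp
      also have "move (Suc i) (Suc (Suc i)) (b - a) (move (Suc i) i a (move (Suc (Suc i)) (Suc i) b lam)) = move (Suc (Suc i)) i a lam"
        using ab b by (auto simp: move_def)
      finally have "(\<Sum>T\<in>subsets_of_card (fiber n ?w i) a. u (relabel ?w T (Suc (Suc i)))) = d"
        using d ab b by auto
      moreover have "fiber n ?w i = ?F"
        using subsets_of_cardD(1)[OF B] by (intro fiber_relabel_other) (auto simp: fiber_def)
      moreover have "relabel ?w T (Suc (Suc i)) = relabel w (T \<union> B) (Suc (Suc i))" for T
        by (auto simp: relabel_def)
      ultimately show "(\<Sum>T\<in>subsets_of_card ?F a. u (relabel w (T \<union> B) (Suc (Suc i)))) = d"
        by simp
    qed simp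
    also have "\<dots> = of_nat ((lam (Suc i) + b - a) choose (b - a)) * d"
      using w by (simp add: card_subsets_of_card card_fiber move_def)
    finally show ?thesis
      using adjacent_expansion[OF w a _ _ b] ab a unfolding set_eq[OF ab] by simp
  qed
  then show ?thesis by blast
qed

sublocale coherent_family p K lam c
  using p_ge_3 lam_Suc_le divided_power_relation distant_relation adjacent_gt_relation adjacent_le_relation
  by unfold_locales auto

end

section \<open>Leading words\<close>

text \<open>
  Reading a word as a number in base \<open>N\<close>, with the letter of the largest entry as the leading digit,
  orders the words linearly: two words are compared at the largest entry where they differ.
\<close>

definition word_value :: "nat \<Rightarrow> nat \<Rightarrow> (nat \<Rightarrow> nat) \<Rightarrow> nat" where
  "word_value N n w = (\<Sum>x\<in>{1..n}. w x * N ^ x)"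

lemma word_value_less:
  assumes "\<And>y. y \<in> {1..n} \<Longrightarrow> f y < N" and x: "x \<in> {1..n}" and less: "f x < g x"
    and eq: "\<And>y. y \<in> {1..n} \<Longrightarrow> x < y \<Longrightarrow> f y = g y"
  shows "word_value N n f < word_value N n g"
proof -
  have split: "{1..n} = {1..<x} \<union> ({x} \<union> {x<..n})" using x by auto
  have sum_split: "(\<Sum>y\<in>{1..n}. h y) = (\<Sum>y\<in>{1..<x}. h y) + (h x + (\<Sum>y\<in>{x<..n}. h y))" for h :: "nat \<Rightarrow> nat"
    unfolding split by (subst sum.union_disjoint; auto)+
  have geo: "(\<Sum>y\<in>{1..<m}. (N - 1) * N ^ y) < N ^ m" if "N > 0" for m
  proof (induction m)
    case (Suc m)
    show ?case
    proof (cases "m = 0")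
      case True
      then show ?thesis using that by simp
    next
      case False
      then have "{1..<Suc m} = insert m {1..<m}" by auto
      then have "(\<Sum>y\<in>{1..<Suc m}. (N - 1) * N ^ y) = (N - 1) * N ^ m + (\<Sum>y\<in>{1..<m}. (N - 1) * N ^ y)"
        by simp
      also have "\<dots> < (N - 1) * N ^ m + N ^ m" using Suc by simp
      also have "\<dots> = N ^ Suc m" using that by (simp add: algebra_simps)
      finally show ?thesis .
    qed
  qed (use that in simp)
  have N: "N > 0" using assms(1)[OF x] by simp
  have "(\<Sum>y\<in>{1..<x}. f y * N ^ y) \<le> (\<Sum>y\<in>{1..<x}. (N - 1) * N ^ y)"
  proof (intro sum_mono mult_le_mono1)
    fix y assume "y \<in> {1..<x}"
    then have "f y < N" using x by (intro assms(1)) auto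
    then show "f y \<le> N - 1" by simp
  qed
  also have "\<dots> < N ^ x" by (rule geo[OF N])
  finally have "(\<Sum>y\<in>{1..<x}. f y * N ^ y) + f x * N ^ x < Suc (f x) * N ^ x" by simp
  also have "\<dots> \<le> g x * N ^ x" using less by (intro mult_le_mono1) simp
  finally have "(\<Sum>y\<in>{1..<x}. f y * N ^ y) + f x * N ^ x < g x * N ^ x" .
  moreover have "(\<Sum>y\<in>{x<..n}. f y * N ^ y) = (\<Sum>y\<in>{x<..n}. g y * N ^ y)"
    using x by (intro sum.cong) (auto simp: eq)
  ultimately show ?thesis
    unfolding word_value_def sum_split by linarith
qed

lemma words_bound:
  assumes "w \<in> words n mu" and "\<And>i. N \<le> i \<Longrightarrow> mu i = 0" and "x \<in> {1..n}"
  shows "w x < N"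
proof (rule ccontr)
  assume "\<not> w x < N"
  then have "card (fiber n w (w x)) = 0" using assms(1,2) by (simp add: card_fiber)
  then show False using assms(3) by (auto simp: mem_fiber)
qed

lemma word_value_inj:
  assumes "w \<in> words n mu" "w' \<in> words n mu" and bound: "\<And>i. N \<le> i \<Longrightarrow> mu i = 0"
    and "word_value N n w = word_value N n w'"
  shows "w = w'"
proof (rule ccontr)
  assume ne: "w \<noteq> w'"
  let ?D = "{x \<in> {1..n}. w x \<noteq> w' x}"
  have "?D \<noteq> {}"
  proof
    assume D: "?D = {}"
    have "w x = w' x" for x
      using D assms(1,2) by (cases "x \<in> {1..n}") (auto simp: words_def)
    then show False using ne by auto
  qed
  then have m: "Max ?D \<in> ?D" by (intro Max_in) auto
  define x where "x = Max ?D"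
  have x: "x \<in> {1..n}" "w x \<noteq> w' x" using m unfolding x_def by auto
  have eq: "w y = w' y" if "y \<in> {1..n}" "x < y" for y
  proof (rule ccontr)
    assume "w y \<noteq> w' y"
    then have "y \<le> x" unfolding x_def using that by (intro Max_ge) auto
    then show False using that by simp
  qed
  have b: "w y < N" "w' y < N" if "y \<in> {1..n}" for y
    using words_bound[of w n mu N y] words_bound[of w' n mu N y] assms(1,2) bound that by auto
  show False
  proof (cases "w x < w' x")
    case True
    have "word_value N n w < word_value N n w'"
      by (rule word_value_less[of n w N x w', OF b(1) x(1) True eq])
    then show False using assms by simp
  next
    case False
    then have "w' x < w x" using x by simp
    then have "word_value N n w' < word_value N n w"
      using word_value_less[of n w' N x w, OF b(2) x(1) _ eq[symmetric]] by simp
    then show False using assms by simp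
  qed
qed

text \<open>
  Membership in the common kernel of all raising operators $e_i^{(a)}$, $a \ge 1$, on the space of
  words of content \<open>lam\<close>.
\<close>

definition annihilated :: "nat \<Rightarrow> (nat \<Rightarrow> nat) \<Rightarrow> ((nat \<Rightarrow> nat) \<Rightarrow> 'k::comm_ring_1) \<Rightarrow> bool" where
  "annihilated n lam v \<longleftrightarrow> (\<forall>i a w. 0 < a \<longrightarrow> a \<le> lam (Suc i) \<longrightarrow> w \<in> words n (move (Suc i) i a lam) \<longrightarrow>
     raise n i a v w = 0)"

text \<open>
  The sum runs over all ways of choosing which entries \<open>R\<close> of rows \<open>i\<close> and $i+1$ lie in row $i+1$,
  with \<open>B\<close> forced to be in row $i+1$ and \<open>A\<close> forced to stay in row \<open>i\<close>.  For empty \<open>A\<close> it is a value of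
  a raising operator; inclusion and exclusion over \<open>A\<close> gives the general case, where
  $|A| + |B| < m$ keeps every operator that occurs of positive degree.
\<close>

lemma garnir_relation:
  fixes v :: "(nat \<Rightarrow> nat) \<Rightarrow> 'k::comm_ring_1"
  assumes v: "annihilated n lam v" and w: "w \<in> words n lam"
    and P: "P = fiber n w i \<union> fiber n w (Suc i)"
    and w0: "w0 = relabel w (fiber n w (Suc i)) i"
    and m: "m = lam (Suc i)"
    and A: "finite A" and AB: "A \<inter> B = {}" "A \<subseteq> P" "B \<subseteq> P" and small: "card A + card B < m"
  shows "(\<Sum>R\<in>{R \<in> subsets_of_card P m. B \<subseteq> R \<and> R \<inter> A = {}}. v (relabel w0 R (Suc i))) = 0"
proof -
  have finP: "finite P" unfolding P by simp
  have F': "fiber n w (Suc i) \<in> subsets_of_card (fiber n w (Suc i)) m"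
    using w by (simp add: subsets_of_card_def card_fiber m)
  have w0': "w0 \<in> words n (move (Suc i) i m lam)"
    unfolding w0 using relabel_in_words[OF w F', of i] by simp
  have fib: "fiber n w0 i = P"
    unfolding w0 P by (rule fiber_relabel_target[OF fiber_subset])
  from A AB small show ?thesis
  proof (induction A arbitrary: B)
    case empty
    have finB: "finite B" using empty finP finite_subset by blast
    define a where "a = m - card B"
    have a: "0 < a" "a \<le> lam (Suc i)" using empty unfolding a_def m by auto
    have B: "B \<in> subsets_of_card (fiber n w0 i) (card B)"
      using empty unfolding fib by (simp add: subsets_of_card_def)
    have "move i (Suc i) (card B) (move (Suc i) i m lam) = move (Suc i) i a lam"
      using empty unfolding a_def m by (auto simp: move_def)
    then have wB: "relabel w0 B (Suc i) \<in> words n (move (Suc i) i a lam)"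
      using relabel_in_words[OF w0' B, of "Suc i"] by simp
    have "(\<Sum>R\<in>{R \<in> subsets_of_card P m. B \<subseteq> R \<and> R \<inter> {} = {}}. v (relabel w0 R (Suc i))) =
          (\<Sum>A\<in>subsets_of_card (P - B) a. v (relabel (relabel w0 B (Suc i)) A (Suc i)))"
    proof (rule sum.reindex_bij_witness[of _ "\<lambda>A. A \<union> B" "\<lambda>R. R - B"], goal_cases)
      case (2 R)
      then show ?case
        using finB card_Diff_subset[OF finB, of R] by (auto simp: subsets_of_card_def a_def)
    next
      case (4 A)
      then have "card (A \<union> B) = m"
        using finP finB empty finite_subset[of A P]
        by (subst card_Un_disjoint) (auto simp: subsets_of_card_def a_def)
      then show ?case using 4 empty by (auto simp: subsets_of_card_def)
    next
      case (5 R)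
      have "relabel (relabel w0 B (Suc i)) (R - B) (Suc i) = relabel w0 (B \<union> R) (Suc i)"
        by (auto simp: relabel_def)
      moreover have "B \<union> R = R" using 5 by auto
      ultimately show ?case by simp
    qed (auto simp: subsets_of_card_def)
    also have "\<dots> = raise n i a v (relabel w0 B (Suc i))"
      unfolding raise_def fiber_relabel_source[OF n_not_Suc_n] fib ..
    also have "\<dots> = 0"
      using v a wB unfolding annihilated_def by blast
    finally show ?case .
  next
    case (insert x A)
    note prems = insert.prems insert.hyps
    have finB: "finite B" using prems(3) finP finite_subset by blast
    let ?S = "\<lambda>A B. {R \<in> subsets_of_card P m. B \<subseteq> R \<and> R \<inter> A = {}}"
    let ?v = "\<lambda>R. v (relabel w0 R (Suc i))"
    have 1: "(\<Sum>R\<in>?S A B. ?v R) = 0"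
      using prems by (intro insert.IH) auto
    have 2: "(\<Sum>R\<in>?S A (insert x B). ?v R) = 0"
      using prems finB by (intro insert.IH) auto
    have un: "?S A B = ?S (insert x A) B \<union> ?S A (insert x B)" by auto
    have dis: "?S (insert x A) B \<inter> ?S A (insert x B) = {}" by auto
    have fin: "finite (?S C D)" for C D using finP by simp
    have "(\<Sum>R\<in>?S A B. ?v R) = (\<Sum>R\<in>?S (insert x A) B. ?v R) + (\<Sum>R\<in>?S A (insert x B). ?v R)"
      unfolding un by (rule sum.union_disjoint[OF fin fin dis])
    then show ?case using 1 2 by simp
  qed
qed

text \<open>
  If the column \<open>j\<close> of the row-sorted tableau had a descent between rows \<open>i\<close> and $i+1$, then the
  Garnir relation for the entries from column \<open>j\<close> on in row \<open>i\<close> and up to column \<open>j\<close> in row $i+1$ would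
  express the coefficient of the leading word by coefficients of larger words, which all vanish.
\<close>

theorem leading_word_standard:
  fixes v :: "(nat \<Rightarrow> nat) \<Rightarrow> 'k::comm_ring_1"
  assumes v: "annihilated n lam v" and w: "w \<in> words n lam"
    and bound: "\<And>i. N \<le> i \<Longrightarrow> lam i = 0"
    and lead: "v w \<noteq> 0" "\<And>w'. w' \<in> words n lam \<Longrightarrow> word_value N n w < word_value N n w' \<Longrightarrow> v w' = 0"
    and j: "j < lam (Suc i)" and le: "lam (Suc i) \<le> lam i"
  shows "sorted_list_of_set (fiber n w i) ! j < sorted_list_of_set (fiber n w (Suc i)) ! j"
proof (rule ccontr)
  let ?F = "fiber n w i" and ?F' = "fiber n w (Suc i)"
  let ?a = "sorted_list_of_set (fiber n w i)" and ?b = "sorted_list_of_set (fiber n w (Suc i))"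
  define m where "m = lam (Suc i)"
  assume "\<not> ?a ! j < ?b ! j"
  have len: "length ?a = lam i" "length ?b = m"
    using w by (simp_all add: card_fiber m_def)
  have mem: "?a ! k \<in> ?F" if "k < lam i" for k
    using nth_mem[of k ?a] that len by simp
  have mem': "?b ! k \<in> ?F'" if "k < m" for k
    using nth_mem[of k ?b] that len by simp
  have jl: "j < lam i" "j < m" using j le by (simp_all add: m_def)
  have "?a ! j \<noteq> ?b ! j"
    using mem[OF jl(1)] mem'[OF jl(2)] by (auto simp: fiber_def)
  then have desc: "?b ! j < ?a ! j" using \<open>\<not> ?a ! j < ?b ! j\<close> by simp
  define A where "A = set (take j ?a)"
  define B where "B = set (drop (Suc j) ?b)"
  define P where "P = ?F \<union> ?F'"
  define w0 where "w0 = relabel w ?F' i"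
  have A_sub: "A \<subseteq> ?F" and B_sub: "B \<subseteq> ?F'"
    unfolding A_def B_def using set_take_subset[of j ?a] set_drop_subset[of "Suc j" ?b] by auto
  have "card A = j" "card B = m - Suc j"
    unfolding A_def B_def using len jl by (simp_all add: distinct_card)
  then have small: "card A + card B < m" using jl by simp
  have high: "?a ! j \<le> z" if z: "z \<in> ?F" "z \<notin> A" for z
  proof -
    obtain k where k: "k < lam i" "z = ?a ! k"
      using z len by (metis finite_fiber in_set_conv_nth set_sorted_list_of_set)
    have "\<not> k < j"
    proof
      assume "k < j"
      then have "z \<in> set (take j ?a)" using k len by (auto simp: in_set_conv_nth intro!: exI[of _ k])
      then show False using z by (simp add: A_def)
    qed
    then show ?thesis using k len by (simp add: sorted_nth_mono)
  qed
  have low: "z \<le> ?b ! j" if z: "z \<in> ?F'" "z \<notin> B" for z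
  proof -
    obtain k where k: "k < m" "z = ?b ! k"
      using z len by (metis finite_fiber in_set_conv_nth set_sorted_list_of_set)
    have "\<not> Suc j \<le> k"
    proof
      assume "Suc j \<le> k"
      then have "z \<in> set (drop (Suc j) ?b)" using k len
        by (auto simp: in_set_conv_nth intro!: exI[of _ "k - Suc j"])
      then show False using z by (simp add: B_def)
    qed
    then show ?thesis using k len jl by (simp add: sorted_nth_mono)
  qed
  let ?S = "{R \<in> subsets_of_card P m. B \<subseteq> R \<and> R \<inter> A = {}}"
  have finP: "finite P" by (simp add: P_def)
  have F'_in: "?F' \<in> ?S"
  proof -
    have "?F' \<inter> A = {}" using A_sub by (auto simp: fiber_def)
    then show ?thesis using w B_sub by (simp add: subsets_of_card_def P_def card_fiber m_def)
  qed
  have F'_in_sub: "?F' \<in> subsets_of_card ?F' m"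
    using w by (simp add: subsets_of_card_def card_fiber m_def)
  have "(\<Sum>R\<in>?S. v (relabel w0 R (Suc i))) = 0"
  proof (rule garnir_relation[OF v w P_def w0_def m_def])
    show "finite A" by (simp add: A_def)
    have "?F \<inter> ?F' = {}" by (auto simp: fiber_def)
    then show "A \<inter> B = {}" using A_sub B_sub by blast
  qed (use A_sub B_sub small in \<open>auto simp: P_def\<close>)
  moreover have "v (relabel w0 R (Suc i)) = 0" if R: "R \<in> ?S - {?F'}" for R
  proof (rule lead(2))
    have finR: "finite R" using R finP finite_subset by (auto simp: subsets_of_card_def)
    have fib: "fiber n w0 i = P"
      unfolding w0_def P_def by (rule fiber_relabel_target[OF fiber_subset])
    have w0': "w0 \<in> words n (move (Suc i) i m lam)"
      unfolding w0_def using relabel_in_words[OF w F'_in_sub, of i] by simp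
    have "R \<in> subsets_of_card (fiber n w0 i) m" using R fib by simp
    then have "relabel w0 R (Suc i) \<in> words n (move i (Suc i) m (move (Suc i) i m lam))"
      using relabel_in_words[OF w0'] by simp
    moreover have "move i (Suc i) m (move (Suc i) i m lam) = lam"
      by (auto simp: move_def m_def)
    ultimately show wR: "relabel w0 R (Suc i) \<in> words n lam" by simp
    have ne: "R - ?F' \<noteq> {}"
    proof
      assume "R - ?F' = {}"
      then have "R \<subseteq> ?F'" by auto
      moreover have "card R = card ?F'" using R w by (auto simp: subsets_of_card_def card_fiber m_def)
      ultimately have "R = ?F'" by (intro card_subset_eq) auto
      then show False using R by simp
    qed
    define x where "x = Max (R - ?F')"
    have x: "x \<in> R - ?F'" unfolding x_def using ne finR by (intro Max_in) auto
    then have xF: "x \<in> ?F" "x \<notin> A" using R by (auto simp: subsets_of_card_def P_def)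
    (* Only entries up to b_j can leave row i + 1, and only entries from a_j > b_j on can enter it;
       so the largest entry that changes its row moves down. *)
    have x_high: "?b ! j < x" using desc high[OF xF] by simp
    show "word_value N n w < word_value N n (relabel w0 R (Suc i))"
    proof (rule word_value_less)
      show "x \<in> {1..n}" using xF fiber_subset by blast
      show "w x < relabel w0 R (Suc i) x" using x xF by (simp add: relabel_def fiber_def)
      fix y assume y: "y \<in> {1..n}" "x < y"
      have "y \<notin> R - ?F'" using y Max_ge[of "R - ?F'" y] finR unfolding x_def by (meson finite_Diff not_less)
      moreover have "y \<notin> ?F' - R"
      proof
        assume "y \<in> ?F' - R"
        then have "y \<le> ?b ! j" using R by (intro low) auto
        then show False using x_high y by simp
      qed
      ultimately show "w y = relabel w0 R (Suc i) y"
        using R y by (cases "y \<in> R"; cases "y \<in> ?F'") (auto simp: relabel_def w0_def mem_fiber)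
    next
      show "w y < N" if "y \<in> {1..n}" for y using words_bound[of w n lam N y] w bound that by auto
    qed
  qed
  ultimately have "v (relabel w0 ?F' (Suc i)) = 0"
    using F'_in finP sum.remove[of ?S ?F' "\<lambda>R. v (relabel w0 R (Suc i))"] by simp
  moreover have "relabel w0 ?F' (Suc i) = w"
    by (auto simp: relabel_def w0_def fiber_def)
  ultimately show False using lead by simp
qed

section \<open>Tabloids as words\<close>

definition row_length :: "nat list \<Rightarrow> nat \<Rightarrow> nat" where
  "row_length la i = (if i < length la then la ! i else 0)"

definition row_word :: "nat list \<Rightarrow> (nat \<times> nat \<Rightarrow> nat) \<Rightarrow> nat \<Rightarrow> nat" where
  "row_word la t = (\<lambda>x. if x \<in> {1..sum_list la} then fst (inv_into (young_diagram la) t x) else 0)"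

definition word_tabloid :: "nat list \<Rightarrow> (nat \<Rightarrow> nat) \<Rightarrow> tabloid" where
  "word_tabloid la w = {t \<in> tableaux la. \<forall>i j. (i, j) \<in> young_diagram la \<longrightarrow> w (t (i, j)) = i}"

definition row_reading :: "nat list \<Rightarrow> (nat \<Rightarrow> nat) \<Rightarrow> nat \<times> nat \<Rightarrow> nat" where
  "row_reading la w = (\<lambda>(i, j). if (i, j) \<in> young_diagram la
     then sorted_list_of_set (fiber (sum_list la) w i) ! j else 0)"

definition word_coeff :: "nat list \<Rightarrow> (tabloid \<Rightarrow> 'k) \<Rightarrow> (nat \<Rightarrow> nat) \<Rightarrow> 'k" where
  "word_coeff la v w = v (word_tabloid la w)"

lemma mem_young_diagram: "(i, j) \<in> young_diagram la \<longleftrightarrow> j < row_length la i"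
  by (auto simp: young_diagram_def row_length_def)

lemma module_class_ring_iff_vectorspace:
  "Module.module (class_ring :: 'k :: field ring) V \<Longrightarrow> vectorspace class_ring V"
  by (simp add: vectorspace_def class_field)

lemma perm_module_simps:
  "carrier (perm_module la) = {v. \<forall>T. T \<notin> tabloids la \<longrightarrow> v T = 0}"
  "zero (perm_module la) = (\<lambda>T. 0)"
  "add (perm_module la) = (\<lambda>v w T. v T + w T)"
  "module.smult (perm_module la) = (\<lambda>c v T. c * v T)"
  by (simp_all add: perm_module_def)

lemma perm_module_module: "Module.module class_ring (perm_module la :: ('k :: field, _) module)"
proof (rule module_criteria)
  show "\<forall>v\<in>carrier (perm_module la :: ('k, _) module). \<exists>neg_v\<in>carrier (perm_module la). v \<oplus>\<^bsub>perm_module la\<^esub> neg_v = \<zero>\<^bsub>perm_module la\<^esub>"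
  proof
    fix v :: "tabloid \<Rightarrow> 'k" assume "v \<in> carrier (perm_module la)"
    then show "\<exists>neg_v\<in>carrier (perm_module la). v \<oplus>\<^bsub>perm_module la\<^esub> neg_v = \<zero>\<^bsub>perm_module la\<^esub>"
      by (intro bexI[of _ "\<lambda>T. - v T"]) (auto simp: perm_module_simps)
  qed
qed (auto simp: perm_module_simps class_ring_simps algebra_simps class_cring.is_cring)

lemma perm_module_vectorspace: "vectorspace class_ring (perm_module la :: ('k :: field, _) module)"
  by (rule module_class_ring_iff_vectorspace[OF perm_module_module])

locale partition_shape =
  fixes la :: "nat list" and n :: nat
  assumes partition: "partition_of la n"
begin

abbreviation "lam \<equiv> row_length la"
abbreviation "D \<equiv> young_diagram la"

lemma sum_la [simp]: "sum_list la = n"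
  using partition by (simp add: partition_of_def)

lemma lam_Suc_le: "lam (Suc i) \<le> lam i"
  using partition by (auto simp: partition_of_def row_length_def sorted_wrt_iff_nth_less)

lemma lam_eq_0: "length la \<le> i \<Longrightarrow> lam i = 0"
  by (simp add: row_length_def)

lemma tableau_bij: "t \<in> tableaux la \<Longrightarrow> bij_betw t D {1..n}"
  by (simp add: tableaux_def)

lemma tableau_inj: "t \<in> tableaux la \<Longrightarrow> c \<in> D \<Longrightarrow> c' \<in> D \<Longrightarrow> t c = t c' \<longleftrightarrow> c = c'"
  using tableau_bij[THEN bij_betw_imp_inj_on] by (metis inj_on_eq_iff)

lemma tableau_mem: "t \<in> tableaux la \<Longrightarrow> c \<in> D \<Longrightarrow> t c \<in> {1..n}"
  by (rule bij_betwE[OF tableau_bij, rule_format])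

lemma tableau_surj:
  assumes "t \<in> tableaux la" "x \<in> {1..n}"
  obtains i j where "(i, j) \<in> D" "x = t (i, j)"
  using bij_betw_imp_surj_on[OF tableau_bij[OF assms(1)]] assms(2) by (metis imageE surj_pair)

lemma permutes_comp_tableau:
  assumes "t \<in> tableaux la" "q permutes {1..n}"
  shows "q \<circ> t \<in> tableaux la"
proof -
  have "bij_betw (q \<circ> t) D {1..n}"
    using tableau_bij[OF assms(1)] permutes_imp_bij[OF assms(2)] by (rule bij_betw_trans)
  moreover have "q 0 = 0" using permutes_not_in[OF assms(2), of 0] by simp
  ultimately show ?thesis using assms(1) by (simp add: tableaux_def)
qed

lemma tableaux_transitive:
  assumes t: "t \<in> tableaux la" and s: "s \<in> tableaux la"
  obtains q where "q permutes {1..n}" "s = q \<circ> t"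
proof -
  define q where "q x = (if x \<in> {1..n} then s (inv_into D t x) else x)" for x
  have "bij_betw (s \<circ> inv_into D t) {1..n} {1..n}"
    using bij_betw_inv_into[OF tableau_bij[OF t]] tableau_bij[OF s] by (rule bij_betw_trans)
  then have "bij_betw q {1..n} {1..n}"
    by (rule bij_betw_cong[THEN iffD1, rotated]) (simp add: q_def)
  then have q: "q permutes {1..n}"
    by (rule bij_imp_permutes) (simp only: q_def if_False)
  have "s c = q (t c)" for c
  proof (cases "c \<in> D")
    case True
    then show ?thesis
      using tableau_mem[OF t True] bij_betw_inv_into_left[OF tableau_bij[OF t] True] by (simp add: q_def)
  next
    case False
    then have "t c = 0" "s c = 0" using t s by (cases c; simp add: tableaux_def)+
    then show ?thesis by (simp add: q_def)
  qed
  then have "s = q \<circ> t" by auto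
  then show thesis using q that by blast
qed

lemma row_word_tableau:
  assumes "t \<in> tableaux la" "(i, j) \<in> D"
  shows "row_word la t (t (i, j)) = i"
  using tableau_mem[OF assms] bij_betw_inv_into_left[OF tableau_bij[OF assms(1)] assms(2)]
  by (simp add: row_word_def)

lemma row_word_outside: "x \<notin> {1..n} \<Longrightarrow> row_word la t x = 0"
  by (auto simp: row_word_def)

lemma fiber_row_word:
  assumes "t \<in> tableaux la"
  shows "fiber n (row_word la t) i = (\<lambda>j. t (i, j)) ` {..<lam i}"
proof -
  have "x \<in> (\<lambda>j. t (i, j)) ` {..<lam i}" if x: "x \<in> fiber n (row_word la t) i" for x
  proof -
    obtain i' j' where c: "(i', j') \<in> D" "x = t (i', j')"
      using x tableau_surj[OF assms] by (metis mem_fiber)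
    then have "i' = i" using x row_word_tableau[OF assms c(1)] by (simp add: mem_fiber)
    then show ?thesis using c by (auto simp: mem_young_diagram)
  qed
  moreover have "t (i, j) \<in> fiber n (row_word la t) i" if "j < lam i" for j
    using that tableau_mem[OF assms] row_word_tableau[OF assms] by (simp add: mem_young_diagram mem_fiber del: atLeastAtMost_iff)
  ultimately show ?thesis by auto
qed

lemma row_word_in_words:
  assumes "t \<in> tableaux la"
  shows "row_word la t \<in> words n lam"
proof -
  have "inj_on (\<lambda>j. t (i, j)) {..<lam i}" for i
    using tableau_inj[OF assms] by (auto simp: inj_on_def mem_young_diagram)
  then have "card (fiber n (row_word la t) i) = lam i" for i
    by (simp add: fiber_row_word[OF assms] card_image)
  then show ?thesis using row_word_outside unfolding words_def by blast
qed

lemma word_tabloidD: "t \<in> word_tabloid la w \<Longrightarrow> t \<in> tableaux la"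
  "t \<in> word_tabloid la w \<Longrightarrow> (i, j) \<in> D \<Longrightarrow> w (t (i, j)) = i"
  by (simp_all add: word_tabloid_def)

lemma row_word_unique:
  assumes "t \<in> word_tabloid la w" and "\<And>x. x \<notin> {1..n} \<Longrightarrow> w x = 0"
  shows "row_word la t = w"
proof
  fix x show "row_word la t x = w x"
  proof (cases "x \<in> {1..n}")
    case True
    then obtain i j where "(i, j) \<in> D" "x = t (i, j)"
      using tableau_surj[OF word_tabloidD(1)[OF assms(1)]] by blast
    then show ?thesis
      using word_tabloidD[OF assms(1)] row_word_tableau by simp
  next
    case False
    then show ?thesis using assms(2)[OF False] row_word_outside[OF False] by simp
  qed
qed

lemma row_reading_in_word_tabloid:
  assumes w: "w \<in> words n lam"
  shows "row_reading la w \<in> word_tabloid la w"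
proof -
  let ?L = "\<lambda>i. sorted_list_of_set (fiber n w i)"
  have val: "row_reading la w (i, j) = ?L i ! j" if "(i, j) \<in> D" for i j
    using that by (simp add: row_reading_def)
  have len: "length (?L i) = lam i" for i
    using w by (simp add: card_fiber)
  have mem: "?L i ! j \<in> fiber n w i" if "(i, j) \<in> D" for i j
    using that len[of i] nth_mem[of j "?L i"] by (simp add: mem_young_diagram)
  have "inj_on (row_reading la w) D"
  proof (rule inj_onI, clarify)
    fix i j i' j' assume c: "(i, j) \<in> D" "(i', j') \<in> D" "row_reading la w (i, j) = row_reading la w (i', j')"
    then have "i = i'"
      using mem[OF c(1)] mem[OF c(2)] by (simp add: val mem_fiber)
    moreover from this have "j = j'"
      using c len by (auto simp: val nth_eq_iff_index_eq mem_young_diagram)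
    ultimately show "i = i' \<and> j = j'" by simp
  qed
  moreover have "row_reading la w ` D = {1..n}"
  proof (intro equalityI subsetI)
    fix x assume "x \<in> row_reading la w ` D"
    then show "x \<in> {1..n}" using val mem fiber_subset by fastforce
  next
    fix x assume "x \<in> {1..n}"
    then have "x \<in> set (?L (w x))" by (simp add: mem_fiber)
    then obtain j where j: "j < lam (w x)" "?L (w x) ! j = x"
      using len by (metis in_set_conv_nth)
    then have "x = row_reading la w (w x, j)" "(w x, j) \<in> D"
      by (simp_all add: val mem_young_diagram)
    then show "x \<in> row_reading la w ` D" by blast
  qed
  ultimately have "row_reading la w \<in> tableaux la"
    by (auto simp: tableaux_def bij_betw_def row_reading_def)
  then show ?thesis
    using val mem by (simp add: word_tabloid_def mem_fiber)
qed

lemma row_word_row_reading: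
  assumes "w \<in> words n lam"
  shows "row_word la (row_reading la w) = w"
  using assms by (intro row_word_unique row_reading_in_word_tabloid) (simp_all add: words_def)

lemma words_nonempty: "words n lam \<noteq> {}"
proof -
  have fin: "finite D"
  proof (rule finite_subset)
    show "D \<subseteq> {..<length la} \<times> {..<Suc (Max (set la))}"
    proof clarify
      fix i j assume "(i, j) \<in> D"
      then have "i < length la" "j < la ! i" by (simp_all add: young_diagram_def)
      moreover from this have "la ! i \<le> Max (set la)" by simp
      ultimately have "j < Suc (Max (set la))" by linarith
      then show "i \<in> {..<length la} \<and> j \<in> {..<Suc (Max (set la))}" using \<open>i < length la\<close> by simp
    qed
  qed simp
  have "D = Sigma {..<length la} (\<lambda>i. {..<la ! i})"
    by (auto simp: young_diagram_def)
  then have "card D = (\<Sum>i<length la. la ! i)" by simp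
  also have "\<dots> = n" by (metis sum_la atLeast0LessThan sum_list_sum_nth)
  finally obtain t where t: "bij_betw t D {1..n}"
    using finite_same_card_bij[OF fin, of "{1..n}"] by auto
  have "bij_betw (\<lambda>c. if c \<in> D then t c else 0) D {1..n}"
    using t by (rule bij_betw_cong[THEN iffD1, rotated]) simp
  then have "(\<lambda>c. if c \<in> D then t c else 0) \<in> tableaux la"
    by (simp add: tableaux_def)
  then show ?thesis using row_word_in_words by blast
qed

lemma row_stabilizerD:
  "q \<in> row_stabilizer la t \<Longrightarrow> q permutes {1..n}"
  "q \<in> row_stabilizer la t \<Longrightarrow> (i, j) \<in> D \<Longrightarrow> \<exists>j'. (i, j') \<in> D \<and> q (t (i, j)) = t (i, j')"
  by (simp_all add: row_stabilizer_def)

lemma column_stabilizerD: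
  "q \<in> column_stabilizer la t \<Longrightarrow> q permutes {1..n}"
  "q \<in> column_stabilizer la t \<Longrightarrow> (i, j) \<in> D \<Longrightarrow> \<exists>i'. (i', j) \<in> D \<and> q (t (i, j)) = t (i', j)"
  by (simp_all add: column_stabilizer_def)

lemma tabloid_of_eq:
  assumes t: "t \<in> tableaux la"
  shows "tabloid_of la t = word_tabloid la (row_word la t)"
proof (intro equalityI subsetI)
  fix s assume "s \<in> tabloid_of la t"
  then obtain q where q: "q \<in> row_stabilizer la t" "s = q \<circ> t"
    by (auto simp: tabloid_of_def)
  then have "q permutes {1..n}" by (simp add: row_stabilizer_def)
  then have "s \<in> tableaux la" using q permutes_comp_tableau[OF t] by simp
  moreover have "row_word la t (s (i, j)) = i" if c: "(i, j) \<in> D" for i j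
  proof -
    obtain j' where "(i, j') \<in> D" "q (t (i, j)) = t (i, j')"
      using row_stabilizerD(2)[OF q(1) c] by blast
    then show ?thesis using row_word_tableau[OF t] q(2) by simp
  qed
  ultimately show "s \<in> word_tabloid la (row_word la t)" by (simp add: word_tabloid_def)
next
  fix s assume s: "s \<in> word_tabloid la (row_word la t)"
  then obtain q where q: "q permutes {1..n}" "s = q \<circ> t"
    using tableaux_transitive[OF t] word_tabloidD by metis
  have "\<exists>j'. (i, j') \<in> D \<and> q (t (i, j)) = t (i, j')" if c: "(i, j) \<in> D" for i j
  proof -
    have "s (i, j) \<in> {1..n}" using s c tableau_mem word_tabloidD by blast
    then obtain i' j' where c': "(i', j') \<in> D" "s (i, j) = t (i', j')"
      using tableau_surj[OF t] by blast
    then have "i' = i"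
      using word_tabloidD(2)[OF s c] row_word_tableau[OF t c'(1)] by simp
    then show ?thesis using c' q(2) by auto
  qed
  then have "q \<in> row_stabilizer la t" using q by (simp add: row_stabilizer_def)
  then show "s \<in> tabloid_of la t" using q by (auto simp: tabloid_of_def)
qed

lemma word_tabloid_inj:
  assumes "w \<in> words n lam" "w' \<in> words n lam" "word_tabloid la w = word_tabloid la w'"
  shows "w = w'"
proof -
  have "row_reading la w \<in> word_tabloid la w'"
    using row_reading_in_word_tabloid[OF assms(1)] assms(3) by simp
  then have "row_word la (row_reading la w) = w'"
    using assms(2) by (intro row_word_unique) (auto simp: words_def)
  then show ?thesis using row_word_row_reading[OF assms(1)] by simp
qed

lemma tabloids_eq: "tabloids la = word_tabloid la ` words n lam"
proof (intro equalityI subsetI)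
  fix T assume "T \<in> tabloids la"
  then show "T \<in> word_tabloid la ` words n lam"
    using tabloid_of_eq row_word_in_words by (auto simp: tabloids_def)
next
  fix T assume "T \<in> word_tabloid la ` words n lam"
  then obtain w where w: "w \<in> words n lam" "T = word_tabloid la w" by blast
  have "row_reading la w \<in> tableaux la"
    using row_reading_in_word_tabloid[OF w(1)] word_tabloidD by blast
  then have "T = tabloid_of la (row_reading la w)"
    using tabloid_of_eq row_word_row_reading[OF w(1)] w(2) by simp
  then show "T \<in> tabloids la"
    using \<open>row_reading la w \<in> tableaux la\<close> by (simp add: tabloids_def)
qed

lemma tabloid_action_word_tabloid:
  assumes q: "q permutes {1..n}"
  shows "tabloid_action q (word_tabloid la w) = word_tabloid la (w \<circ> inv' q)"
proof (intro equalityI subsetI)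
  fix s assume "s \<in> tabloid_action q (word_tabloid la w)"
  then show "s \<in> word_tabloid la (w \<circ> inv' q)"
    using permutes_comp_tableau[OF _ q] q
    by (auto simp: tabloid_action_def word_tabloid_def permutes_inverses)
next
  fix s assume s: "s \<in> word_tabloid la (w \<circ> inv' q)"
  have "inv' q \<circ> s \<in> word_tabloid la w"
    using s permutes_comp_tableau[OF _ permutes_inv[OF q]] by (auto simp: word_tabloid_def)
  moreover have "s = q \<circ> (inv' q \<circ> s)"
    using q by (auto simp: permutes_inverses)
  ultimately show "s \<in> tabloid_action q (word_tabloid la w)"
    unfolding tabloid_action_def by blast
qed

lemma perm_action_coeff:
  assumes "q permutes {1..n}"
  shows "word_coeff la (perm_action q v) w = word_coeff la v (w \<circ> q)"
  using tabloid_action_word_tabloid[OF permutes_inv[OF assms], of w] assms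
  by (simp add: word_coeff_def perm_action_def permutes_inv_inv)

lemma perm_module_eqI:
  assumes "v \<in> carrier (perm_module la)" "v' \<in> carrier (perm_module la)"
    and "\<And>w. w \<in> words n lam \<Longrightarrow> word_coeff la v w = word_coeff la v' w"
  shows "v = v'"
proof
  fix T show "v T = v' T"
    using assms by (cases "T \<in> tabloids la") (auto simp: perm_module_simps tabloids_eq word_coeff_def)
qed

section \<open>Polytabloids\<close>

lemma polytabloid_coeff:
  assumes t: "t \<in> tableaux la" and w: "w \<in> words n lam"
  shows "word_coeff la (polytabloid la t) w =
    (\<Sum>q\<in>column_stabilizer la t. if w \<circ> q = row_word la t then of_int (sign q) else 0)"
proof -
  have "word_tabloid la w = tabloid_action q (tabloid_of la t) \<longleftrightarrow> w \<circ> q = row_word la t"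
    if "q \<in> column_stabilizer la t" for q
  proof -
    have q: "q permutes {1..n}" using that by (simp add: column_stabilizer_def)
    have "row_word la t \<circ> inv' q \<in> words n lam"
      using row_word_in_words[OF t] permutes_inv[OF q] by (rule comp_in_words)
    then have "word_tabloid la w = tabloid_action q (tabloid_of la t) \<longleftrightarrow> w = row_word la t \<circ> inv' q"
      using word_tabloid_inj[OF w] by (auto simp: tabloid_of_eq[OF t] tabloid_action_word_tabloid[OF q])
    also have "\<dots> \<longleftrightarrow> w \<circ> q = row_word la t"
      using q by (auto simp: fun_eq_iff permutes_inverses) (metis permutes_inverses(1))
    finally show ?thesis .
  qed
  then show ?thesis
    unfolding word_coeff_def polytabloid_def by (intro sum.cong) auto
qed

lemma polytabloid_in_perm_module:
  assumes t: "t \<in> tableaux la"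
  shows "polytabloid la t \<in> carrier (perm_module la)"
proof -
  have "tabloid_action q (tabloid_of la t) \<in> tabloids la" if "q \<in> column_stabilizer la t" for q
  proof -
    have q: "q permutes {1..n}" using that by (simp add: column_stabilizer_def)
    have "row_word la t \<circ> inv' q \<in> words n lam"
      using row_word_in_words[OF t] permutes_inv[OF q] by (rule comp_in_words)
    then show ?thesis
      by (simp add: tabloid_of_eq[OF t] tabloid_action_word_tabloid[OF q] tabloids_eq)
  qed
  then have "polytabloid la t T = 0" if "T \<notin> tabloids la" for T
    unfolding polytabloid_def using that by (intro sum.neutral) auto
  then show ?thesis unfolding perm_module_simps by blast
qed

lemma finite_column_stabilizer: "finite (column_stabilizer la t)"
  by (rule finite_subset[OF _ finite_permutations[of "{1..n}"]]) (auto simp: column_stabilizer_def)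

text \<open>
  Composing on the right with the transposition of two entries of one column is a sign-reversing
  involution of the summands, so the sum equals its own negative.
\<close>

lemma column_sum_eq_0:
  fixes g :: "nat \<Rightarrow> nat"
  assumes t: "t \<in> tableaux la" and two: "(2 :: 'k :: field) \<noteq> 0"
    and c: "(i, j) \<in> D" "(i', j) \<in> D" "i \<noteq> i'" and g: "g (t (i, j)) = g (t (i', j))"
  shows "(\<Sum>q\<in>column_stabilizer la t. if w \<circ> q = g then (of_int (sign q) :: 'k) else 0) = 0"
proof -
  let ?x = "t (i, j)" and ?y = "t (i', j)"
  let ?tau = "transpose ?x ?y"
  let ?S = "\<Sum>q\<in>column_stabilizer la t. if w \<circ> q = g then (of_int (sign q) :: 'k) else 0"
  have xy: "?x \<noteq> ?y" using tableau_inj[OF t c(1,2)] c(3) by simp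
  have tau: "?tau permutes {1..n}"
    using tableau_mem[OF t c(1)] tableau_mem[OF t c(2)] by (rule permutes_swap_id)
  have g_tau: "g \<circ> ?tau = g"
    using g by (auto simp: transpose_def)
  have invol: "q \<circ> ?tau \<circ> ?tau = q" for q :: "nat \<Rightarrow> nat"
    by (simp add: comp_assoc)
  have closed: "q \<circ> ?tau \<in> column_stabilizer la t" if q: "q \<in> column_stabilizer la t" for q
  proof -
    have col: "\<exists>k'. (k', l) \<in> D \<and> q (t (k, l)) = t (k', l)" if "(k, l) \<in> D" for k l
      using column_stabilizerD(2)[OF q that] .
    have "\<exists>k'. (k', l) \<in> D \<and> (q \<circ> ?tau) (t (k, l)) = t (k', l)" if kl: "(k, l) \<in> D" for k l
    proof -
      consider "(k, l) = (i, j)" | "(k, l) = (i', j)" | "t (k, l) \<noteq> ?x" "t (k, l) \<noteq> ?y"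
        using tableau_inj[OF t kl] c by blast
      then show ?thesis
        using col[OF kl] col[OF c(1)] col[OF c(2)] by cases (auto simp: transpose_def)
    qed
    moreover have "q \<circ> ?tau permutes {1..n}"
      using tau column_stabilizerD(1)[OF q] by (rule permutes_compose)
    ultimately show ?thesis by (simp add: column_stabilizer_def)
  qed
  have sgn: "sign (q \<circ> ?tau) = - sign q" if "q \<in> column_stabilizer la t" for q
  proof -
    have "permutation q"
      using column_stabilizerD(1)[OF that] by (auto simp: permutation_permutes)
    then show ?thesis
      using xy by (simp add: sign_compose permutation_swap_id sign_swap_id)
  qed
  have "?S = (\<Sum>q\<in>column_stabilizer la t. if w \<circ> (q \<circ> ?tau) = g then of_int (sign (q \<circ> ?tau)) else 0)"
    by (rule sum.reindex_bij_witness[of _ "\<lambda>q. q \<circ> ?tau" "\<lambda>q. q \<circ> ?tau"]) (use closed invol in auto)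
  also have "\<dots> = (\<Sum>q\<in>column_stabilizer la t. - (if w \<circ> q = g then of_int (sign q) else 0))"
  proof (rule sum.cong)
    fix q assume q: "q \<in> column_stabilizer la t"
    have "w \<circ> (q \<circ> ?tau) = g \<longleftrightarrow> w \<circ> q = g"
      using g_tau invol[of "w \<circ> q"] by (metis comp_assoc)
    then show "(if w \<circ> (q \<circ> ?tau) = g then (of_int (sign (q \<circ> ?tau)) :: 'k) else 0) = - (if w \<circ> q = g then of_int (sign q) else 0)"
      using sgn[OF q] by simp
  qed simp
  finally have "?S = - ?S" unfolding sum_negf .
  moreover have "s = 0" if "s = - s" for s :: 'k
  proof -
    have "s + s = 0" using that by (metis add.right_inverse)
    then have "2 * s = 0" by (simp only: mult_2)
    then show ?thesis using two by simp
  qed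
  ultimately show ?thesis by blast
qed

text \<open>
  Raising \<open>a\<close> entries of a column-permuted tableau amounts to first raising a set \<open>B\<close> of \<open>a\<close> entries of
  row $i+1$ and then permuting the columns.  For fixed \<open>B\<close>, an entry of \<open>B\<close> and the entry above it are
  then in the same row, so the signed sum over the column stabilizer vanishes.
\<close>

lemma polytabloid_annihilated:
  assumes t: "t \<in> tableaux la" and two: "(2 :: 'k :: field) \<noteq> 0"
  shows "annihilated n lam (word_coeff la (polytabloid la t :: tabloid \<Rightarrow> 'k))"
  unfolding annihilated_def
proof (intro allI impI)
  fix i a w assume a: "0 < a" "a \<le> lam (Suc i)" and w: "w \<in> words n (move (Suc i) i a lam)"
  define r where "r = row_word la t"
  let ?C = "column_stabilizer la t"
  let ?Up = "subsets_of_card (fiber n w i) a" and ?Low = "subsets_of_card (fiber n r (Suc i)) a"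
  have count: "(\<Sum>A\<in>?Up. if relabel w A (Suc i) \<circ> q = r then x else 0) =
      (\<Sum>B\<in>?Low. if w \<circ> q = relabel r B i then x else 0)" if q: "q \<in> ?C" for q and x :: 'k
  proof -
    have qp: "q permutes {1..n}" using q by (rule column_stabilizerD)
    have inj: "inj q" "inj (inv' q)" using qp permutes_inj permutes_inv by blast+
    have inv: "q (inv' q z) = z" "inv' q (q z) = z" for z using qp by (simp_all add: permutes_inverses)
    have mem: "q z \<in> {1..n} \<longleftrightarrow> z \<in> {1..n}" "inv' q z \<in> {1..n} \<longleftrightarrow> z \<in> {1..n}" for z
      using permutes_in_image[OF qp] permutes_in_image[OF permutes_inv[OF qp]] by blast+
    have eq: "relabel w A (Suc i) \<circ> q = r \<longleftrightarrow> w \<circ> q = relabel r (inv' q ` A) i"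
      if "\<And>z. z \<in> A \<Longrightarrow> w z = i" "\<And>z. z \<in> A \<Longrightarrow> r (inv' q z) = Suc i" for A
    proof -
      have im: "z \<in> inv' q ` A \<longleftrightarrow> q z \<in> A" for z
        using inv by (metis image_iff)
      have "relabel w A (Suc i) (q z) = r z \<longleftrightarrow> w (q z) = relabel r (inv' q ` A) i z" for z
        using that[of "q z"] im inv by (auto simp: relabel_def)
      then show ?thesis by (simp add: fun_eq_iff)
    qed
    have rA: "r (inv' q z) = Suc i" if "relabel w A (Suc i) \<circ> q = r" "z \<in> A" for A z
      using fun_cong[OF that(1), of "inv' q z"] that(2) inv by (simp add: relabel_def)
    have wB: "w (q z) = i" if "w \<circ> q = relabel r B i" "z \<in> B" for B z
      using fun_cong[OF that(1), of z] that(2) by (simp add: relabel_def)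
    let ?U = "{A \<in> ?Up. relabel w A (Suc i) \<circ> q = r}" and ?L = "{B \<in> ?Low. w \<circ> q = relabel r B i}"
    have "bij_betw (\<lambda>A. inv' q ` A) ?U ?L"
    proof (rule bij_betw_byWitness[where f' = "\<lambda>B. q ` B"])
      show "(\<lambda>A. inv' q ` A) ` ?U \<subseteq> ?L"
      proof (rule image_subsetI)
        fix A assume "A \<in> ?U"
        then have A: "A \<in> ?Up" "relabel w A (Suc i) \<circ> q = r" by simp_all
        have "w z = i" if "z \<in> A" for z using subsets_of_cardD(1)[OF A(1)] that by (auto simp: mem_fiber)
        then have "w \<circ> q = relabel r (inv' q ` A) i" using eq rA[OF A(2)] A(2) by blast
        moreover have "inv' q ` A \<in> ?Low"
        proof -
          have "inv' q z \<in> fiber n r (Suc i)" if "z \<in> A" for z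
          proof -
            have "z \<in> {1..n}" using subsets_of_cardD(1)[OF A(1)] that fiber_subset by blast
            then show ?thesis using rA[OF A(2) that] mem(2) unfolding mem_fiber by simp
          qed
          moreover have "card (inv' q ` A) = a"
            using subsets_of_cardD(2)[OF A(1)] card_image[OF inj_on_subset[OF inj(2)]] by simp
          ultimately show ?thesis unfolding subsets_of_card_def by blast
        qed
        ultimately show "inv' q ` A \<in> ?L" by simp
      qed
      show "(\<lambda>B. q ` B) ` ?L \<subseteq> ?U"
      proof (rule image_subsetI)
        fix B assume "B \<in> ?L"
        then have B: "B \<in> ?Low" "w \<circ> q = relabel r B i" by simp_all
        have qB: "inv' q ` q ` B = B" using inv by (simp add: image_image)
        have "r z = Suc i" if "z \<in> B" for z using subsets_of_cardD(1)[OF B(1)] that by (auto simp: mem_fiber)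
        then have "r (inv' q z) = Suc i" if "z \<in> q ` B" for z
          using that inv by auto
        moreover have "w z = i" if "z \<in> q ` B" for z
          using that wB[OF B(2)] by auto
        ultimately have "relabel w (q ` B) (Suc i) \<circ> q = r \<longleftrightarrow> w \<circ> q = relabel r (inv' q ` q ` B) i"
          by (intro eq)
        then have "relabel w (q ` B) (Suc i) \<circ> q = r"
          using B(2) qB by simp
        moreover have "q ` B \<in> ?Up"
        proof -
          have "q z \<in> fiber n w i" if "z \<in> B" for z
          proof -
            have "z \<in> {1..n}" using subsets_of_cardD(1)[OF B(1)] that fiber_subset by blast
            then show ?thesis using wB[OF B(2) that] mem(1) unfolding mem_fiber by simp
          qed
          moreover have "card (q ` B) = a"
            using subsets_of_cardD(2)[OF B(1)] card_image[OF inj_on_subset[OF inj(1)]] by simp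
          ultimately show ?thesis unfolding subsets_of_card_def by blast
        qed
        ultimately show "q ` B \<in> ?U" by simp
      qed
    qed (use inv in \<open>auto simp: image_image\<close>)
    then have "card ?U = card ?L" by (rule bij_betw_same_card)
    then show ?thesis by (simp add: sum.If_cases Int_def)
  qed
  have "raise n i a (word_coeff la (polytabloid la t :: tabloid \<Rightarrow> 'k)) w =
      (\<Sum>A\<in>?Up. \<Sum>q\<in>?C. if relabel w A (Suc i) \<circ> q = r then of_int (sign q) else 0)"
    unfolding raise_def
  proof (rule sum.cong)
    fix A assume A: "A \<in> ?Up"
    have "move i (Suc i) a (move (Suc i) i a lam) = lam"
      using a by (auto simp: move_def)
    then have "relabel w A (Suc i) \<in> words n lam"
      using relabel_in_words[OF w A, of "Suc i"] by simp
    then show "word_coeff la (polytabloid la t :: tabloid \<Rightarrow> 'k) (relabel w A (Suc i)) =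
        (\<Sum>q\<in>?C. if relabel w A (Suc i) \<circ> q = r then of_int (sign q) else 0)"
      unfolding r_def by (rule polytabloid_coeff[OF t])
  qed simp
  also have "\<dots> = (\<Sum>q\<in>?C. \<Sum>A\<in>?Up. if relabel w A (Suc i) \<circ> q = r then of_int (sign q) else 0)"
    by (rule sum.swap)
  also have "\<dots> = (\<Sum>q\<in>?C. \<Sum>B\<in>?Low. if w \<circ> q = relabel r B i then of_int (sign q) else 0)"
    by (intro sum.cong refl count)
  also have "\<dots> = (\<Sum>B\<in>?Low. \<Sum>q\<in>?C. if w \<circ> q = relabel r B i then of_int (sign q) else 0)"
    by (rule sum.swap)
  also have "\<dots> = 0"
  proof (rule sum.neutral, rule ballI)
    fix B assume B: "B \<in> ?Low"
    have "B \<noteq> {}" using subsets_of_cardD(2)[OF B] a by auto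
    then obtain x where x: "x \<in> B" by blast
    then have "x \<in> (\<lambda>j. t (Suc i, j)) ` {..<lam (Suc i)}"
      using subsets_of_cardD(1)[OF B] unfolding r_def fiber_row_word[OF t] by blast
    then obtain j where j: "j < lam (Suc i)" "x = t (Suc i, j)" by auto
    then have D: "(Suc i, j) \<in> D" "(i, j) \<in> D"
      using lam_Suc_le[of i] by (simp_all add: mem_young_diagram)
    have "relabel r B i (t (Suc i, j)) = relabel r B i (t (i, j))"
      using x j row_word_tableau[OF t D(2)] by (simp add: relabel_def r_def)
    then show "(\<Sum>q\<in>?C. if w \<circ> q = relabel r B i then of_int (sign q) else 0 :: 'k) = 0"
      by (intro column_sum_eq_0[OF t two D]) simp_all
  qed
  finally show "raise n i a (word_coeff la (polytabloid la t :: tabloid \<Rightarrow> 'k)) w = 0" .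
qed

lemma column_strictly_increasing:
  assumes incr: "\<And>i j. (Suc i, j) \<in> D \<Longrightarrow> t (i, j) < t (Suc i, j)"
    and c: "(i', j) \<in> D" and "i < i'"
  shows "t (i, j) < (t (i', j) :: nat)"
  using \<open>i < i'\<close> c
proof (induction i')
  case (Suc i')
  have "(i', j) \<in> D"
    using Suc.prems lam_Suc_le[of i'] by (simp add: mem_young_diagram)
  then show ?case
    using Suc incr[of i' j] by (cases "i = i'") auto
qed simp

text \<open>
  A nontrivial column permutation of a tableau with increasing columns puts an earlier row at the
  largest place that it moves, and so makes the word smaller.
\<close>

lemma leading_coeff_polytabloid:
  assumes t: "t \<in> tableaux la" and incr: "\<And>i j. (Suc i, j) \<in> D \<Longrightarrow> t (i, j) < t (Suc i, j)"
  shows "word_coeff la (polytabloid la t) (row_word la t) = (1 :: 'k :: field)"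
    and "\<And>w. w \<in> words n lam \<Longrightarrow> word_coeff la (polytabloid la t) w \<noteq> (0 :: 'k) \<Longrightarrow>
      w = row_word la t \<or> word_value (length la) n w < word_value (length la) n (row_word la t)"
proof -
  let ?C = "column_stabilizer la t" and ?r = "row_word la t"
  have col: "\<exists>i'. (i', j) \<in> D \<and> q (t (i, j)) = t (i', j)" if "q \<in> ?C" "(i, j) \<in> D" for q i j
    using column_stabilizerD(2)[OF that] .
  have "q = id" if q: "q \<in> ?C" "?r \<circ> q = ?r" for q
  proof
    fix x show "q x = id x"
    proof (cases "x \<in> {1..n}")
      case True
      then obtain i j where c: "(i, j) \<in> D" "x = t (i, j)"
        using tableau_surj[OF t] by blast
      obtain i' where c': "(i', j) \<in> D" "q x = t (i', j)"
        using col[OF q(1) c(1)] c(2) by blast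
      have "?r (q x) = ?r x" using q(2) by (metis comp_apply)
      then have "i' = i" using row_word_tableau[OF t] c c' by simp
      then show ?thesis using c c' by simp
    next
      case False
      then show ?thesis using permutes_not_in[OF column_stabilizerD(1)[OF q(1)]] by simp
    qed
  qed
  then have iff: "?r \<circ> q = ?r \<longleftrightarrow> q = id" if "q \<in> ?C" for q
    using that by auto
  have "id \<in> ?C" by (auto simp: column_stabilizer_def permutes_id)
  have "(\<Sum>q\<in>?C. if ?r \<circ> q = ?r then (of_int (sign q) :: 'k) else 0) = (\<Sum>q\<in>?C. if q = id then 1 else 0)"
    by (intro sum.cong) (auto simp: iff)
  also have "\<dots> = 1"
    using \<open>id \<in> ?C\<close> finite_column_stabilizer[of t] by simp
  finally have "(\<Sum>q\<in>?C. if ?r \<circ> q = ?r then (of_int (sign q) :: 'k) else 0) = 1" .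
  then show "word_coeff la (polytabloid la t) ?r = (1 :: 'k)"
    by (simp only: polytabloid_coeff[OF t row_word_in_words[OF t]])
  fix w assume w: "w \<in> words n lam" and nz: "word_coeff la (polytabloid la t) w \<noteq> (0 :: 'k)"
  have "\<exists>q\<in>?C. w \<circ> q = ?r"
  proof (rule ccontr)
    assume "\<not> ?thesis"
    then have "word_coeff la (polytabloid la t) w = (0 :: 'k)"
      unfolding polytabloid_coeff[OF t w] by (intro sum.neutral) auto
    then show False using nz by simp
  qed
  then obtain q where q: "q \<in> ?C" "w \<circ> q = ?r" by blast
  have qp: "q permutes {1..n}" using q by (simp add: column_stabilizer_def)
  have inv: "q (inv' q z) = z" "inv' q (q z) = z" for z using qp by (simp_all add: permutes_inverses)
  have wq: "w x = ?r (inv' q x)" for x using q(2) inv by (metis comp_apply)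
  show "w = ?r \<or> word_value (length la) n w < word_value (length la) n ?r"
  proof (cases "inv' q = id")
    case True
    then show ?thesis using wq by auto
  next
    case False
    let ?M = "{x \<in> {1..n}. inv' q x \<noteq> x}"
    have "?M \<noteq> {}"
    proof
      assume M: "?M = {}"
      have "inv' q x = x" for x
        using M permutes_not_in[OF permutes_inv[OF qp], of x] by (cases "x \<in> {1..n}") auto
      then show False using False by auto
    qed
    then have Max: "Max ?M \<in> ?M" by (intro Max_in) auto
    define x where "x = Max ?M"
    have x: "x \<in> {1..n}" "inv' q x \<noteq> x" using Max unfolding x_def by auto
    have fixed: "inv' q y = y" if "x < y" for y
    proof (rule ccontr)
      assume ne: "inv' q y \<noteq> y"
      then have "y \<in> {1..n}" using permutes_not_in[OF permutes_inv[OF qp]] by blast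
      then have "y \<le> x" unfolding x_def using ne by (intro Max_ge) auto
      then show False using that by simp
    qed
    have lt: "inv' q x < x"
    proof (rule ccontr)
      assume "\<not> inv' q x < x"
      then have "inv' q (inv' q x) = inv' q x" using x(2) by (intro fixed) simp
      then show False using x(2) inv by metis
    qed
    have "inv' q x \<in> {1..n}" using permutes_in_image[OF permutes_inv[OF qp]] x(1) by blast
    then obtain i' j' where c': "(i', j') \<in> D" "inv' q x = t (i', j')"
      using tableau_surj[OF t] by blast
    obtain i where c: "(i, j') \<in> D" "x = t (i, j')"
      using col[OF q(1) c'(1)] c'(2) inv by metis
    have "i' < i"
    proof (rule ccontr)
      assume "\<not> i' < i"
      then have "i = i' \<or> i < i'" by auto
      then have "x \<le> inv' q x"
        using column_strictly_increasing[of t i' j' i, OF incr c'(1)] c c' by auto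
      then show False using lt by simp
    qed
    then have "w x < ?r x"
      using wq[of x] row_word_tableau[OF t] c c' by simp
    moreover have "w y = ?r y" if "x < y" for y
      using wq[of y] fixed[OF that] by simp
    moreover have "w y < length la" if "y \<in> {1..n}" for y
      using words_bound[OF w lam_eq_0 that] .
    ultimately show ?thesis
      using word_value_less[of n w "length la" x ?r] x by blast
  qed
qed

section \<open>The kernel intersection theorem\<close>

definition raising_kernel :: "(tabloid \<Rightarrow> 'k :: field) set" where
  "raising_kernel = {v \<in> carrier (perm_module la). annihilated n lam (word_coeff la v)}"

lemma raise_linear: "raise n i a (\<lambda>w. x * f w + y * g w) w = (x :: 'k :: field) * raise n i a f w + y * raise n i a g w"
  by (simp add: raise_def sum.distrib sum_distrib_left)

lemma raising_kernel_linear: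
  assumes "v \<in> raising_kernel" "v' \<in> raising_kernel"
  shows "(\<lambda>T. x * v T + y * v' T) \<in> (raising_kernel :: (tabloid \<Rightarrow> 'k :: field) set)"
proof -
  have "word_coeff la (\<lambda>T. x * v T + y * v' T) = (\<lambda>w. x * word_coeff la v w + y * word_coeff la v' w)"
    by (simp add: word_coeff_def fun_eq_iff)
  then show ?thesis
    using assms by (simp add: raising_kernel_def annihilated_def raise_linear perm_module_simps)
qed

lemma raising_kernel_submodule:
  "LinearCombinations.submodule class_ring raising_kernel (perm_module la :: ('k :: field, _) module)"
proof (rule LinearCombinations.submodule.intro[OF perm_module_module])
  show "(raising_kernel :: (tabloid \<Rightarrow> 'k) set) \<subseteq> carrier (perm_module la)"
    by (auto simp: raising_kernel_def)
  fix v v' :: "tabloid \<Rightarrow> 'k" assume v: "v \<in> raising_kernel" "v' \<in> raising_kernel"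
  show "v \<oplus>\<^bsub>perm_module la\<^esub> v' \<in> raising_kernel"
    using raising_kernel_linear[OF v, of 1 1] by (simp add: perm_module_simps)
next
  show "\<zero>\<^bsub>perm_module la\<^esub> \<in> (raising_kernel :: (tabloid \<Rightarrow> 'k) set)"
    by (simp add: raising_kernel_def annihilated_def raise_def word_coeff_def perm_module_simps)
  fix c :: 'k and v :: "tabloid \<Rightarrow> 'k" assume v: "v \<in> raising_kernel"
  show "c \<odot>\<^bsub>perm_module la\<^esub> v \<in> raising_kernel"
    using raising_kernel_linear[OF v v, of c 0] by (simp add: perm_module_simps)
qed

text \<open>
  Every polytabloid is annihilated by the raising operators.  Conversely, the leading word of a
  vector in the kernel belongs to a standard tableau \<open>t\<close>, whose polytabloid has the same leading
  word with coefficient \<open>1\<close>; subtracting a multiple of it lowers the leading word.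
\<close>

theorem carrier_specht_module:
  assumes two: "(2 :: 'k :: field) \<noteq> 0"
  shows "carrier (specht_module la :: ('k, _) module) = raising_kernel"
proof -
  interpret V: vectorspace class_ring "perm_module la :: ('k, _) module"
    by (rule perm_module_vectorspace)
  let ?P = "polytabloid la ` tableaux la :: (tabloid \<Rightarrow> 'k) set"
  have P: "?P \<subseteq> carrier (perm_module la)"
    using polytabloid_in_perm_module by blast
  have sub: "LinearCombinations.submodule class_ring (V.module.span ?P) (perm_module la :: ('k, _) module)"
    using V.span_is_submodule[OF P] .
  have span_closed: "(\<lambda>T. v T + c * e T) \<in> V.module.span ?P" if "v \<in> V.module.span ?P" "e \<in> ?P" for v e and c :: 'k
  proof -
    have "e \<in> V.module.span ?P" using V.span_mem[OF P] that(2) by blast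
    then have "c \<odot>\<^bsub>perm_module la\<^esub> e \<in> V.module.span ?P"
      using LinearCombinations.submodule.smult_closed[OF sub] by (simp add: class_ring_simps)
    then have "v \<oplus>\<^bsub>perm_module la\<^esub> (c \<odot>\<^bsub>perm_module la\<^esub> e) \<in> V.module.span ?P"
      using LinearCombinations.submodule.m_closed[OF sub that(1)] by blast
    then show ?thesis by (simp add: perm_module_simps)
  qed
  have poly_kernel: "polytabloid la t \<in> (raising_kernel :: (tabloid \<Rightarrow> 'k) set)" if "t \<in> tableaux la" for t
    using polytabloid_annihilated[OF that two] polytabloid_in_perm_module[OF that] by (simp add: raising_kernel_def)
  have "V.module.span ?P \<subseteq> raising_kernel"
    using V.span_is_subset[OF _ raising_kernel_submodule, of ?P] poly_kernel by blast
  moreover have in_span: "v \<in> V.module.span ?P"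
    if "v \<in> raising_kernel" "\<And>w. w \<in> words n lam \<Longrightarrow> word_coeff la v w \<noteq> 0 \<Longrightarrow> word_value (length la) n w < m"
    for v m
    using that
  proof (induction m arbitrary: v)
    case 0
    have "v = \<zero>\<^bsub>perm_module la\<^esub>"
      using 0 V.M.zero_closed
      by (intro perm_module_eqI) (auto simp: raising_kernel_def word_coeff_def perm_module_simps)
    then show ?case
      using LinearCombinations.submodule.zero_closed[OF sub] by simp
  next
    case (Suc m)
    show ?case
    proof (cases "\<exists>w\<in>words n lam. word_coeff la v w \<noteq> 0 \<and> word_value (length la) n w = m")
      case False
      have "word_value (length la) n w < m" if "w \<in> words n lam" "word_coeff la v w \<noteq> 0" for w
        using Suc.prems(2)[OF that] False that by (metis less_SucE)
      then show ?thesis using Suc.IH Suc.prems(1) by blast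
    next
      case True
      then obtain w where w: "w \<in> words n lam" "word_coeff la v w \<noteq> 0" "word_value (length la) n w = m"
        by blast
      define t where "t = row_reading la w"
      have t: "t \<in> tableaux la"
        unfolding t_def using row_reading_in_word_tabloid[OF w(1)] by (rule word_tabloidD)
      have rt: "row_word la t = w"
        unfolding t_def by (rule row_word_row_reading[OF w(1)])
      have ann: "annihilated n lam (word_coeff la v)"
        using Suc.prems(1) by (simp add: raising_kernel_def)
      have incr: "t (i, j) < t (Suc i, j)" if D: "(Suc i, j) \<in> D" for i j
      proof -
        have D': "(i, j) \<in> D" using D lam_Suc_le[of i] by (simp add: mem_young_diagram)
        have "word_coeff la v w' = 0" if "w' \<in> words n lam" "word_value (length la) n w < word_value (length la) n w'" for w'
          using Suc.prems(2)[OF that(1)] that(2) w(3) by linarith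
        then have "sorted_list_of_set (fiber n w i) ! j < sorted_list_of_set (fiber n w (Suc i)) ! j"
          using D by (intro leading_word_standard[OF ann w(1) lam_eq_0 w(2)]) (auto simp: mem_young_diagram lam_Suc_le)
        then show ?thesis using D D' by (simp add: t_def row_reading_def)
      qed
      define e where "e = (polytabloid la t :: tabloid \<Rightarrow> 'k)"
      define c where "c = word_coeff la v w"
      define v' where "v' = (\<lambda>T. v T + (- c) * e T)"
      have v': "v' \<in> raising_kernel"
        using raising_kernel_linear[OF Suc.prems(1) poly_kernel[OF t], of 1 "- c"] by (simp add: v'_def e_def)
      have coeff: "word_coeff la v' u = word_coeff la v u - c * word_coeff la e u" for u
        by (simp add: v'_def word_coeff_def)
      have "word_value (length la) n u < m" if u: "u \<in> words n lam" "word_coeff la v' u \<noteq> 0" for u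
      proof -
        have "u \<noteq> w"
        proof
          assume "u = w"
          moreover have "word_coeff la (polytabloid la t :: tabloid \<Rightarrow> 'k) (row_word la t) = 1"
            by (rule leading_coeff_polytabloid(1)[OF t incr])
          ultimately have "word_coeff la v' u = 0"
            unfolding coeff by (simp add: rt c_def e_def)
          then show False using u by simp
        qed
        show ?thesis
        proof (cases "word_coeff la e u = 0")
          case True
          then have "word_coeff la v u \<noteq> 0" using u coeff[of u] by simp
          then have "word_value (length la) n u < Suc m" using Suc.prems(2)[OF u(1)] by blast
          moreover have "word_value (length la) n u \<noteq> m"
          proof
            assume "word_value (length la) n u = m"
            then have "word_value (length la) n u = word_value (length la) n w" using w(3) by simp
            then have "u = w" using word_value_inj[OF u(1) w(1) lam_eq_0] by simp
            then show False using \<open>u \<noteq> w\<close> by simp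
          qed
          ultimately show ?thesis by simp
        next
          case False
          then have "u = row_word la t \<or> word_value (length la) n u < word_value (length la) n (row_word la t)"
            using leading_coeff_polytabloid(2)[of t u] t incr u(1) unfolding e_def by blast
          then show ?thesis using \<open>u \<noteq> w\<close> w(3) by (simp add: rt)
        qed
      qed
      then have "v' \<in> V.module.span ?P" using Suc.IH[OF v'] by blast
      then have "(\<lambda>T. v' T + c * e T) \<in> V.module.span ?P"
        using t by (intro span_closed) (auto simp: e_def)
      moreover have "(\<lambda>T. v' T + c * e T) = v" by (auto simp: v'_def)
      ultimately show ?thesis by simp
    qed
  qed
  have "raising_kernel \<subseteq> V.module.span ?P"
  proof
    fix v :: "tabloid \<Rightarrow> 'k" assume v: "v \<in> raising_kernel"
    have "word_value (length la) n w < Suc (\<Sum>x\<in>{1..n}. length la * length la ^ x)" if "w \<in> words n lam" for w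
    proof -
      have "word_value (length la) n w \<le> (\<Sum>x\<in>{1..n}. length la * length la ^ x)"
        unfolding word_value_def
      proof (intro sum_mono mult_le_mono1)
        fix x assume "x \<in> {1..n}"
        then show "w x \<le> length la" using words_bound[OF that lam_eq_0] by (simp add: less_imp_le)
      qed
      then show ?thesis by simp
    qed
    then show "v \<in> V.module.span ?P"
      by (intro in_span[OF v])
  qed
  ultimately show ?thesis
    by (auto simp: specht_module_def)
qed

end

section \<open>Quotients of dimension at most one\<close>

text \<open>
  If any two vectors are linearly dependent modulo \<open>W\<close>, then the coset of any vector outside \<open>W\<close>
  generates the quotient.
\<close>

lemma quotient_dim_le_1:
  fixes V :: "('k :: field, 'v) module"
  assumes V: "Module.module class_ring V" and W: "LinearCombinations.submodule class_ring W V"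
    and dep: "\<And>x y. x \<in> carrier V \<Longrightarrow> y \<in> carrier V \<Longrightarrow>
      \<exists>a b. (a \<noteq> 0 \<or> b \<noteq> 0) \<and> (a \<odot>\<^bsub>V\<^esub> x) \<oplus>\<^bsub>V\<^esub> (b \<odot>\<^bsub>V\<^esub> y) \<in> W"
  shows "vectorspace.fin_dim class_ring (quotient_module V W)"
    and "vectorspace.dim class_ring (quotient_module V W) \<le> 1"
proof -
  interpret V: Module.module class_ring V by (rule V)
  interpret W: LinearCombinations.submodule class_ring W V by (rule W)
  have K [simp]: "c \<in> carrier class_ring" for c :: 'k by (simp add: class_ring_simps)
  have one: "1 \<odot>\<^bsub>V\<^esub> x = x" and null: "0 \<odot>\<^bsub>V\<^esub> x = \<zero>\<^bsub>V\<^esub>"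
    and assoc: "(a * b) \<odot>\<^bsub>V\<^esub> x = a \<odot>\<^bsub>V\<^esub> (b \<odot>\<^bsub>V\<^esub> x)"
    and distr: "(a + b) \<odot>\<^bsub>V\<^esub> x = a \<odot>\<^bsub>V\<^esub> x \<oplus>\<^bsub>V\<^esub> b \<odot>\<^bsub>V\<^esub> x"
    and minus: "(- a) \<odot>\<^bsub>V\<^esub> x = \<ominus>\<^bsub>V\<^esub> (a \<odot>\<^bsub>V\<^esub> x)" if "x \<in> carrier V" for a b x
    using that V.smult_one[of x] V.smult_l_null[of x] V.smult_assoc1[of a b x] V.smult_l_distr[of a b x] V.smult_l_minus[of a x]
    by (simp_all add: class_ring_simps)
  have neg: "\<ominus>\<^bsub>V\<^esub> w \<in> W" if "w \<in> W" for w
  proof -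
    have "\<ominus>\<^bsub>V\<^esub> w = (- 1) \<odot>\<^bsub>V\<^esub> w"
      using that W.subset minus[of w 1] one[of w] by auto
    then show ?thesis using W.smult_closed[OF K that] by simp
  qed
  have "subgroup W (add_monoid V)"
    using W.subset neg by unfold_locales (auto simp: a_inv_def)
  then interpret W': abelian_subgroup W V
    by (intro abelian_subgroupI3) (auto simp: additive_subgroup_def V.abelian_group_axioms)
  let ?Q = "quotient_module V W"
  let ?c = "\<lambda>x. W +>\<^bsub>V\<^esub> x"
  have carr: "carrier ?Q = ?c ` carrier V"
    by (auto simp: quotient_module_def A_RCOSETS_def')
  have coset_eq: "?c x = ?c y" if "x \<in> carrier V" "y \<in> carrier V" "x \<ominus>\<^bsub>V\<^esub> y \<in> W" for x y
  proof -
    have "x \<in> ?c y" using that by (intro W'.a_rcos_module_rev) (simp_all add: V.minus_eq)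
    then show ?thesis using W'.a_repr_independence'[of x y] that(2) by blast
  qed
  have zero: "zero ?Q = ?c \<zero>\<^bsub>V\<^esub>"
    using W.subset by (simp add: quotient_module_def V.a_coset_add_zero)
  have add: "add ?Q (?c x) (?c y) = ?c (x \<oplus>\<^bsub>V\<^esub> y)" if "x \<in> carrier V" "y \<in> carrier V" for x y
    using W'.a_rcos_sum[OF that] by (simp add: quotient_module_def)
  have smult: "module.smult ?Q a (?c x) = ?c (a \<odot>\<^bsub>V\<^esub> x)" if x: "x \<in> carrier V" for a x
  proof -
    have eq: "?c (a \<odot>\<^bsub>V\<^esub> z) = ?c (a \<odot>\<^bsub>V\<^esub> x)" if z: "z \<in> ?c x" for z
    proof -
      obtain w where w: "w \<in> W" "z = w \<oplus>\<^bsub>V\<^esub> x"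
        using z by (auto simp: a_r_coset_def')
      then have wV: "w \<in> carrier V" using W.subset by auto
      have "a \<odot>\<^bsub>V\<^esub> z \<ominus>\<^bsub>V\<^esub> a \<odot>\<^bsub>V\<^esub> x = a \<odot>\<^bsub>V\<^esub> w"
        using w wV x by (simp add: V.smult_r_distr V.minus_eq V.a_assoc V.r_neg)
      then show ?thesis
        using w wV x W.smult_closed[OF K w(1), of a] by (intro coset_eq) auto
    qed
    have "x \<in> ?c x" using W'.a_rcos_self[OF x] .
    then have "(\<Union>z\<in>?c x. ?c (a \<odot>\<^bsub>V\<^esub> z)) = ?c (a \<odot>\<^bsub>V\<^esub> x)"
      by (intro SUP_eq_const eq) blast+
    then show ?thesis by (simp add: quotient_module_def)
  qed
  have Q: "Module.module class_ring ?Q"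
  proof (rule module_criteria)
    show "cring (class_ring :: 'k ring)" by (rule class_cring.is_cring)
    show "\<zero>\<^bsub>?Q\<^esub> \<in> carrier ?Q" unfolding carr zero by blast
    show "\<forall>v w. v \<in> carrier ?Q \<and> w \<in> carrier ?Q \<longrightarrow> v \<oplus>\<^bsub>?Q\<^esub> w \<in> carrier ?Q"
      unfolding carr by (auto simp: add)
    show "\<forall>v\<in>carrier ?Q. \<exists>neg_v\<in>carrier ?Q. v \<oplus>\<^bsub>?Q\<^esub> neg_v = \<zero>\<^bsub>?Q\<^esub>"
    proof
      fix v assume "v \<in> carrier ?Q"
      then obtain x where "x \<in> carrier V" "v = ?c x" unfolding carr by blast
      then show "\<exists>neg_v\<in>carrier ?Q. v \<oplus>\<^bsub>?Q\<^esub> neg_v = \<zero>\<^bsub>?Q\<^esub>"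
        unfolding carr by (intro bexI[of _ "?c (\<ominus>\<^bsub>V\<^esub> x)"]) (auto simp: add zero V.r_neg)
    qed
    show "\<forall>c v. c \<in> carrier class_ring \<and> v \<in> carrier ?Q \<longrightarrow> c \<odot>\<^bsub>?Q\<^esub> v \<in> carrier ?Q"
      unfolding carr by (auto simp: smult)
    show "\<forall>v w. v \<in> carrier ?Q \<and> w \<in> carrier ?Q \<longrightarrow> v \<oplus>\<^bsub>?Q\<^esub> w = w \<oplus>\<^bsub>?Q\<^esub> v"
      unfolding carr by (auto simp: add V.a_comm)
    show "\<forall>v w x. v \<in> carrier ?Q \<and> w \<in> carrier ?Q \<and> x \<in> carrier ?Q \<longrightarrow>
        v \<oplus>\<^bsub>?Q\<^esub> w \<oplus>\<^bsub>?Q\<^esub> x = v \<oplus>\<^bsub>?Q\<^esub> (w \<oplus>\<^bsub>?Q\<^esub> x)"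
      unfolding carr by (auto simp: add V.a_assoc)
    show "\<forall>v\<in>carrier ?Q. v \<oplus>\<^bsub>?Q\<^esub> \<zero>\<^bsub>?Q\<^esub> = v"
      unfolding carr zero by (auto simp: add)
    show "\<forall>a b v. a \<in> carrier class_ring \<and> b \<in> carrier class_ring \<and> v \<in> carrier ?Q \<longrightarrow>
        (a \<otimes>\<^bsub>class_ring\<^esub> b) \<odot>\<^bsub>?Q\<^esub> v = a \<odot>\<^bsub>?Q\<^esub> (b \<odot>\<^bsub>?Q\<^esub> v)"
      unfolding carr by (auto simp: smult assoc class_ring_simps)
    show "\<forall>v\<in>carrier ?Q. \<one>\<^bsub>class_ring\<^esub> \<odot>\<^bsub>?Q\<^esub> v = v"
      unfolding carr by (auto simp: smult one class_ring_simps)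
    show "\<forall>a b v. a \<in> carrier class_ring \<and> b \<in> carrier class_ring \<and> v \<in> carrier ?Q \<longrightarrow>
        (a \<oplus>\<^bsub>class_ring\<^esub> b) \<odot>\<^bsub>?Q\<^esub> v = a \<odot>\<^bsub>?Q\<^esub> v \<oplus>\<^bsub>?Q\<^esub> b \<odot>\<^bsub>?Q\<^esub> v"
      unfolding carr by (auto simp: smult add distr class_ring_simps)
    show "\<forall>a v w. a \<in> carrier class_ring \<and> v \<in> carrier ?Q \<and> w \<in> carrier ?Q \<longrightarrow>
        a \<odot>\<^bsub>?Q\<^esub> (v \<oplus>\<^bsub>?Q\<^esub> w) = a \<odot>\<^bsub>?Q\<^esub> v \<oplus>\<^bsub>?Q\<^esub> a \<odot>\<^bsub>?Q\<^esub> w"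
      unfolding carr by (auto simp: smult add V.smult_r_distr)
  qed
  then interpret Q: vectorspace class_ring ?Q
    by (simp add: vectorspace_def class_field)
  obtain x0 where x0: "x0 \<in> carrier V" "\<And>y. y \<in> carrier V \<Longrightarrow> \<exists>a. ?c y = a \<odot>\<^bsub>?Q\<^esub> ?c x0"
  proof (cases "carrier V \<subseteq> W")
    case True
    have "?c y = 1 \<odot>\<^bsub>?Q\<^esub> ?c \<zero>\<^bsub>V\<^esub>" if "y \<in> carrier V" for y
    proof -
      have "?c y = ?c \<zero>\<^bsub>V\<^esub>" using True that by (intro coset_eq) auto
      then show ?thesis by (simp add: smult)
    qed
    then show thesis using that[of "\<zero>\<^bsub>V\<^esub>"] by blast
  next
    case False
    then obtain x0 where x0: "x0 \<in> carrier V" "x0 \<notin> W" by blast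
    have "\<exists>a. ?c y = a \<odot>\<^bsub>?Q\<^esub> ?c x0" if y: "y \<in> carrier V" for y
    proof -
      obtain a b where ab: "a \<noteq> 0 \<or> b \<noteq> 0" "a \<odot>\<^bsub>V\<^esub> x0 \<oplus>\<^bsub>V\<^esub> b \<odot>\<^bsub>V\<^esub> y \<in> W"
        using dep[OF x0(1) y] by blast
      have scale: "inverse c \<odot>\<^bsub>V\<^esub> (c \<odot>\<^bsub>V\<^esub> x) = x" if "c \<noteq> 0" "x \<in> carrier V" for c x
        using that assoc[of x "inverse c" c] one[of x] by simp
      have "b \<noteq> 0"
      proof
        assume b: "b = 0"
        have "0 \<odot>\<^bsub>V\<^esub> y = \<zero>\<^bsub>V\<^esub>" by (rule null[OF y])
        then have "a \<odot>\<^bsub>V\<^esub> x0 \<in> W" using ab(2) b x0(1) by simp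
        then have "inverse a \<odot>\<^bsub>V\<^esub> (a \<odot>\<^bsub>V\<^esub> x0) \<in> W" by (rule W.smult_closed[OF K])
        then show False using scale[of a x0] ab(1) b x0 by simp
      qed
      have "inverse b \<odot>\<^bsub>V\<^esub> (a \<odot>\<^bsub>V\<^esub> x0 \<oplus>\<^bsub>V\<^esub> b \<odot>\<^bsub>V\<^esub> y) \<in> W"
        using ab(2) by (rule W.smult_closed[OF K])
      also have "inverse b \<odot>\<^bsub>V\<^esub> (a \<odot>\<^bsub>V\<^esub> x0 \<oplus>\<^bsub>V\<^esub> b \<odot>\<^bsub>V\<^esub> y) = (inverse b * a) \<odot>\<^bsub>V\<^esub> x0 \<oplus>\<^bsub>V\<^esub> y"
        using scale[OF \<open>b \<noteq> 0\<close> y] assoc[OF x0(1), of "inverse b" a] x0(1) y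
        by (simp add: V.smult_r_distr)
      also have "\<dots> = y \<ominus>\<^bsub>V\<^esub> (- (inverse b * a)) \<odot>\<^bsub>V\<^esub> x0"
        using minus[OF x0(1), of "inverse b * a"] x0(1) y
        by (simp add: V.minus_eq V.a_comm)
      finally have "?c y = ?c ((- (inverse b * a)) \<odot>\<^bsub>V\<^esub> x0)"
        using x0(1) y by (intro coset_eq) auto
      then show ?thesis using smult[OF x0(1)] by metis
    qed
    then show thesis using that[OF x0(1)] by blast
  qed
  have c0: "{?c x0} \<subseteq> carrier ?Q" using x0(1) carr by blast
  have "carrier ?Q \<subseteq> Q.module.span {?c x0}"
  proof
    fix X assume "X \<in> carrier ?Q"
    then obtain y where "y \<in> carrier V" "X = ?c y" unfolding carr by blast
    then obtain a where "X = a \<odot>\<^bsub>?Q\<^esub> ?c x0" using x0(2) by blast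
    moreover have "?c x0 \<in> Q.module.span {?c x0}" using Q.span_self c0 by blast
    ultimately show "X \<in> Q.module.span {?c x0}"
      using LinearCombinations.submodule.smult_closed[OF Q.span_is_submodule[OF c0] K] by blast
  qed
  then have gen: "Q.module.span {?c x0} = carrier ?Q"
    using Q.span_is_subset2[OF c0] by blast
  show "vectorspace.fin_dim class_ring ?Q"
    unfolding Q.fin_dim_def using gen c0 by blast
  show "vectorspace.dim class_ring ?Q \<le> 1"
    using Q.dim_le1I[OF gen] c0 by blast
qed

section \<open>Vectors fixed modulo the Specht module\<close>

context partition_shape begin

definition almost_fixed :: "(tabloid \<Rightarrow> 'k :: field) set" where
  "almost_fixed = {u \<in> carrier (perm_module la).
     \<forall>q. q permutes {1..n} \<longrightarrow> (\<lambda>T. perm_action q u T - u T) \<in> raising_kernel}"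

definition all_ones :: "tabloid \<Rightarrow> 'k :: field" where
  "all_ones = (\<lambda>T. if T \<in> tabloids la then 1 else 0)"

text \<open>
  A representative word at which a raising operator is evaluated; for vectors fixed modulo the
  Specht module the value does not depend on the choice (\<open>raise_almost_fixed\<close>).
\<close>

definition target_word :: "nat \<Rightarrow> nat \<Rightarrow> nat \<Rightarrow> nat" where
  "target_word i a = (SOME w. w \<in> words n (move (Suc i) i a lam))"

definition raising_const :: "(tabloid \<Rightarrow> 'k :: field) \<Rightarrow> nat \<Rightarrow> nat \<Rightarrow> 'k" where
  "raising_const u i a = raise n i a (word_coeff la u) (target_word i a)"

lemma target_word:
  assumes "a \<le> lam (Suc i)"
  shows "target_word i a \<in> words n (move (Suc i) i a lam)"
proof -
  obtain w where "w \<in> words n lam" using words_nonempty by blast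
  then obtain w' where "w' \<in> words n (move (Suc i) i a lam)"
    using obtain_moved_word[of w n lam a "Suc i" i] assms by auto
  then show ?thesis unfolding target_word_def by (metis someI)
qed

lemma tabloid_action_in_tabloids:
  assumes "q permutes {1..n}"
  shows "tabloid_action q T \<in> tabloids la \<longleftrightarrow> T \<in> tabloids la"
proof
  have closed: "tabloid_action r T' \<in> tabloids la" if r: "r permutes {1..n}" and "T' \<in> tabloids la" for r T'
  proof -
    obtain w where w: "w \<in> words n lam" "T' = word_tabloid la w"
      using \<open>T' \<in> tabloids la\<close> unfolding tabloids_eq by blast
    then show ?thesis
      using comp_in_words[OF w(1) permutes_inv[OF r]] by (simp add: tabloid_action_word_tabloid[OF r] tabloids_eq)
  qed
  have "tabloid_action (inv' q) (tabloid_action q T) = T"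
    using permutes_inv_o(2)[OF assms] by (simp add: tabloid_action_def image_image flip: comp_assoc)
  then show "T \<in> tabloids la" if "tabloid_action q T \<in> tabloids la"
    using closed[OF permutes_inv[OF assms] that] by simp
  show "tabloid_action q T \<in> tabloids la" if "T \<in> tabloids la"
    by (rule closed[OF assms that])
qed

lemma perm_action_in_perm_module:
  assumes "q permutes {1..n}" "v \<in> carrier (perm_module la)"
  shows "perm_action q v \<in> carrier (perm_module la)"
  using assms tabloid_action_in_tabloids[OF permutes_inv[OF assms(1)]]
  by (simp add: perm_module_simps perm_action_def)

lemma perm_action_in_raising_kernel:
  assumes q: "q permutes {1..n}" and v: "v \<in> raising_kernel"
  shows "perm_action q v \<in> raising_kernel"
proof -
  have "word_coeff la (perm_action q v) = (\<lambda>w. word_coeff la v (w \<circ> q))"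
    by (simp add: perm_action_coeff[OF q] fun_eq_iff)
  then show ?thesis
    using v perm_action_in_perm_module[OF q, of v] comp_in_words[OF _ q]
    by (auto simp: raising_kernel_def annihilated_def raise_comp_permutes[OF q])
qed

lemma perm_action_comp:
  assumes "q permutes {1..n}" "r permutes {1..n}"
  shows "perm_action (q \<circ> r) v = perm_action q (perm_action r v)"
proof -
  have "inv' (q \<circ> r) = inv' r \<circ> inv' q"
    using assms by (simp add: o_inv_distrib permutes_bij)
  then show ?thesis
    by (simp add: perm_action_def tabloid_action_def image_image comp_assoc)
qed

lemma perm_action_linear:
  "perm_action q (\<lambda>T. x * v T + y * v' T) = (\<lambda>T. x * perm_action q v T + y * perm_action q v' T)"
  by (simp add: perm_action_def)

lemma almost_fixed_linear:
  assumes "u \<in> almost_fixed" "u' \<in> almost_fixed"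
  shows "(\<lambda>T. x * u T + y * u' T) \<in> (almost_fixed :: (tabloid \<Rightarrow> 'k :: field) set)"
proof -
  have "(\<lambda>T. perm_action q (\<lambda>T. x * u T + y * u' T) T - (x * u T + y * u' T)) \<in> raising_kernel"
    if "q permutes {1..n}" for q
  proof -
    have "(\<lambda>T. x * (perm_action q u T - u T) + y * (perm_action q u' T - u' T)) \<in> raising_kernel"
      using assms that by (intro raising_kernel_linear) (simp_all add: almost_fixed_def)
    moreover have "(\<lambda>T. x * (perm_action q u T - u T) + y * (perm_action q u' T - u' T)) =
        (\<lambda>T. perm_action q (\<lambda>T. x * u T + y * u' T) T - (x * u T + y * u' T))"
      by (simp add: perm_action_linear algebra_simps fun_eq_iff)
    ultimately show ?thesis by simp
  qed
  moreover have "(\<lambda>T. x * u T + y * u' T) \<in> carrier (perm_module la)"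
    using assms by (simp add: almost_fixed_def perm_module_simps)
  ultimately show ?thesis by (simp add: almost_fixed_def)
qed

lemma perm_action_all_ones:
  assumes "q permutes {1..n}"
  shows "perm_action q all_ones = all_ones"
  using tabloid_action_in_tabloids[OF permutes_inv[OF assms]] by (simp add: perm_action_def all_ones_def)

lemma all_ones_almost_fixed: "all_ones \<in> (almost_fixed :: (tabloid \<Rightarrow> 'k :: field) set)"
proof -
  have "(\<lambda>T. 0) \<in> (raising_kernel :: (tabloid \<Rightarrow> 'k) set)"
    using LinearCombinations.submodule.zero_closed[OF raising_kernel_submodule] by (simp add: perm_module_simps)
  then show ?thesis
    by (simp add: almost_fixed_def perm_action_all_ones) (simp add: perm_module_simps all_ones_def)
qed

lemma raising_const_linear:
  "raising_const (\<lambda>T. x * u T + y * u' T) i a = x * raising_const u i a + (y :: 'k :: field) * raising_const u' i a"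
proof -
  have "word_coeff la (\<lambda>T. x * u T + y * u' T) = (\<lambda>w. x * word_coeff la u w + y * word_coeff la u' w)"
    by (simp add: word_coeff_def fun_eq_iff)
  then show ?thesis by (simp add: raising_const_def raise_linear)
qed

text \<open>
  Each of the $\binom{\lambda_i+a}{a}$ ways of choosing the raised entries contributes \<open>1\<close>.
\<close>

lemma raising_const_all_ones:
  assumes "a \<le> lam (Suc i)"
  shows "raising_const all_ones i a = (of_nat ((lam i + a) choose a) :: 'k :: field)"
proof -
  let ?w = "target_word i a"
  have "word_coeff la all_ones (relabel ?w A (Suc i)) = (1 :: 'k)" if "A \<in> subsets_of_card (fiber n ?w i) a" for A
  proof -
    have "move i (Suc i) a (move (Suc i) i a lam) = lam"
      using assms by (auto simp: move_def)
    then have "relabel ?w A (Suc i) \<in> words n lam"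
      using relabel_in_words[OF target_word[OF assms] that, of "Suc i"] by simp
    then show ?thesis by (simp add: word_coeff_def all_ones_def tabloids_eq)
  qed
  then have "raising_const all_ones i a = (\<Sum>A\<in>subsets_of_card (fiber n ?w i) a. 1 :: 'k)"
    unfolding raising_const_def raise_def by (intro sum.cong) auto
  also have "\<dots> = of_nat ((lam i + a) choose a)"
    using card_fiber[OF target_word[OF assms], of i] by (simp add: card_subsets_of_card move_def)
  finally show ?thesis .
qed

text \<open>
  Words of equal content are conjugate under the symmetric group, and $qu - u$ is annihilated.
\<close>

lemma raise_almost_fixed:
  assumes u: "u \<in> (almost_fixed :: (tabloid \<Rightarrow> 'k :: field) set)"
    and a: "0 < a" "a \<le> lam (Suc i)" and w: "w \<in> words n (move (Suc i) i a lam)"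
  shows "raise n i a (word_coeff la u) w = raising_const u i a"
proof -
  obtain q where q: "q permutes {1..n}" "w = target_word i a \<circ> q"
    using words_transitive[OF target_word[OF a(2)] w] by blast
  let ?d = "\<lambda>T. perm_action q u T - u T"
  have "?d \<in> raising_kernel" using u q(1) by (simp add: almost_fixed_def)
  then have "raise n i a (word_coeff la ?d) (target_word i a) = 0"
    using target_word[OF a(2)] a by (simp add: raising_kernel_def annihilated_def)
  moreover have "word_coeff la ?d = (\<lambda>w. 1 * word_coeff la u (w \<circ> q) + (- 1) * word_coeff la u w)"
    using perm_action_coeff[OF q(1), of u] by (simp add: word_coeff_def fun_eq_iff)
  ultimately have "1 * raise n i a (\<lambda>w. word_coeff la u (w \<circ> q)) (target_word i a) +
      (- 1) * raise n i a (word_coeff la u) (target_word i a) = 0"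
    by (simp only: raise_linear)
  then show ?thesis
    by (simp add: raise_comp_permutes[OF q(1)] q(2) raising_const_def)
qed

lemma constant_raising:
  assumes p: "prime p" "p \<ge> 3" "CHAR('k :: field) = p"
    and u: "u \<in> (almost_fixed :: (tabloid \<Rightarrow> 'k) set)"
  shows "constant_raising p n lam (word_coeff la u) (raising_const u)"
  using p lam_Suc_le words_nonempty raise_almost_fixed[OF u] by unfold_locales auto

text \<open>
  The two conditions of \<open>coherent_family_eq_0\<close> are linear functionals \<open>f\<close> and \<open>g\<close> on the vectors fixed
  modulo the Specht module, and three vectors have a nontrivial combination that both of them
  kill.  Since \<open>f\<close> does not vanish on \<open>all_ones\<close>, this combination involves one of the other two.
\<close>

theorem combination_in_raising_kernel:
  assumes p: "prime p" "p \<ge> 3" "CHAR('k :: field) = p" and non_james: "\<not> james_partition p la"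
    and u: "u \<in> (almost_fixed :: (tabloid \<Rightarrow> 'k) set)" "u' \<in> (almost_fixed :: (tabloid \<Rightarrow> 'k) set)"
  shows "\<exists>x y z. (x \<noteq> 0 \<or> y \<noteq> 0) \<and> (\<lambda>T. x * u T + y * u' T + z * all_ones T) \<in> raising_kernel"
proof -
  interpret char: field_of_char p "TYPE('k)"
    using p by unfold_locales auto
  let ?J = "\<lambda>i a. of_nat ((lam i + a) choose a) :: 'k"
  let ?bad = "\<lambda>i a. 0 < a \<and> a \<le> lam (Suc i) \<and> ?J i a \<noteq> 0"
  obtain i0 a0 where "Suc i0 < length la" "a0 \<in> {1..la ! Suc i0}" "\<not> p dvd ((la ! i0 + a0) choose a0)"
    using non_james unfolding james_partition_def by blast
  then have "?bad i0 a0"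
    by (simp add: row_length_def char.of_nat_eq_0)
  define i where "i = (LEAST i. \<exists>a. ?bad i a)"
  have "\<exists>a. ?bad i a" unfolding i_def by (rule LeastI[of _ i0]) (use \<open>?bad i0 a0\<close> in blast)
  define a where "a = (LEAST a. ?bad i a)"
  have a: "?bad i a" unfolding a_def by (rule LeastI_ex) fact
  have james: "?J j b = 0" if "j < i" "0 < b" "b \<le> lam (Suc j)" for j b
    using not_less_Least[of j "\<lambda>i. \<exists>a. ?bad i a"] that unfolding i_def by blast
  have least: "?J i b = 0" if "0 < b" "b < a" for b
    using not_less_Least[of b "?bad i"] that a unfolding a_def by auto
  obtain s where s: "a = p ^ s"
  proof -
    (* J_i(a) (a choose x) is a multiple of J_i(a - x) = 0. *)
    have "(of_nat (a choose x) :: 'k) = 0" if x: "0 < x" "x < a" for x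
    proof -
      have "((lam i + a) choose a) * (a choose x) = ((lam i + a) choose x) * ((lam i + (a - x)) choose (a - x))"
        using choose_mult[of x a "lam i + a"] x by simp
      then have "?J i a * of_nat (a choose x) = of_nat ((lam i + a) choose x) * ?J i (a - x)"
        by (metis of_nat_mult)
      then show ?thesis using least[of "a - x"] x a by simp
    qed
    then show thesis using char.choose_neq_0_imp_ppow[of a] a that by blast
  qed
  obtain h where h: "p ^ h \<le> lam (Suc i)" "lam (Suc i) < p ^ Suc h"
    using ex_power_ivl1[of p "lam (Suc i)"] p(2) a by auto
  define f where "f v = raising_const v i (p ^ s)" for v :: "tabloid \<Rightarrow> 'k"
  define g where "g v = (if p ^ s \<le> lam (Suc (Suc i)) then raising_const v (Suc i) (p ^ s) else raising_const v i (p ^ h))"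
    for v :: "tabloid \<Rightarrow> 'k"
  have f_lin: "f (\<lambda>T. x * v T + y * v' T) = x * f v + y * f v'" for x y v v'
    by (simp add: f_def raising_const_linear)
  have g_lin: "g (\<lambda>T. x * v T + y * v' T) = x * g v + y * g v'" for x y v v'
    by (simp add: g_def raising_const_linear)
  have in_kernel: "v \<in> raising_kernel" if v: "v \<in> almost_fixed" "f v = 0" "g v = 0" for v
  proof -
    interpret cr: constant_raising p "TYPE('k)" n lam "word_coeff la v" "raising_const v"
      by (rule constant_raising[OF p v(1)])
    have "raising_const v j b = 0" if "0 < b" "b \<le> lam (Suc j)" for j b
      by (rule cr.coherent_family_eq_0[OF james _ _ _ h])
        (use a s least that v(2,3) in \<open>auto simp: f_def g_def split: if_splits\<close>)
    then show ?thesis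
      using v(1) raise_almost_fixed[OF v(1)] by (simp add: raising_kernel_def annihilated_def almost_fixed_def)
  qed
  have f1: "f all_ones \<noteq> 0"
    using a s by (simp add: f_def raising_const_all_ones)
  (* Normalise so that f vanishes. *)
  define k where "k v = - (f v / f all_ones)" for v
  define nu where "nu v = (\<lambda>T. 1 * v T + k v * all_ones T)" for v
  have nu: "nu v \<in> almost_fixed" "f (nu v) = 0" if "v \<in> almost_fixed" for v
  proof -
    show "nu v \<in> almost_fixed"
      unfolding nu_def by (rule almost_fixed_linear[OF that all_ones_almost_fixed])
    have "f (nu v) = 1 * f v + k v * f all_ones"
      unfolding nu_def by (rule f_lin)
    then show "f (nu v) = 0" using f1 by (simp add: k_def)
  qed
  obtain x y where xy: "x \<noteq> 0 \<or> y \<noteq> 0" "x * g (nu u) + y * g (nu u') = 0"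
  proof (cases "g (nu u) = 0")
    case True
    then show thesis using that[of 1 0] by simp
  next
    case False
    then show thesis using that[of "g (nu u')" "- g (nu u)"] by simp
  qed
  define v where "v = (\<lambda>T. x * nu u T + y * nu u' T)"
  have "v \<in> raising_kernel"
    unfolding v_def using nu[OF u(1)] nu[OF u(2)] xy
    by (intro in_kernel almost_fixed_linear) (simp_all add: f_lin g_lin)
  moreover have "v = (\<lambda>T. x * u T + y * u' T + (x * k u + y * k u') * all_ones T)"
    by (simp add: v_def nu_def algebra_simps fun_eq_iff)
  ultimately show ?thesis using xy(1) by blast
qed

section \<open>Cohomology of the permutation module\<close>

text \<open>
  On the stabilizer of a word a crossed homomorphism is additive.  The stabilizer is a Young
  subgroup, generated by transpositions, and on a transposition an additive map has a value
  \<open>z\<close> with $2z = 0$.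
\<close>

lemma crossed_hom_stabilizer:
  fixes Z :: "(nat \<Rightarrow> nat) \<Rightarrow> (nat \<Rightarrow> nat) \<Rightarrow> 'k :: field"
  assumes two: "(2 :: 'k) \<noteq> 0"
    and Z: "\<And>q r. q permutes {1..n} \<Longrightarrow> r permutes {1..n} \<Longrightarrow> Z (q \<circ> r) w = Z q w + Z r (w \<circ> q)"
    and s: "s permutes {1..n}" "w \<circ> s = w"
  shows "Z s w = 0"
  using s
proof (induction "card {x. s x \<noteq> x}" arbitrary: s rule: less_induct)
  case less
  have "Z (id \<circ> id) w = Z id w + Z id (w \<circ> id)"
    by (rule Z) (rule permutes_id)+
  then have Z_id: "Z id w = 0"
    by (simp only: comp_id add_cancel_right_right)
  show ?case
  proof (cases "s = id")
    case True
    then show ?thesis using Z_id by simp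
  next
    case False
    then obtain x where x: "s x \<noteq> x" by (auto simp: fun_eq_iff)
    have x_in: "x \<in> {1..n}" using x permutes_not_in[OF less.prems(1)] by blast
    have sx_in: "s x \<in> {1..n}" using x_in permutes_in_image[OF less.prems(1)] by blast
    let ?tau = "transpose x (s x)"
    have tau: "?tau permutes {1..n}" using x_in sx_in by (rule permutes_swap_id)
    have w_tau: "w \<circ> ?tau = w"
      using fun_cong[OF less.prems(2), of x] by (auto simp: transpose_def)
    have Z_tau: "Z ?tau w = 0"
    proof -
      have "Z ?tau w + Z ?tau w = 0"
        using Z[OF tau tau] Z_id by (simp add: w_tau)
      then have "2 * Z ?tau w = 0" by (simp only: mult_2)
      then show ?thesis using two by simp
    qed
    let ?s = "?tau \<circ> s"
    have s': "?s permutes {1..n}" using less.prems(1) tau by (rule permutes_compose)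
    have inj: "inj s" using less.prems(1) by (rule permutes_inj)
    have "{y. ?s y \<noteq> y} \<subset> {y. s y \<noteq> y}"
    proof
      show "{y. ?s y \<noteq> y} \<subseteq> {y. s y \<noteq> y}"
      proof clarify
        fix y assume y: "?s y \<noteq> y" "s y = y"
        then have "y = x \<or> y = s x" by (auto simp: transpose_def split: if_splits)
        then show False using x y(2) injD[OF inj, of "s x" x] by auto
      qed
      have "x \<notin> {y. ?s y \<noteq> y}" "x \<in> {y. s y \<noteq> y}" using x by simp_all
      then show "{y. ?s y \<noteq> y} \<noteq> {y. s y \<noteq> y}" by blast
    qed
    moreover have "finite {y. s y \<noteq> y}"
      by (rule finite_subset[of _ "{1..n}"]) (use permutes_not_in[OF less.prems(1)] in blast)+
    ultimately have "card {y. ?s y \<noteq> y} < card {y. s y \<noteq> y}" by (intro psubset_card_mono)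
    moreover have "w \<circ> ?s = w" using w_tau less.prems(2) by (metis comp_assoc)
    ultimately have "Z ?s w = 0" using less.hyps s' by blast
    then have "Z (?tau \<circ> ?s) w = 0" using Z[OF tau s'] Z_tau unfolding w_tau by simp
    moreover have "?tau \<circ> ?s = s" by (simp add: comp_assoc[symmetric])
    ultimately show ?thesis by (simp only:)
  qed
qed

text \<open>
  This is Shapiro's lemma made explicit: the symmetric group acts transitively on words, so
  \<open>u\<close> can be defined at $w_0 q$ as the value of \<open>z\<close> for \<open>q\<close> at $w_0$.  This is independent of the choice
  of \<open>q\<close> since crossed homomorphisms vanish on the stabilizer of $w_0$.
\<close>

lemma crossed_hom_principal:
  fixes z :: "(nat \<Rightarrow> nat) \<Rightarrow> tabloid \<Rightarrow> 'k :: field"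
  assumes two: "(2 :: 'k) \<noteq> 0"
    and z: "\<And>q. q permutes {1..n} \<Longrightarrow> z q \<in> carrier (perm_module la)"
    and crossed: "\<And>q r. q permutes {1..n} \<Longrightarrow> r permutes {1..n} \<Longrightarrow>
      z (q \<circ> r) = (\<lambda>T. z q T + perm_action q (z r) T)"
  shows "\<exists>u\<in>carrier (perm_module la). \<forall>q. q permutes {1..n} \<longrightarrow> z q = (\<lambda>T. perm_action q u T - u T)"
proof -
  define Z where "Z q = word_coeff la (z q)" for q
  have Z: "Z (q \<circ> r) w = Z q w + Z r (w \<circ> q)" if "q permutes {1..n}" "r permutes {1..n}" for q r w
    using crossed[OF that] perm_action_coeff[OF that(1), of "z r" w] by (simp add: Z_def word_coeff_def)
  obtain w0 where w0: "w0 \<in> words n lam" using words_nonempty by blast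
  have well_defined: "Z q w0 = Z r w0"
    if q: "q permutes {1..n}" and r: "r permutes {1..n}" and eq: "w0 \<circ> q = w0 \<circ> r" for q r
  proof -
    let ?s = "q \<circ> inv' r"
    have s: "?s permutes {1..n}" using permutes_inv[OF r] q by (rule permutes_compose)
    have w0_s: "w0 \<circ> ?s = w0"
      using eq permutes_inv_o(1)[OF r] by (metis comp_assoc comp_id)
    have "q = ?s \<circ> r"
      using permutes_inv_o(2)[OF r] by (simp add: comp_assoc)
    then have "Z q w0 = Z ?s w0 + Z r (w0 \<circ> ?s)" using Z[OF s r] by metis
    then show ?thesis
      using crossed_hom_stabilizer[where Z = Z and w = w0 and s = ?s, OF two Z s w0_s] w0_s by simp
  qed
  define h where "h w = (SOME q. q permutes {1..n} \<and> w = w0 \<circ> q)" for w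
  have h: "h w permutes {1..n}" "w = w0 \<circ> h w" if "w \<in> words n lam" for w
    using someI_ex[of "\<lambda>q. q permutes {1..n} \<and> w = w0 \<circ> q"] words_transitive[OF w0 that]
    unfolding h_def by blast+
  define U where "U w = Z (h w) w0" for w
  have U: "U (w0 \<circ> q) = Z q w0" if q: "q permutes {1..n}" for q
    unfolding U_def using h[OF comp_in_words[OF w0 q]] q by (intro well_defined) auto
  have UZ: "U (w \<circ> q) - U w = Z q w" if w: "w \<in> words n lam" and q: "q permutes {1..n}" for w q
  proof -
    have "U (w \<circ> q) = Z (h w \<circ> q) w0"
      using U[OF permutes_compose[OF q h(1)[OF w]]] h(2)[OF w] by (metis comp_assoc)
    also have "\<dots> = Z (h w) w0 + Z q w"
      using Z[OF h(1)[OF w] q] h(2)[OF w] by metis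
    finally show ?thesis by (simp add: U_def)
  qed
  define u where "u T = (if T \<in> tabloids la then U (the_inv_into (words n lam) (word_tabloid la) T) else 0)" for T
  have inj: "inj_on (word_tabloid la) (words n lam)"
    using word_tabloid_inj by (auto simp: inj_on_def)
  have u: "u \<in> carrier (perm_module la)" by (simp add: u_def perm_module_simps)
  have u_coeff: "word_coeff la u w = U w" if "w \<in> words n lam" for w
    using that by (simp add: word_coeff_def u_def tabloids_eq the_inv_into_f_f[OF inj])
  have "z q = (\<lambda>T. perm_action q u T - u T)" if q: "q permutes {1..n}" for q
  proof (rule perm_module_eqI[OF z[OF q]])
    show "(\<lambda>T. perm_action q u T - u T) \<in> carrier (perm_module la)"
      using u perm_action_in_perm_module[OF q u] by (simp add: perm_module_simps)
    fix w assume w: "w \<in> words n lam"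
    have "word_coeff la (\<lambda>T. perm_action q u T - u T) w = U (w \<circ> q) - U w"
      using perm_action_coeff[OF q, of u w] u_coeff[OF w] u_coeff[OF comp_in_words[OF w q]] by (simp add: word_coeff_def)
    then show "word_coeff la (z q) w = word_coeff la (\<lambda>T. perm_action q u T - u T) w"
      using UZ[OF w q] by (simp add: Z_def)
  qed
  then show ?thesis using u by blast
qed

end

section \<open>Cocycles with values in the Specht module\<close>

lemma carrier_update_simps:
  fixes M :: "('a, 'b) module"
  shows "carrier (M\<lparr>carrier := X\<rparr>) = X" "zero (M\<lparr>carrier := X\<rparr>) = zero M"
    "add (M\<lparr>carrier := X\<rparr>) = add M" "module.smult (M\<lparr>carrier := X\<rparr>) = module.smult M"
  by simp_all

context partition_shape begin

abbreviation "G \<equiv> sym_group n"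

lemma permutes_tuples:
  "gs \<in> tuples G 1 \<longleftrightarrow> (\<exists>g. gs = [g] \<and> g permutes {1..n})"
  "gs \<in> tuples G 2 \<longleftrightarrow> (\<exists>g h. gs = [g, h] \<and> g permutes {1..n} \<and> h permutes {1..n})"
  "gs \<in> tuples G 3 \<longleftrightarrow>
     (\<exists>a b c. gs = [a, b, c] \<and> a permutes {1..n} \<and> b permutes {1..n} \<and> c permutes {1..n})"
  by (auto simp: tuples_def sym_group_carrier length_Suc_conv numeral_2_eq_2 numeral_3_eq_3)

context
  fixes V :: "('k :: field, tabloid \<Rightarrow> 'k) module"
  assumes two: "(2 :: 'k) \<noteq> 0" and V_def: "V = specht_module la"
begin

lemma V_eq: "V = (perm_module la) \<lparr>carrier := raising_kernel\<rparr>"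
  using carrier_specht_module[OF two] by (simp add: V_def specht_module_def)

lemma V_simps:
  "carrier V = raising_kernel" "zero V = (\<lambda>T. 0)" "add V = (\<lambda>v w T. v T + w T)" "module.smult V = (\<lambda>c v T. c * v T)"
  by (simp_all add: V_eq perm_module_simps)

lemma V_module: "Module.module class_ring V"
proof -
  interpret P: Module.module class_ring "perm_module la :: ('k, _) module" by (rule perm_module_module)
  show ?thesis unfolding V_eq by (rule P.submodule_is_module[OF raising_kernel_submodule])
qed

lemma finsum_V:
  assumes "finite A" "\<And>i. i \<in> A \<Longrightarrow> F i \<in> raising_kernel"
  shows "(\<Oplus>\<^bsub>V\<^esub>i\<in>A. F i) = (\<lambda>T. \<Sum>i\<in>A. F i T)"
proof -
  interpret V: Module.module class_ring V by (rule V_module)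
  show ?thesis
    using assms
  proof (induction A rule: finite_induct)
    case empty
    then show ?case by (simp add: V_simps)
  next
    case (insert i A)
    then have "(\<Oplus>\<^bsub>V\<^esub>i\<in>insert i A. F i) = F i \<oplus>\<^bsub>V\<^esub> (\<Oplus>\<^bsub>V\<^esub>i\<in>A. F i)"
      by (intro V.finsum_insert) (auto simp: V_simps)
    then show ?case using insert by (simp add: V_simps)
  qed
qed

lemma raising_kernel_scaled: "v \<in> raising_kernel \<Longrightarrow> (\<lambda>T. c * v T) \<in> (raising_kernel :: (tabloid \<Rightarrow> 'k) set)"
  using raising_kernel_linear[of v v c 0] by simp

lemma coboundary_0:
  assumes f: "\<And>g. g permutes {1..n} \<Longrightarrow> f [g] \<in> raising_kernel" and "g permutes {1..n}" "h permutes {1..n}"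
  shows "coboundary G V 0 f [g, h] = (\<lambda>T. f [h] T - f [g] T)"
proof -
  have "[g, h] \<in> tuples G (0 + 2)" using assms by (simp add: tuples_def sym_group_carrier)
  then have "coboundary G V 0 f [g, h] =
      (\<Oplus>\<^bsub>V\<^esub>i\<in>{..0 + 1}. (- 1) ^ i \<odot>\<^bsub>V\<^esub> f (take i [g, h] @ drop (Suc i) [g, h]))"
    by (simp only: coboundary_def restrict_apply' if_True)
  also have "\<dots> = (\<lambda>T. \<Sum>i\<in>{..0 + 1}. ((- 1) ^ i \<odot>\<^bsub>V\<^esub> f (take i [g, h] @ drop (Suc i) [g, h])) T)"
  proof (rule finsum_V)
    fix i assume "i \<in> {..0 + 1 :: nat}"
    then have "i = 0 \<or> i = 1" by auto
    then show "(- 1) ^ i \<odot>\<^bsub>V\<^esub> f (take i [g, h] @ drop (Suc i) [g, h]) \<in> raising_kernel"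
      using assms by (auto simp: V_simps intro!: raising_kernel_scaled[where c = "-1", simplified])
  qed simp
  also have "\<dots> = (\<lambda>T. f [h] T - f [g] T)"
    by (simp add: V_simps)
  finally show ?thesis .
qed

lemma coboundary_1:
  assumes f: "\<And>g h. g permutes {1..n} \<Longrightarrow> h permutes {1..n} \<Longrightarrow> f [g, h] \<in> raising_kernel"
    and "a permutes {1..n}" "b permutes {1..n}" "c permutes {1..n}"
  shows "coboundary G V 1 f [a, b, c] = (\<lambda>T. f [b, c] T - f [a, c] T + f [a, b] T)"
proof -
  have "[a, b, c] \<in> tuples G (1 + 2)" using assms by (simp add: tuples_def sym_group_carrier)
  then have "coboundary G V 1 f [a, b, c] =
      (\<Oplus>\<^bsub>V\<^esub>i\<in>{..1 + 1}. (- 1) ^ i \<odot>\<^bsub>V\<^esub> f (take i [a, b, c] @ drop (Suc i) [a, b, c]))"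
    by (simp only: coboundary_def restrict_apply' if_True)
  also have "\<dots> = (\<lambda>T. \<Sum>i\<in>{..1 + 1}. ((- 1) ^ i \<odot>\<^bsub>V\<^esub> f (take i [a, b, c] @ drop (Suc i) [a, b, c])) T)"
  proof (rule finsum_V)
    fix i assume "i \<in> {..1 + 1 :: nat}"
    then have "i = 0 \<or> i = 1 \<or> i = 2" by auto
    then show "(- 1) ^ i \<odot>\<^bsub>V\<^esub> f (take i [a, b, c] @ drop (Suc i) [a, b, c]) \<in> raising_kernel"
      using assms by (auto simp: V_simps intro!: raising_kernel_scaled[where c = "-1", simplified])
  qed simp
  also have "\<dots> = (\<lambda>T. f [b, c] T - f [a, c] T + f [a, b] T)"
    by (simp add: V_simps numeral_2_eq_2)
  finally show ?thesis .
qed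

text \<open>
  The homogeneous \<open>1\<close>-cocycles, written out on pairs of permutations.
\<close>

definition is_cocycle :: "((nat \<Rightarrow> nat) list \<Rightarrow> tabloid \<Rightarrow> 'k) \<Rightarrow> bool" where
  "is_cocycle f \<longleftrightarrow> f \<in> extensional (tuples G 2) \<and>
     (\<forall>g h. g permutes {1..n} \<longrightarrow> h permutes {1..n} \<longrightarrow> f [g, h] \<in> raising_kernel) \<and>
     (\<forall>q g h. q permutes {1..n} \<longrightarrow> g permutes {1..n} \<longrightarrow> h permutes {1..n} \<longrightarrow>
        f [q \<circ> g, q \<circ> h] = perm_action q (f [g, h])) \<and>
     (\<forall>a b c T. a permutes {1..n} \<longrightarrow> b permutes {1..n} \<longrightarrow> c permutes {1..n} \<longrightarrow>
        f [b, c] T - f [a, c] T + f [a, b] T = 0)"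

abbreviation "C1 \<equiv> cochains G V perm_action 1"

lemma C1_simps:
  "zero C1 = (\<lambda>gs\<in>tuples G 2. \<lambda>T. 0)"
  "add C1 = (\<lambda>f h. \<lambda>gs\<in>tuples G 2. \<lambda>T. f gs T + h gs T)"
  "module.smult C1 = (\<lambda>c f. \<lambda>gs\<in>tuples G 2. \<lambda>T. c * f gs T)"
  by (simp_all add: cochains_def V_simps numeral_2_eq_2)

lemma cocycles_eq: "cocycles G V perm_action 1 = {f. is_cocycle f}"
proof -
  have carr: "f \<in> carrier C1 \<longleftrightarrow> f \<in> extensional (tuples G 2) \<and>
     (\<forall>g h. g permutes {1..n} \<longrightarrow> h permutes {1..n} \<longrightarrow> f [g, h] \<in> raising_kernel) \<and>
     (\<forall>q g h. q permutes {1..n} \<longrightarrow> g permutes {1..n} \<longrightarrow> h permutes {1..n} \<longrightarrow>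
        f [q \<circ> g, q \<circ> h] = perm_action q (f [g, h]))" for f
  proof -
    have "f \<in> tuples G 2 \<rightarrow>\<^sub>E raising_kernel \<longleftrightarrow> f \<in> extensional (tuples G 2) \<and>
       (\<forall>g h. g permutes {1..n} \<longrightarrow> h permutes {1..n} \<longrightarrow> f [g, h] \<in> raising_kernel)"
      unfolding PiE_def Pi_def permutes_tuples(2) by auto
    moreover have "(\<forall>g\<in>carrier G. \<forall>gs\<in>tuples G 2.
         f (map (\<lambda>h. g \<otimes>\<^bsub>G\<^esub> h) gs) = perm_action g (f gs)) \<longleftrightarrow>
       (\<forall>q g h. q permutes {1..n} \<longrightarrow> g permutes {1..n} \<longrightarrow> h permutes {1..n} \<longrightarrow>
        f [q \<circ> g, q \<circ> h] = perm_action q (f [g, h]))"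
    proof (intro iffI ballI allI impI)
      fix q g h
      assume eqv: "\<forall>g\<in>carrier G. \<forall>gs\<in>tuples G 2.
         f (map (\<lambda>h. g \<otimes>\<^bsub>G\<^esub> h) gs) = perm_action g (f gs)"
        and q: "q permutes {1..n}" and gh: "g permutes {1..n}" "h permutes {1..n}"
      have "q \<in> carrier G" "[g, h] \<in> tuples G 2"
        using q gh by (simp_all add: tuples_def sym_group_carrier)
      then have "f (map (\<lambda>h. q \<otimes>\<^bsub>G\<^esub> h) [g, h]) = perm_action q (f [g, h])"
        using eqv by blast
      then show "f [q \<circ> g, q \<circ> h] = perm_action q (f [g, h])" by (simp add: sym_group_mult)
    next
      fix g gs
      assume eqv: "\<forall>q g h. q permutes {1..n} \<longrightarrow> g permutes {1..n} \<longrightarrow> h permutes {1..n} \<longrightarrow>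
          f [q \<circ> g, q \<circ> h] = perm_action q (f [g, h])"
        and g: "g \<in> carrier G" and gs: "gs \<in> tuples G 2"
      obtain a b where ab: "gs = [a, b]" "a permutes {1..n}" "b permutes {1..n}"
        using gs unfolding permutes_tuples(2) by blast
      have "g permutes {1..n}" using g by (simp only: sym_group_carrier)
      then have "f [g \<circ> a, g \<circ> b] = perm_action g (f [a, b])" using eqv ab by blast
      then show "f (map (\<lambda>h. g \<otimes>\<^bsub>G\<^esub> h) gs) = perm_action g (f gs)"
        using ab by (simp add: sym_group_mult)
    qed
    ultimately show ?thesis
      by (simp add: cochains_def V_simps numeral_2_eq_2)
  qed
  have cond: "coboundary G V 1 f = zero (cochains G V perm_action (1 + 1)) \<longleftrightarrow>
     (\<forall>a b c T. a permutes {1..n} \<longrightarrow> b permutes {1..n} \<longrightarrow> c permutes {1..n} \<longrightarrow>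
        f [b, c] T - f [a, c] T + f [a, b] T = 0)" if "f \<in> carrier C1" for f
  proof -
    have zero: "zero (cochains G V perm_action (1 + 1)) = (\<lambda>gs\<in>tuples G 3. \<lambda>T. 0)"
      by (simp add: cochains_def V_simps numeral_3_eq_3)
    have ext: "coboundary G V 1 f \<in> extensional (tuples G 3)"
      by (simp add: coboundary_def numeral_3_eq_3)
    have f: "f [g, h] \<in> raising_kernel" if "g permutes {1..n}" "h permutes {1..n}" for g h
      using \<open>f \<in> carrier C1\<close> carr that by blast
    have cob: "coboundary G V 1 f [a, b, c] = (\<lambda>T. f [b, c] T - f [a, c] T + f [a, b] T)"
      if "a permutes {1..n}" "b permutes {1..n}" "c permutes {1..n}" for a b c
      by (rule coboundary_1[OF _ that]) (rule f)
    show ?thesis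
      unfolding zero
    proof (intro iffI allI impI)
      fix a b c T
      assume eq: "coboundary G V 1 f = (\<lambda>gs\<in>tuples G 3. \<lambda>T. 0)"
        and abc: "a permutes {1..n}" "b permutes {1..n}" "c permutes {1..n}"
      have "[a, b, c] \<in> tuples G 3"
        using abc by (simp add: tuples_def sym_group_carrier)
      then have "coboundary G V 1 f [a, b, c] = (\<lambda>T. 0)"
        unfolding eq by (rule restrict_apply')
      then show "f [b, c] T - f [a, c] T + f [a, b] T = 0"
        unfolding cob[OF abc] by (rule fun_cong)
    next
      assume eq: "\<forall>a b c T. a permutes {1..n} \<longrightarrow> b permutes {1..n} \<longrightarrow> c permutes {1..n} \<longrightarrow>
        f [b, c] T - f [a, c] T + f [a, b] T = 0"
      show "coboundary G V 1 f = (\<lambda>gs\<in>tuples G 3. \<lambda>T. 0)"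
      proof (rule extensionalityI[OF ext restrict_extensional])
        fix gs assume gs: "gs \<in> tuples G 3"
        then obtain a b c where abc: "gs = [a, b, c]" "a permutes {1..n}" "b permutes {1..n}" "c permutes {1..n}"
          unfolding permutes_tuples(3) by blast
        have "coboundary G V 1 f gs = (\<lambda>T. 0)"
          unfolding abc(1) cob[OF abc(2-4)] fun_eq_iff using eq abc(2-4) by blast
        then show "coboundary G V 1 f gs = (\<lambda>gs\<in>tuples G 3. \<lambda>T. 0) gs"
          unfolding restrict_apply'[OF gs] .
      qed
    qed
  qed
  have cocycle: "is_cocycle f \<longleftrightarrow> f \<in> carrier C1 \<and>
     (\<forall>a b c T. a permutes {1..n} \<longrightarrow> b permutes {1..n} \<longrightarrow> c permutes {1..n} \<longrightarrow>
        f [b, c] T - f [a, c] T + f [a, b] T = 0)" for f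
    by (simp only: is_cocycle_def carr conj_assoc)
  show ?thesis
    unfolding cocycles_def cocycle by (intro Collect_cong conj_cong refl cond)
qed

text \<open>
  An equivariant map on \<open>1\<close>-tuples is determined by its value \<open>s\<close> at the identity, and this is its
  coboundary.  The definition makes sense for every \<open>s\<close> in the permutation module.
\<close>

definition delta :: "(tabloid \<Rightarrow> 'k) \<Rightarrow> (nat \<Rightarrow> nat) list \<Rightarrow> tabloid \<Rightarrow> 'k" where
  "delta s = (\<lambda>gs\<in>tuples G 2. \<lambda>T. perm_action (gs ! 1) s T - perm_action (gs ! 0) s T)"

lemma delta_apply:
  "g permutes {1..n} \<Longrightarrow> h permutes {1..n} \<Longrightarrow> delta s [g, h] = (\<lambda>T. perm_action h s T - perm_action g s T)"
  using permutes_tuples(2) by (simp add: delta_def)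

lemma extensional_eqI:
  assumes "f \<in> extensional (tuples G 2)" "f' \<in> extensional (tuples G 2)"
    and "\<And>g h. g permutes {1..n} \<Longrightarrow> h permutes {1..n} \<Longrightarrow> f [g, h] = f' [g, h]"
  shows "f = f'"
  using assms by (intro extensionalityI[of f "tuples G 2" f']) (auto simp: permutes_tuples(2))

lemma coboundaries_eq: "coboundaries G V perm_action 1 = delta ` raising_kernel"
proof -
  let ?C0 = "cochains G V perm_action 0"
  have B: "coboundaries G V perm_action 1 = coboundary G V 0 ` carrier ?C0"
    by (simp add: coboundaries_def)
  have ext: "coboundary G V 0 f \<in> extensional (tuples G 2)" for f
    by (simp add: coboundary_def numeral_2_eq_2)
  have ext': "delta s \<in> extensional (tuples G 2)" for s
    by (simp add: delta_def)
  show ?thesis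
    unfolding B
  proof (intro equalityI image_subsetI)
    fix f assume f: "f \<in> carrier ?C0"
    have val: "f [g] \<in> raising_kernel" if "g permutes {1..n}" for g
      using f that permutes_tuples(1) by (auto simp: cochains_def V_simps)
    have eqv: "f [g] = perm_action g (f [id])" if "g permutes {1..n}" for g
    proof -
      have "\<forall>g\<in>carrier G. \<forall>gs\<in>tuples G (0 + 1).
          f (map (\<lambda>h. g \<otimes>\<^bsub>G\<^esub> h) gs) = perm_action g (f gs)"
        using f by (simp add: cochains_def)
      moreover have "g \<in> carrier G" "[id] \<in> tuples G (0 + 1)"
        using that permutes_id[of "{1..n}"] by (simp_all add: tuples_def sym_group_carrier)
      ultimately have "f (map (\<lambda>h. g \<otimes>\<^bsub>G\<^esub> h) [id]) = perm_action g (f [id])"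
        by blast
      then show ?thesis by (simp add: sym_group_mult)
    qed
    have "coboundary G V 0 f = delta (f [id])"
    proof (rule extensional_eqI[OF ext ext'])
      fix g h assume gh: "g permutes {1..n}" "h permutes {1..n}"
      show "coboundary G V 0 f [g, h] = delta (f [id]) [g, h]"
        using coboundary_0[of f, OF val gh] eqv[OF gh(1)] eqv[OF gh(2)] by (simp add: delta_apply[OF gh])
    qed
    then show "coboundary G V 0 f \<in> delta ` raising_kernel"
      using val[OF permutes_id] by blast
  next
    fix s :: "tabloid \<Rightarrow> 'k" assume s: "s \<in> raising_kernel"
    define f where "f = (\<lambda>gs\<in>tuples G 1. perm_action (gs ! 0) s)"
    have f_apply: "f [g] = perm_action g s" if "g permutes {1..n}" for g
      using that permutes_tuples(1) by (simp add: f_def)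
    have val: "f [g] \<in> raising_kernel" if "g permutes {1..n}" for g
      using perm_action_in_raising_kernel[OF that s] f_apply[OF that] by simp
    have "f \<in> tuples G 1 \<rightarrow>\<^sub>E raising_kernel"
    proof (rule PiE_I)
      fix gs assume "gs \<in> tuples G 1"
      then show "f gs \<in> raising_kernel" using val permutes_tuples(1) by auto
    qed (simp add: f_def)
    moreover have "f (map (\<lambda>h. g \<otimes>\<^bsub>G\<^esub> h) gs) = perm_action g (f gs)"
      if gs: "g \<in> carrier G" "gs \<in> tuples G 1" for g gs
    proof -
      have g: "g permutes {1..n}" using gs(1) by (simp only: sym_group_carrier)
      obtain h where h: "gs = [h]" "h permutes {1..n}" using gs(2) unfolding permutes_tuples(1) by blast
      have "f [g \<circ> h] = perm_action (g \<circ> h) s" using f_apply permutes_compose[OF h(2) g] by blast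
      then show ?thesis
        using f_apply[OF h(2)] perm_action_comp[OF g h(2)] h(1) by (simp add: sym_group_mult)
    qed
    ultimately have "f \<in> carrier ?C0"
      by (simp add: cochains_def V_simps)
    moreover have "delta s = coboundary G V 0 f"
    proof (rule extensional_eqI[OF ext' ext])
      fix g h assume gh: "g permutes {1..n}" "h permutes {1..n}"
      show "delta s [g, h] = coboundary G V 0 f [g, h]"
        using coboundary_0[of f, OF val gh] f_apply[OF gh(1)] f_apply[OF gh(2)] by (simp add: delta_apply[OF gh])
    qed
    ultimately show "delta s \<in> coboundary G V 0 ` carrier ?C0" by blast
  qed
qed

lemma is_cocycleD:
  assumes "is_cocycle f"
  shows "f \<in> extensional (tuples G 2)"
    and "g permutes {1..n} \<Longrightarrow> h permutes {1..n} \<Longrightarrow> f [g, h] \<in> raising_kernel"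
    and "q permutes {1..n} \<Longrightarrow> g permutes {1..n} \<Longrightarrow> h permutes {1..n} \<Longrightarrow>
      f [q \<circ> g, q \<circ> h] = perm_action q (f [g, h])"
    and "a permutes {1..n} \<Longrightarrow> b permutes {1..n} \<Longrightarrow> c permutes {1..n} \<Longrightarrow>
      f [b, c] T - f [a, c] T + f [a, b] T = 0"
  using assms unfolding is_cocycle_def by blast+

lemma cocycle_extensional: "is_cocycle f \<Longrightarrow> gs \<notin> tuples G 2 \<Longrightarrow> f gs = undefined"
  by (rule extensional_arb[OF is_cocycleD(1)])

lemma is_cocycle_linear:
  assumes f: "is_cocycle f" and f': "is_cocycle f'"
  shows "is_cocycle (\<lambda>gs\<in>tuples G 2. \<lambda>T. x * f gs T + y * f' gs T)" (is "is_cocycle ?f")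
proof -
  have app: "?f [g, h] = (\<lambda>T. x * f [g, h] T + y * f' [g, h] T)" if "g permutes {1..n}" "h permutes {1..n}" for g h
    using that permutes_tuples(2) by simp
  have 1: "?f [g, h] \<in> raising_kernel" if "g permutes {1..n}" "h permutes {1..n}" for g h
    unfolding app[OF that] by (intro raising_kernel_linear is_cocycleD(2) f f' that)
  have 2: "?f [q \<circ> g, q \<circ> h] = perm_action q (?f [g, h])"
    if "q permutes {1..n}" "g permutes {1..n}" "h permutes {1..n}" for q g h
    unfolding app[OF that(2,3)] app[OF permutes_compose[OF that(2,1)] permutes_compose[OF that(3,1)]] perm_action_linear
    unfolding is_cocycleD(3)[OF f that] is_cocycleD(3)[OF f' that] ..
  have 3: "?f [b, c] T - ?f [a, c] T + ?f [a, b] T = 0"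
    if abc: "a permutes {1..n}" "b permutes {1..n}" "c permutes {1..n}" for a b c T
  proof -
    have "x * (f [b, c] T - f [a, c] T + f [a, b] T) + y * (f' [b, c] T - f' [a, c] T + f' [a, b] T) = 0"
      unfolding is_cocycleD(4)[OF f abc] is_cocycleD(4)[OF f' abc] by simp
    then show ?thesis
      unfolding app[OF abc(2,3)] app[OF abc(1,3)] app[OF abc(1,2)] by (simp add: algebra_simps)
  qed
  show ?thesis
    unfolding is_cocycle_def by (intro conjI allI impI restrict_extensional 1 2 3)
qed

lemma is_cocycle_zero: "is_cocycle (\<lambda>gs\<in>tuples G 2. \<lambda>T. 0)"
proof -
  have zero_kernel: "(\<lambda>T. 0) \<in> (raising_kernel :: (tabloid \<Rightarrow> 'k) set)"
    using LinearCombinations.submodule.zero_closed[OF raising_kernel_submodule] by (simp add: perm_module_simps)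
  have zero_fixed: "perm_action q (\<lambda>T. 0 :: 'k) = (\<lambda>T. 0)" for q by (simp add: perm_action_def)
  have pair: "[g, h] \<in> tuples G 2" if "g permutes {1..n}" "h permutes {1..n}" for g h
    using that permutes_tuples(2) by blast
  have val: "(\<lambda>gs\<in>tuples G 2. \<lambda>T. 0 :: 'k) [g, h] = (\<lambda>T. 0)"
    if "g permutes {1..n}" "h permutes {1..n}" for g h
    using pair[OF that] by (rule restrict_apply')
  show ?thesis
    unfolding is_cocycle_def
  proof (intro conjI allI impI restrict_extensional)
    fix q g h assume q: "q permutes {1..n}" and g: "g permutes {1..n}" and h: "h permutes {1..n}"
    show "(\<lambda>gs\<in>tuples G 2. \<lambda>T. 0 :: 'k) [q \<circ> g, q \<circ> h] =
        perm_action q ((\<lambda>gs\<in>tuples G 2. \<lambda>T. 0) [g, h])"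
      unfolding val[OF g h] val[OF permutes_compose[OF g q] permutes_compose[OF h q]] zero_fixed ..
  qed (simp_all only: val zero_kernel diff_self add_0_right)
qed

abbreviation "Z1 \<equiv> C1 \<lparr>carrier := cocycles G V perm_action 1\<rparr>"

lemma Z1_simps:
  "carrier Z1 = {f. is_cocycle f}" "zero Z1 = zero C1" "add Z1 = add C1" "module.smult Z1 = module.smult C1"
  unfolding cocycles_eq by (simp_all only: carrier_update_simps)

lemma Z1_add_closed: "is_cocycle f \<Longrightarrow> is_cocycle f' \<Longrightarrow> is_cocycle (f \<oplus>\<^bsub>C1\<^esub> f')"
  using is_cocycle_linear[of f f' 1 1] unfolding C1_simps by (simp only: mult_1_left)

lemma Z1_smult_closed: "is_cocycle f \<Longrightarrow> is_cocycle (c \<odot>\<^bsub>C1\<^esub> f)"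
  using is_cocycle_linear[of f f c 0] unfolding C1_simps by (simp only: mult_zero_left add_0_right)

lemma Z1_module: "Module.module class_ring Z1"
proof (rule module_criteria)
  show "cring (class_ring :: 'k ring)" by (rule class_cring.is_cring)
  show "\<forall>v\<in>carrier Z1. \<exists>neg_v\<in>carrier Z1. v \<oplus>\<^bsub>Z1\<^esub> neg_v = \<zero>\<^bsub>Z1\<^esub>"
  proof
    fix v assume v: "v \<in> carrier Z1"
    then have "(- 1) \<odot>\<^bsub>C1\<^esub> v \<in> carrier Z1" using Z1_smult_closed unfolding Z1_simps by simp
    moreover have "v \<oplus>\<^bsub>Z1\<^esub> ((- 1) \<odot>\<^bsub>C1\<^esub> v) = \<zero>\<^bsub>Z1\<^esub>"
      unfolding Z1_simps C1_simps by (auto simp: restrict_def)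
    ultimately show "\<exists>neg_v\<in>carrier Z1. v \<oplus>\<^bsub>Z1\<^esub> neg_v = \<zero>\<^bsub>Z1\<^esub>" by blast
  qed
  show "\<zero>\<^bsub>Z1\<^esub> \<in> carrier Z1" unfolding Z1_simps C1_simps using is_cocycle_zero by simp
  show "\<forall>v w. v \<in> carrier Z1 \<and> w \<in> carrier Z1 \<longrightarrow> v \<oplus>\<^bsub>Z1\<^esub> w \<in> carrier Z1"
    unfolding Z1_simps using Z1_add_closed by simp
  show "\<forall>c v. c \<in> carrier (class_ring :: 'k ring) \<and> v \<in> carrier Z1 \<longrightarrow> c \<odot>\<^bsub>Z1\<^esub> v \<in> carrier Z1"
    unfolding Z1_simps using Z1_smult_closed by simp
  show "\<forall>v\<in>carrier Z1. v \<oplus>\<^bsub>Z1\<^esub> \<zero>\<^bsub>Z1\<^esub> = v"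
    unfolding Z1_simps C1_simps by (auto simp: restrict_def cocycle_extensional)
  show "\<forall>v\<in>carrier Z1. \<one>\<^bsub>class_ring :: 'k ring\<^esub> \<odot>\<^bsub>Z1\<^esub> v = v"
    unfolding Z1_simps C1_simps class_ring_simps by (auto simp: restrict_def cocycle_extensional)
next
  show "\<forall>v w. v \<in> carrier Z1 \<and> w \<in> carrier Z1 \<longrightarrow> v \<oplus>\<^bsub>Z1\<^esub> w = w \<oplus>\<^bsub>Z1\<^esub> v"
    unfolding Z1_simps C1_simps by (simp only: add.commute simp_thms)
  show "\<forall>v w x. v \<in> carrier Z1 \<and> w \<in> carrier Z1 \<and> x \<in> carrier Z1 \<longrightarrow>
      v \<oplus>\<^bsub>Z1\<^esub> w \<oplus>\<^bsub>Z1\<^esub> x = v \<oplus>\<^bsub>Z1\<^esub> (w \<oplus>\<^bsub>Z1\<^esub> x)"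
    unfolding Z1_simps C1_simps
    by (intro allI impI) (rule restrict_ext, simp only: restrict_apply' add.assoc)
  show "\<forall>a b v. a \<in> carrier (class_ring :: 'k ring) \<and> b \<in> carrier (class_ring :: 'k ring) \<and> v \<in> carrier Z1 \<longrightarrow>
      (a \<otimes>\<^bsub>class_ring\<^esub> b) \<odot>\<^bsub>Z1\<^esub> v = a \<odot>\<^bsub>Z1\<^esub> (b \<odot>\<^bsub>Z1\<^esub> v)"
    unfolding Z1_simps C1_simps class_ring_simps
    by (intro allI impI) (rule restrict_ext, simp only: restrict_apply' mult.assoc)
  show "\<forall>a b v. a \<in> carrier (class_ring :: 'k ring) \<and> b \<in> carrier (class_ring :: 'k ring) \<and> v \<in> carrier Z1 \<longrightarrow>
      (a \<oplus>\<^bsub>class_ring\<^esub> b) \<odot>\<^bsub>Z1\<^esub> v = a \<odot>\<^bsub>Z1\<^esub> v \<oplus>\<^bsub>Z1\<^esub> b \<odot>\<^bsub>Z1\<^esub> v"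
    unfolding Z1_simps C1_simps class_ring_simps
    by (intro allI impI) (rule restrict_ext, simp only: restrict_apply' distrib_right)
  show "\<forall>a v w. a \<in> carrier (class_ring :: 'k ring) \<and> v \<in> carrier Z1 \<and> w \<in> carrier Z1 \<longrightarrow>
      a \<odot>\<^bsub>Z1\<^esub> (v \<oplus>\<^bsub>Z1\<^esub> w) = a \<odot>\<^bsub>Z1\<^esub> v \<oplus>\<^bsub>Z1\<^esub> a \<odot>\<^bsub>Z1\<^esub> w"
    unfolding Z1_simps C1_simps
    by (intro allI impI) (rule restrict_ext, simp only: restrict_apply' distrib_left)
qed

lemma delta_linear:
  "(\<lambda>gs\<in>tuples G 2. \<lambda>T. x * delta s gs T + y * delta s' gs T) = delta (\<lambda>T. x * s T + y * s' T)"
proof (rule extensional_eqI)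
  fix g h assume g: "g permutes {1..n}" and h: "h permutes {1..n}"
  then have "[g, h] \<in> tuples G 2" unfolding permutes_tuples(2) by blast
  then show "(\<lambda>gs\<in>tuples G 2. \<lambda>T. x * delta s gs T + y * delta s' gs T) [g, h] =
      delta (\<lambda>T. x * s T + y * s' T) [g, h]"
    by (simp add: delta_apply[OF g h] perm_action_linear algebra_simps)
qed (simp_all add: delta_def)

lemma delta_is_cocycle:
  assumes s: "s \<in> raising_kernel"
  shows "is_cocycle (delta s)"
  unfolding is_cocycle_def
proof (intro conjI allI impI)
  show "delta s \<in> extensional (tuples G 2)" by (simp add: delta_def)
  show "delta s [g, h] \<in> raising_kernel" if "g permutes {1..n}" "h permutes {1..n}" for g h
    using raising_kernel_linear[OF perm_action_in_raising_kernel[OF that(2) s] perm_action_in_raising_kernel[OF that(1) s], of 1 "-1"]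
    by (simp add: delta_apply[OF that])
  show "delta s [q \<circ> g, q \<circ> h] = perm_action q (delta s [g, h])"
    if "q permutes {1..n}" "g permutes {1..n}" "h permutes {1..n}" for q g h
    unfolding delta_apply[OF that(2,3)] delta_apply[OF permutes_compose[OF that(2,1)] permutes_compose[OF that(3,1)]]
      perm_action_comp[OF that(1,2)] perm_action_comp[OF that(1,3)]
    by (simp add: perm_action_def)
  show "delta s [b, c] T - delta s [a, c] T + delta s [a, b] T = 0"
    if "a permutes {1..n}" "b permutes {1..n}" "c permutes {1..n}" for a b c T
    using that by (simp add: delta_apply)
qed

lemma coboundaries_submodule: "LinearCombinations.submodule class_ring (delta ` raising_kernel) Z1"
proof (rule LinearCombinations.submodule.intro[OF Z1_module])
  show "delta ` raising_kernel \<subseteq> carrier Z1"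
    unfolding Z1_simps using delta_is_cocycle by blast
  have "delta (\<lambda>T. 0) = \<zero>\<^bsub>Z1\<^esub>"
    unfolding Z1_simps C1_simps by (auto simp: delta_def perm_action_def restrict_def)
  moreover have "(\<lambda>T. 0) \<in> (raising_kernel :: (tabloid \<Rightarrow> 'k) set)"
    using LinearCombinations.submodule.zero_closed[OF raising_kernel_submodule] by (simp add: perm_module_simps)
  ultimately show "\<zero>\<^bsub>Z1\<^esub> \<in> delta ` raising_kernel" by (metis imageI)
next
  fix f f' assume "f \<in> delta ` raising_kernel" "f' \<in> delta ` raising_kernel"
  then obtain s s' where s: "s \<in> raising_kernel" "f = delta s" "s' \<in> raising_kernel" "f' = delta s'" by blast
  have "f \<oplus>\<^bsub>Z1\<^esub> f' = delta (\<lambda>T. 1 * s T + 1 * s' T)"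
    unfolding Z1_simps C1_simps s(2,4) delta_linear[symmetric] by simp
  then show "f \<oplus>\<^bsub>Z1\<^esub> f' \<in> delta ` raising_kernel"
    using raising_kernel_linear[OF s(1,3), of 1 1] by blast
next
  fix c :: 'k and f assume "f \<in> delta ` raising_kernel"
  then obtain s where s: "s \<in> raising_kernel" "f = delta s" by blast
  have "c \<odot>\<^bsub>Z1\<^esub> f = delta (\<lambda>T. c * s T + 0 * s T)"
    unfolding Z1_simps C1_simps s(2) delta_linear[symmetric] by simp
  then show "c \<odot>\<^bsub>Z1\<^esub> f \<in> delta ` raising_kernel"
    using raising_kernel_linear[OF s(1) s(1), of c 0] by blast
qed

text \<open>
  The inhomogeneous form $q \mapsto f(1, q)$ of a cocycle is a crossed homomorphism.  It is
  principal over the permutation module, and it has values in the Specht module; so the vector \<open>u\<close> is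
  fixed modulo the Specht module.
\<close>

lemma cocycle_eq_delta:
  assumes f: "is_cocycle f"
  shows "\<exists>u\<in>almost_fixed. f = delta u"
proof -
  define z where "z q = f [id, q]" for q
  have id: "id permutes {1..n}" by (rule permutes_id)
  have z_kernel: "z q \<in> raising_kernel" if "q permutes {1..n}" for q
    unfolding z_def by (rule is_cocycleD(2)[OF f id that])
  have eqv: "f [q, q \<circ> r] = perm_action q (z r)" if "q permutes {1..n}" "r permutes {1..n}" for q r
  proof -
    have "f [q \<circ> id, q \<circ> r] = perm_action q (f [id, r])"
      by (rule is_cocycleD(3)[OF f that(1) id that(2)])
    then show ?thesis by (simp add: z_def)
  qed
  have "z (q \<circ> r) = (\<lambda>T. z q T + perm_action q (z r) T)" if q: "q permutes {1..n}" and r: "r permutes {1..n}" for q r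
  proof
    fix T
    have "f [q, q \<circ> r] T - f [id, q \<circ> r] T + f [id, q] T = 0"
      by (rule is_cocycleD(4)[OF f id q permutes_compose[OF r q]])
    then show "z (q \<circ> r) T = z q T + perm_action q (z r) T"
      unfolding eqv[OF q r] z_def by (simp add: algebra_simps)
  qed
  then obtain u where u: "u \<in> carrier (perm_module la)"
      and zu: "\<And>q. q permutes {1..n} \<Longrightarrow> z q = (\<lambda>T. perm_action q u T - u T)"
    using crossed_hom_principal[OF two, of z] z_kernel by (auto simp: raising_kernel_def)
  have "u \<in> almost_fixed"
    using u zu z_kernel unfolding almost_fixed_def by auto
  moreover have "f = delta u"
  proof (rule extensional_eqI)
    show "f \<in> extensional (tuples G 2)" by (rule is_cocycleD(1)[OF f])
    show "delta u \<in> extensional (tuples G 2)" by (simp add: delta_def)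
    fix g h assume g: "g permutes {1..n}" and h: "h permutes {1..n}"
    have "f [id, h] T = f [g, h] T + f [id, g] T" for T
    proof -
      have "f [g, h] T - f [id, h] T + f [id, g] T = 0"
        by (rule is_cocycleD(4)[OF f id g h])
      then show ?thesis by (simp add: algebra_simps)
    qed
    then have "f [g, h] = (\<lambda>T. z h T - z g T)" by (simp add: z_def fun_eq_iff)
    then show "f [g, h] = delta u [g, h]"
      using zu[OF g] zu[OF h] by (simp add: delta_apply[OF g h])
  qed
  ultimately show ?thesis by blast
qed

section \<open>The first cohomology of the Specht module\<close>

lemma cohomology_dim_le_1:
  assumes p: "prime p" "p \<ge> 3" "CHAR('k) = p" and non_james: "\<not> james_partition p la"
  shows "vectorspace.fin_dim class_ring (group_cohomology 1 G V perm_action)"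
    and "vectorspace.dim class_ring (group_cohomology 1 G V perm_action) \<le> 1"
proof -
  have H: "group_cohomology 1 G V perm_action = quotient_module Z1 (delta ` raising_kernel)"
    unfolding group_cohomology_def coboundaries_eq ..
  have dep: "\<exists>a b. (a \<noteq> 0 \<or> b \<noteq> 0) \<and> (a \<odot>\<^bsub>Z1\<^esub> f) \<oplus>\<^bsub>Z1\<^esub> (b \<odot>\<^bsub>Z1\<^esub> f') \<in> delta ` raising_kernel"
    if ff': "f \<in> carrier Z1" "f' \<in> carrier Z1" for f f'
  proof -
    obtain u u' where u: "u \<in> almost_fixed" "f = delta u" and u': "u' \<in> almost_fixed" "f' = delta u'"
      using cocycle_eq_delta ff' unfolding Z1_simps by blast
    obtain x y z where xy: "x \<noteq> 0 \<or> y \<noteq> 0"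
      and s: "(\<lambda>T. x * u T + y * u' T + z * all_ones T) \<in> raising_kernel"
      using combination_in_raising_kernel[OF p non_james u(1) u'(1)] by blast
    have "(x \<odot>\<^bsub>Z1\<^esub> f) \<oplus>\<^bsub>Z1\<^esub> (y \<odot>\<^bsub>Z1\<^esub> f') = delta (\<lambda>T. x * u T + y * u' T + z * all_ones T)"
    proof (rule extensional_eqI)
      fix g h assume g: "g permutes {1..n}" and h: "h permutes {1..n}"
      have act: "perm_action q (\<lambda>T. x * u T + y * u' T + z * all_ones T) =
          (\<lambda>T. x * perm_action q u T + y * perm_action q u' T + z * all_ones T)" if "q permutes {1..n}" for q
        using fun_cong[OF perm_action_all_ones[OF that, where ?'a = 'k]] by (simp add: perm_action_def)
      show "((x \<odot>\<^bsub>Z1\<^esub> f) \<oplus>\<^bsub>Z1\<^esub> (y \<odot>\<^bsub>Z1\<^esub> f')) [g, h] =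
          delta (\<lambda>T. x * u T + y * u' T + z * all_ones T) [g, h]"
        unfolding delta_apply[OF g h] act[OF g] act[OF h] Z1_simps C1_simps u(2) u'(2)
        using g h permutes_tuples(2) by (simp add: delta_apply algebra_simps)
    next
      show "(x \<odot>\<^bsub>Z1\<^esub> f) \<oplus>\<^bsub>Z1\<^esub> (y \<odot>\<^bsub>Z1\<^esub> f') \<in> extensional (tuples G 2)"
        unfolding Z1_simps C1_simps by (rule restrict_extensional)
    qed (simp add: delta_def)
    then show ?thesis using xy s by blast
  qed
  show "vectorspace.fin_dim class_ring (group_cohomology 1 G V perm_action)"
    unfolding H by (rule quotient_dim_le_1(1)[OF Z1_module coboundaries_submodule dep])
  show "vectorspace.dim class_ring (group_cohomology 1 G V perm_action) \<le> 1"
    unfolding H by (rule quotient_dim_le_1(2)[OF Z1_module coboundaries_submodule dep])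
qed

end

end

theorem theorem26:
  fixes p n :: nat and la :: "nat list"
  assumes "prime p" and "p \<ge> 3" and "CHAR('k :: field) = p"
    and "partition_of la n" and "\<not> james_partition p la"
  shows "let H1 = group_cohomology 1 (sym_group n) (specht_module la :: ('k, _) module) perm_action
         in vectorspace.fin_dim class_ring H1 \<and> vectorspace.dim class_ring H1 \<le> 1"
proof -
  interpret partition_shape la n by unfold_locales fact
  have "\<not> p dvd 2" using assms(2) by (auto dest: dvd_imp_le)
  then have two: "(2 :: 'k) \<noteq> 0"
    using of_nat_eq_0_iff_char_dvd[where 'a = 'k, of 2] assms(3) by simp
  show ?thesis
    unfolding Let_def
    using cohomology_dim_le_1[OF two refl assms(1-3,5)] by blast
qed

end
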